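(* Assume (A1), (A2), (B1), (B2), (B3), (B5) and (C) (written out in the context), and assume that $f$ is not constant $\mu$-a.s. If $\limsup_{\alpha\to0}\alpha v_\alpha(z)=\lambda>\mu(f)$, then $\hat\lambda_N$ is a constant function (of $x\in E$) for sufficiently large $N$ and $\hat\lambda_N(x)\to\hat\lambda(x)$ as $N\to\infty$; so, in particular, $\hat\lambda$ is a constant function on $E$.
   Context: Setting. $(X_t)$ is a Feller-Markov process with right-continuous, left-limited paths and values in a locally compact space $E$ with metric $\rho$ and Borel $\sigma$-field $\mathcal E$; $(\mathcal F_t)$ is its filtration, $\mathbb P^x,\mathbb E^x$ the law and expectation when started at $x$, $P_t\phi(x)=\mathbb E^x\{\phi(X_t)\}$, $P_t(x,\cdot)=\mathbb P^x\{X_t\in\cdot\}$. $U\subseteq E$ is compact, $f:E\to\mathbb R$ is continuous and bounded, $\|\cdot\|$ is the supremum norm, and the impulse cost $c:E\times U\to\mathbb R$ is continuous, negative and bounded away from zero. A point $z\in U$ is fixed. Impulse strategies. A strategy $V=(\tau_i,\xi_i)_{i\ge1}$ is an increasing (non-decreasing) sequence of stopping times $\tau_i\in[0,\infty]$ and $U$-valued $\mathcal F_{\tau_i}$-measurable random variables $\xi_i$; it is admissible for $x$ if $\tau_i\to\infty$ $\mathbb P^x$-a.s., and integrable if in addition $\mathbb E^x\{\tau_i\}<\infty$ for all $i$. The controlled process (also denoted $X$, under $\mathbb P^x$) is realised on the countable product of the canonical path space $D(\mathbb R^+,E)$ with coordinates $x^1,x^2,\dots$: $x^1$ has the law of the uncontrolled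 process from $x$; $\tau_n$ is a stopping time, and $\xi_n$ is measurable, with respect to the filtration generated by $x^1,\dots,x^n$; after $\tau_n$ the coordinate $x^{n+1}$ evolves as the uncontrolled process restarted at time $\tau_n$ from $\xi_n$; $X_t=x^n_t$ for $t\in[\tau_{n-1},\tau_n)$, $\tau_0=0$. $X_{\tau_i-}:=x^i_{\tau_i}$ is the state just before the $i$-th impulse. Functionals. For $\alpha>0$, $v_\alpha(x)=\sup_V\mathbb E^x\{\int_0^\infty e^{-\alpha s}f(X_s)ds+\sum_{i\ge1}1_{\tau_i<\infty}e^{-\alpha\tau_i}c(X_{\tau_i-},\xi_i)\}$ over admissible $V$. With $B_{z,N}$ the ball with centre $z$ and radius $N$ and $\rho(x,A)$ the distance from $x$ to $A$, let $\tilde f_N(x)=f(x)(1-\rho(x,B_{z,N}))^++(\|f\|+1)(1-\rho(x,B_{z,N+1}^c))^+$. For integrable $V$ put $\hat J(x,V)=\liminf_{n\to\infty}\frac1{\mathbb E^x\{\tau_n\}}\mathbb E^x\{\int_0^{\tau_n}f(X_s)ds+\sum_{i=1}^nc(X_{\tau_i-},\xi_i)\}$, $\hat J^{N,c}(x,V)=\liminf_{n\to\infty}\frac1{\mathbb E^x\{\tau_n\}}\mathbb E^x\{\int_0^{\tau_n}\tilde f_N(X_s)ds+\sum_{i=1}^nc(X_{\tau_i-},\xi_i)\}$, and $\hat\lambda(x)=\sup_V\hat J(x,V)$, $\hat\lambda_N(x)=\sup_V\hat J^{N,c}(x,V)$, suprema over integrable strategies. Notation. $\mu(f)=\int f\,d\mu$;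 $\underline c(x)=\inf_{a\in U}c(x,a)$; $D_U=\inf\{s\ge0:X_s\in U\}$ (uncontrolled process). Assumptions. (A1) $P_t\mathcal C_0\subseteq\mathcal C_0$, where $\mathcal C_0$ is the space of continuous bounded functions on $E$ vanishing at infinity. (A2) There are a unique probability measure $\mu$ on $\mathcal E$, a function $K:E\to(0,\infty)$ bounded on compacts and $h:[0,\infty)\to\mathbb R_+$ with $\int_0^\infty h(t)dt<\infty$ such that $\|P_t(x,\cdot)-\mu\|_{TV}\le K(x)h(t)$ for all $x\in E$ (total variation norm). Furthermore $\mathbb E^x\{K(X_T)\}<\infty$ for each $T\ge0$, and for any compact $\Gamma\subset E$ and any sets $A_T\in\mathcal F_T$, $\lim_{T\to\infty}\sup_{x\in\Gamma}\mathbb P^x\{A_T\}=0$ implies $\lim_{T\to\infty}\sup_{x\in\Gamma}\mathbb E^x\{1_{A_T}K(X_T)\}=0$. (B1) There is a constant $c_0<0$ with $c(x,x')\le c_0$ for $(x,x')\in E\times U$, and $c(x,y)\ge c(x,y')+c(y',y)$ for $x\in E$, $y,y'\in U$. (B2) For any compact $\Gamma\subset E$ and $T>0$, with $\zeta_T=\sup_{t\in[0,T]}|\underline c(X_t)|$, $\lim_{n\to\infty}\sup_{y\in\Gamma}\mathbb E^y\{\zeta_T1_{\zeta_T>n}\}=0$. (B3) $\sup_{x\in\Gamma}\mathbb E^x\{D_U\}<\infty$ for any compact $\Gamma\subset E$. (B5) For any compact $\Gamma\subset E$ and events $A_T\in\mathcal F_T$, $T>0$: $\lim_{T\to\infty}\sup_{x\in\Gamma}\mathbb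 P^x\{A_T\}=0$ implies $\lim_{T\to\infty}\sup_{x\in\Gamma}\mathbb E^x\{1_{A_T}|\underline c(X_T)|\}=0$. (C) $\sup_{x\in U}\sup_\tau\dfrac{\mathbb E^x\{\int_0^\tau1_{B_{z,N}^c}(X_s)ds\}}{\mathbb E^x\{\tau\}}\to0$ as $N\to\infty$ (uncontrolled process; $\tau$ ranges over stopping times with $0<\mathbb E^x\{\tau\}<\infty$). *)

theory Defs
  imports "HOL-Probability.Probability"
begin

section \<open>The uncontrolled process\<close>

text \<open>
  Time is the set of nonnegative reals. A path is an extensional function on \<open>{0..}\<close>; its values
  at negative arguments are the dummy value of extensional functions and carry no information.
\<close>

definition cadlag :: "(real \<Rightarrow> 'a::metric_space) \<Rightarrow> bool" where
  "cadlag \<omega> \<longleftrightarrow>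
     (\<forall>t\<ge>0. (\<omega> \<longlongrightarrow> \<omega> t) (at_right t)) \<and> (\<forall>t>0. \<exists>l. (\<omega> \<longlongrightarrow> l) (at_left t))"

definition path_space :: "(real \<Rightarrow> 'a::metric_space) measure" where
  "path_space = restrict_space (Pi\<^sub>M {0..} (\<lambda>_. borel)) {\<omega>. cadlag \<omega>}"

text \<open>
  The natural filtration \<open>\<sigma>(X\<^sub>s : s \<le> t)\<close> for \<open>t \<in> [0,\<infinity>]\<close>. Indexing by \<^typ>\<open>ennreal\<close> lets the
  library notions of stopping time and of the \<open>\<sigma>\<close>-field of a stopping time apply to
  \<open>[0,\<infinity>]\<close>-valued times.
\<close>

definition path_filtration :: "ennreal \<Rightarrow> (real \<Rightarrow> 'a::metric_space) measure" where
  "path_filtration t =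
     vimage_algebra (space path_space) (\<lambda>\<omega>. restrict \<omega> {s. 0 \<le> s \<and> ennreal s \<le> t})
       (Pi\<^sub>M {s. 0 \<le> s \<and> ennreal s \<le> t} (\<lambda>_. borel))"

definition shift :: "real \<Rightarrow> (real \<Rightarrow> 'a) \<Rightarrow> real \<Rightarrow> 'a" where
  "shift t \<omega> = restrict (\<lambda>s. \<omega> (t + s)) {0..}"

locale markov_process =
  fixes P :: "'a::metric_space \<Rightarrow> (real \<Rightarrow> 'a) measure"
  assumes kernel: "P \<in> borel \<rightarrow>\<^sub>M prob_algebra path_space"
    and start: "\<And>x. AE \<omega> in P x. \<omega> 0 = x"
    and markov: "\<And>x t A B. 0 \<le> t \<Longrightarrow> A \<in> sets (path_filtration (ennreal t)) \<Longrightarrow> B \<in> sets path_space \<Longrightarrow>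
      emeasure (P x) {\<omega> \<in> A. shift t \<omega> \<in> B} = (\<integral>\<^sup>+\<omega>\<in>A. emeasure (P (\<omega> t)) B \<partial>P x)"

definition transition :: "('a::metric_space \<Rightarrow> (real \<Rightarrow> 'a) measure) \<Rightarrow> real \<Rightarrow> 'a \<Rightarrow> 'a measure" where
  "transition P t x = distr (P x) borel (\<lambda>\<omega>. \<omega> t)"

definition semigroup :: "('a::metric_space \<Rightarrow> (real \<Rightarrow> 'a) measure) \<Rightarrow> real \<Rightarrow> ('a \<Rightarrow> real) \<Rightarrow> 'a \<Rightarrow> real" where
  "semigroup P t \<phi> x = (\<integral>\<omega>. \<phi> (\<omega> t) \<partial>P x)"

definition entry_time :: "'a set \<Rightarrow> (real \<Rightarrow> 'a) \<Rightarrow> ennreal" where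
  "entry_time U \<omega> = (INF s\<in>{s. 0 \<le> s \<and> \<omega> s \<in> U}. ennreal s)"


section \<open>Impulse strategies and the controlled process\<close>

text \<open>
  Coordinates and impulses are numbered from \<open>0\<close>: coordinate \<open>k\<close> of \<open>\<omega>\<close> is \<open>x\<^sup>k\<^sup>+\<^sup>1\<close>, and
  \<open>(fst V k, snd V k)\<close> is \<open>(\<tau>\<^sub>k\<^sub>+\<^sub>1, \<xi>\<^sub>k\<^sub>+\<^sub>1)\<close>. Times and targets are functions of the history
  \<open>(x\<^sup>1,\<dots>,x\<^sup>k\<^sup>+\<^sup>1)\<close>, an element of the product over \<open>{0..<Suc k}\<close>. The product of the natural
  filtrations is the filtration generated jointly by these coordinates.
\<close>

type_synonym 'a history = "nat \<Rightarrow> real \<Rightarrow> 'a"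
type_synonym 'a strategy = "(nat \<Rightarrow> 'a history \<Rightarrow> ennreal) \<times> (nat \<Rightarrow> 'a history \<Rightarrow> 'a)"

definition history_space :: "nat \<Rightarrow> 'a::metric_space history measure" where
  "history_space n = Pi\<^sub>M {0..<n} (\<lambda>_. path_space)"

definition history_filtration :: "nat \<Rightarrow> ennreal \<Rightarrow> 'a::metric_space history measure" where
  "history_filtration n t = Pi\<^sub>M {0..<n} (\<lambda>_. path_filtration t)"

definition impulse_strategy :: "'a::metric_space set \<Rightarrow> 'a strategy \<Rightarrow> bool" where
  "impulse_strategy U V \<longleftrightarrow>
     (\<forall>n. stopping_time (history_filtration (Suc n)) (fst V n)) \<and>
     (\<forall>n. snd V n \<in> filtration.pre_sigma (space (history_space (Suc n)))
             (history_filtration (Suc n)) (fst V n) \<rightarrow>\<^sub>M borel) \<and>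
     (\<forall>n. \<forall>h\<in>space (history_space (Suc n)). snd V n h \<in> U) \<and>
     (\<forall>n. \<forall>h\<in>space (history_space (Suc (Suc n))).
        fst V n (restrict h {0..<Suc n}) \<le> fst V (Suc n) h)"

text \<open>
  The path that follows \<open>\<omega>\<close> before time \<open>T\<close> and a copy of \<open>\<omega>'\<close> restarted at \<open>T\<close> from then on;
  it is \<open>\<omega>\<close> if \<open>T = \<infinity>\<close>.
\<close>

definition splice :: "(real \<Rightarrow> 'a) \<Rightarrow> ennreal \<Rightarrow> (real \<Rightarrow> 'a) \<Rightarrow> real \<Rightarrow> 'a" where
  "splice \<omega> T \<omega>' = restrict (\<lambda>t. if ennreal t < T then \<omega> t else \<omega>' (t - enn2real T)) {0..}"

text \<open>
  Conditional law of the next coordinate given the previous ones. From \<open>\<tau>\<^sub>n\<close> on, \<open>x\<^sup>n\<^sup>+\<^sup>1\<close> is a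
  copy of the uncontrolled process started from \<open>\<xi>\<^sub>n\<close>. Before \<open>\<tau>\<^sub>n\<close>, where it plays no role for the
  controlled process, it is set equal to \<open>x\<^sup>n\<close>, so that it reveals nothing new.
\<close>

definition coordinate_kernel ::
    "('a::metric_space \<Rightarrow> (real \<Rightarrow> 'a) measure) \<Rightarrow> 'a strategy \<Rightarrow> 'a \<Rightarrow> nat \<Rightarrow> 'a history \<Rightarrow> (real \<Rightarrow> 'a) measure" where
  "coordinate_kernel P V x n h =
     (case n of 0 \<Rightarrow> P x
      | Suc m \<Rightarrow> distr (P (snd V m h)) path_space (splice (h m) (fst V m h)))"

text \<open>
  The law \<open>\<P>\<^sup>x\<close> of \<open>(x\<^sup>1, x\<^sup>2, \<dots>)\<close> under a strategy: the Ionescu-Tulcea measure with the above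
  kernels (lemma \<open>Ionescu_Tulcea_coordinate_kernel\<close> below shows that these satisfy the
  requirements of the library construction).
\<close>

definition controlled_law ::
    "('a::metric_space \<Rightarrow> (real \<Rightarrow> 'a) measure) \<Rightarrow> 'a strategy \<Rightarrow> 'a \<Rightarrow> 'a history measure" where
  "controlled_law P V x =
     projective_family.lim UNIV
       (Ionescu_Tulcea.CI (coordinate_kernel P V x) (\<lambda>_. path_space)) (\<lambda>_. path_space)"

definition impulse_time :: "'a strategy \<Rightarrow> nat \<Rightarrow> 'a history \<Rightarrow> ennreal" where
  "impulse_time V n \<omega> = fst V n (restrict \<omega> {0..<Suc n})"

definition impulse_target :: "'a strategy \<Rightarrow> nat \<Rightarrow> 'a history \<Rightarrow> 'a" where
  "impulse_target V n \<omega> = snd V n (restrict \<omega> {0..<Suc n})"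

definition pre_impulse_state :: "'a strategy \<Rightarrow> nat \<Rightarrow> 'a history \<Rightarrow> 'a" where
  "pre_impulse_state V n \<omega> = \<omega> n (enn2real (impulse_time V n \<omega>))"

text \<open>
  The value at \<open>t\<close> is read off the coordinate whose index is that of the first impulse after \<open>t\<close>.
  Such an impulse exists for all \<open>t\<close> almost surely if the strategy is admissible.
\<close>

definition controlled_process :: "'a strategy \<Rightarrow> real \<Rightarrow> 'a history \<Rightarrow> 'a" where
  "controlled_process V t \<omega> = \<omega> (LEAST n. ennreal t < impulse_time V n \<omega>) t"

definition admissible ::
    "('a::metric_space \<Rightarrow> (real \<Rightarrow> 'a) measure) \<Rightarrow> 'a set \<Rightarrow> 'a \<Rightarrow> 'a strategy \<Rightarrow> bool" where
  "admissible P U x V \<longleftrightarrow> impulse_strategy U V \<and>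
     (AE \<omega> in controlled_law P V x. (\<lambda>n. impulse_time V n \<omega>) \<longlonglongrightarrow> \<infinity>)"

definition expected_time ::
    "('a::metric_space \<Rightarrow> (real \<Rightarrow> 'a) measure) \<Rightarrow> 'a strategy \<Rightarrow> 'a \<Rightarrow> nat \<Rightarrow> ennreal" where
  "expected_time P V x n = (\<integral>\<^sup>+\<omega>. impulse_time V n \<omega> \<partial>controlled_law P V x)"

definition integrable_strategy ::
    "('a::metric_space \<Rightarrow> (real \<Rightarrow> 'a) measure) \<Rightarrow> 'a set \<Rightarrow> 'a \<Rightarrow> 'a strategy \<Rightarrow> bool" where
  "integrable_strategy P U x V \<longleftrightarrow> admissible P U x V \<and> (\<forall>n. expected_time P V x n < \<infinity>)"


section \<open>Functionals\<close>

text \<open>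
  Expectation of a random variable whose positive part is integrable; the value \<open>-\<infinity>\<close> is possible,
  since impulse costs are unbounded below.
\<close>

definition expectation_ereal :: "'b measure \<Rightarrow> ('b \<Rightarrow> ereal) \<Rightarrow> ereal" where
  "expectation_ereal M g =
     enn2ereal (\<integral>\<^sup>+\<omega>. e2ennreal (g \<omega>) \<partial>M) - enn2ereal (\<integral>\<^sup>+\<omega>. e2ennreal (- g \<omega>) \<partial>M)"

definition discounted_reward ::
    "('a::metric_space \<Rightarrow> (real \<Rightarrow> 'a) measure) \<Rightarrow> ('a \<Rightarrow> real) \<Rightarrow> ('a \<Rightarrow> 'a \<Rightarrow> real) \<Rightarrow> real \<Rightarrow> 'a \<Rightarrow> 'a strategy \<Rightarrow> ereal" where
  "discounted_reward P f c \<alpha> x V =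
     expectation_ereal (controlled_law P V x) (\<lambda>\<omega>.
       ereal (LINT s:{0..}|lborel. exp (- \<alpha> * s) * f (controlled_process V s \<omega>)) +
       (\<Sum>n. if impulse_time V n \<omega> < \<infinity>
            then ereal (exp (- \<alpha> * enn2real (impulse_time V n \<omega>)) *
                   c (pre_impulse_state V n \<omega>) (impulse_target V n \<omega>))
            else 0))"

definition discounted_value ::
    "('a::metric_space \<Rightarrow> (real \<Rightarrow> 'a) measure) \<Rightarrow> 'a set \<Rightarrow> ('a \<Rightarrow> real) \<Rightarrow> ('a \<Rightarrow> 'a \<Rightarrow> real) \<Rightarrow> real \<Rightarrow> 'a \<Rightarrow> ereal" where
  "discounted_value P U f c \<alpha> x = (SUP V\<in>{V. admissible P U x V}. discounted_reward P f c \<alpha> x V)"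

definition average_reward ::
    "('a::metric_space \<Rightarrow> (real \<Rightarrow> 'a) measure) \<Rightarrow> ('a \<Rightarrow> real) \<Rightarrow> ('a \<Rightarrow> 'a \<Rightarrow> real) \<Rightarrow> 'a \<Rightarrow> 'a strategy \<Rightarrow> ereal" where
  "average_reward P f c x V =
     liminf (\<lambda>n.
       expectation_ereal (controlled_law P V x) (\<lambda>\<omega>.
         ereal ((LINT s:{s. 0 \<le> s \<and> ennreal s \<le> impulse_time V n \<omega>}|lborel. f (controlled_process V s \<omega>)) +
           (\<Sum>i\<le>n. c (pre_impulse_state V i \<omega>) (impulse_target V i \<omega>))))
       / enn2ereal (expected_time P V x n))"

definition average_value ::
    "('a::metric_space \<Rightarrow> (real \<Rightarrow> 'a) measure) \<Rightarrow> 'a set \<Rightarrow> ('a \<Rightarrow> real) \<Rightarrow> ('a \<Rightarrow> 'a \<Rightarrow> real) \<Rightarrow> 'a \<Rightarrow> ereal" where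
  "average_value P U f c x = (SUP V\<in>{V. integrable_strategy P U x V}. average_reward P f c x V)"

text \<open>
  \<open>(1 - \<rho>(x,A))\<^sup>+\<close> with the convention \<open>\<rho>(x,\<emptyset>) = \<infinity>\<close>; the library sets \<open>infdist x {} = 0\<close>. The empty
  set occurs as the complement of a ball when the space is bounded.
\<close>

definition proximity :: "'a::metric_space set \<Rightarrow> 'a \<Rightarrow> real" where
  "proximity A x = (if A = {} then 0 else max 0 (1 - infdist x A))"

definition truncated_reward :: "('a::metric_space \<Rightarrow> real) \<Rightarrow> 'a \<Rightarrow> real \<Rightarrow> 'a \<Rightarrow> real" where
  "truncated_reward f z N x =
     f x * proximity (cball z N) x +
     ((SUP y. \<bar>f y\<bar>) + 1) * proximity (- cball z (N + 1)) x"

definition truncated_value ::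
    "('a::metric_space \<Rightarrow> (real \<Rightarrow> 'a) measure) \<Rightarrow> 'a set \<Rightarrow> ('a \<Rightarrow> real) \<Rightarrow> ('a \<Rightarrow> 'a \<Rightarrow> real) \<Rightarrow> 'a \<Rightarrow> real \<Rightarrow> 'a \<Rightarrow> ereal" where
  "truncated_value P U f c z N x = average_value P U (truncated_reward f z N) c x"


section \<open>Assumptions\<close>

definition C0 :: "('a::metric_space \<Rightarrow> real) set" where
  "C0 = {\<phi>. continuous_on UNIV \<phi> \<and> bounded (range \<phi>) \<and>
          (\<forall>\<epsilon>>0. \<exists>K. compact K \<and> (\<forall>x. x \<notin> K \<longrightarrow> \<bar>\<phi> x\<bar> < \<epsilon>))}"

definition assumption_A1 :: "('a::metric_space \<Rightarrow> (real \<Rightarrow> 'a) measure) \<Rightarrow> bool" where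
  "assumption_A1 P \<longleftrightarrow> (\<forall>t\<ge>0. \<forall>\<phi>\<in>C0. semigroup P t \<phi> \<in> C0)"

text \<open>
  Total variation norm \<open>\<bar>\<nu>\<bar>(E)\<close> of \<open>\<nu> = M - N\<close>; by the Hahn decomposition it is the supremum of
  \<open>\<bar>\<nu>(A)\<bar> + \<bar>\<nu>(E - A)\<bar>\<close>.
\<close>

definition tv_norm_diff :: "'b measure \<Rightarrow> 'b measure \<Rightarrow> real" where
  "tv_norm_diff M N =
     (SUP A\<in>sets M. \<bar>measure M A - measure N A\<bar> +
        \<bar>measure M (space M - A) - measure N (space M - A)\<bar>)"

definition ergodic_bound ::
    "('a::metric_space \<Rightarrow> (real \<Rightarrow> 'a) measure) \<Rightarrow> 'a measure \<Rightarrow> ('a \<Rightarrow> real) \<Rightarrow> (real \<Rightarrow> real) \<Rightarrow> bool" where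
  "ergodic_bound P \<mu> K h \<longleftrightarrow>
     prob_space \<mu> \<and> sets \<mu> = sets borel \<and>
     (\<forall>x. 0 < K x) \<and> (\<forall>\<Gamma>. compact \<Gamma> \<longrightarrow> bdd_above (K ` \<Gamma>)) \<and>
     (\<forall>t\<ge>0. 0 \<le> h t) \<and> set_integrable lborel {0..} h \<and>
     (\<forall>x. \<forall>t\<ge>0. tv_norm_diff (transition P t x) \<mu> \<le> K x * h t)"

definition uniformly_negligible ::
    "('a::metric_space \<Rightarrow> (real \<Rightarrow> 'a) measure) \<Rightarrow> ('a \<Rightarrow> real) \<Rightarrow> bool" where
  "uniformly_negligible P g \<longleftrightarrow>
     (\<forall>\<Gamma> A. compact \<Gamma> \<longrightarrow> (\<forall>T>0. A T \<in> sets (path_filtration (ennreal T))) \<longrightarrow>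
        ((\<lambda>T. SUP x\<in>\<Gamma>. emeasure (P x) (A T)) \<longlongrightarrow> 0) at_top \<longrightarrow>
        ((\<lambda>T. SUP x\<in>\<Gamma>. \<integral>\<^sup>+\<omega>\<in>A T. ennreal (g (\<omega> T)) \<partial>P x) \<longlongrightarrow> 0) at_top)"

text \<open>The measure \<open>\<mu>\<close> is a parameter, since it occurs elsewhere; \<open>K\<close> and \<open>h\<close> do not.\<close>

definition assumption_A2 :: "('a::metric_space \<Rightarrow> (real \<Rightarrow> 'a) measure) \<Rightarrow> 'a measure \<Rightarrow> bool" where
  "assumption_A2 P \<mu> \<longleftrightarrow>
     (\<exists>K h. ergodic_bound P \<mu> K h \<and>
        (\<forall>T\<ge>0. \<forall>x. integrable (P x) (\<lambda>\<omega>. K (\<omega> T))) \<and>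
        uniformly_negligible P K) \<and>
     (\<forall>\<nu> K h. ergodic_bound P \<nu> K h \<longrightarrow> \<nu> = \<mu>)"

definition assumption_B1 :: "'a set \<Rightarrow> ('a \<Rightarrow> 'a \<Rightarrow> real) \<Rightarrow> bool" where
  "assumption_B1 U c \<longleftrightarrow>
     (\<exists>c0<0. \<forall>x. \<forall>y\<in>U. c x y \<le> c0) \<and>
     (\<forall>x. \<forall>y\<in>U. \<forall>y'\<in>U. c x y \<ge> c x y' + c y' y)"

definition least_cost :: "'a set \<Rightarrow> ('a \<Rightarrow> 'a \<Rightarrow> real) \<Rightarrow> 'a \<Rightarrow> real" where
  "least_cost U c x = (INF a\<in>U. c x a)"

definition cost_sup :: "'a set \<Rightarrow> ('a \<Rightarrow> 'a \<Rightarrow> real) \<Rightarrow> real \<Rightarrow> (real \<Rightarrow> 'a) \<Rightarrow> ennreal" where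
  "cost_sup U c T \<omega> = (SUP t\<in>{0..T}. ennreal \<bar>least_cost U c (\<omega> t)\<bar>)"

definition assumption_B2 ::
    "('a::metric_space \<Rightarrow> (real \<Rightarrow> 'a) measure) \<Rightarrow> 'a set \<Rightarrow> ('a \<Rightarrow> 'a \<Rightarrow> real) \<Rightarrow> bool" where
  "assumption_B2 P U c \<longleftrightarrow>
     (\<forall>\<Gamma> T. compact \<Gamma> \<longrightarrow> 0 < T \<longrightarrow>
        (\<lambda>n. SUP y\<in>\<Gamma>. \<integral>\<^sup>+\<omega>\<in>{\<omega>. of_nat n < cost_sup U c T \<omega>}. cost_sup U c T \<omega> \<partial>P y) \<longlonglongrightarrow> 0)"

text \<open>
  The entry time into \<open>U\<close> is measurable only with respect to the completion of \<open>P x\<close> in general;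
  by \<open>nn_integral_completion\<close> the integral below is its integral with respect to the completion.
\<close>

definition assumption_B3 :: "('a::metric_space \<Rightarrow> (real \<Rightarrow> 'a) measure) \<Rightarrow> 'a set \<Rightarrow> bool" where
  "assumption_B3 P U \<longleftrightarrow>
     (\<forall>\<Gamma>. compact \<Gamma> \<longrightarrow> (SUP x\<in>\<Gamma>. \<integral>\<^sup>+\<omega>. entry_time U \<omega> \<partial>P x) < \<infinity>)"

definition assumption_B5 ::
    "('a::metric_space \<Rightarrow> (real \<Rightarrow> 'a) measure) \<Rightarrow> 'a set \<Rightarrow> ('a \<Rightarrow> 'a \<Rightarrow> real) \<Rightarrow> bool" where
  "assumption_B5 P U c \<longleftrightarrow> uniformly_negligible P (\<lambda>x. \<bar>least_cost U c x\<bar>)"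

definition occupation_time :: "'a set \<Rightarrow> ennreal \<Rightarrow> (real \<Rightarrow> 'a) \<Rightarrow> ennreal" where
  "occupation_time A T \<omega> = (\<integral>\<^sup>+s\<in>{s. 0 \<le> s \<and> ennreal s \<le> T}. indicator A (\<omega> s) \<partial>lborel)"

definition assumption_C :: "('a::metric_space \<Rightarrow> (real \<Rightarrow> 'a) measure) \<Rightarrow> 'a set \<Rightarrow> 'a \<Rightarrow> bool" where
  "assumption_C P U z \<longleftrightarrow>
     ((\<lambda>N. SUP x\<in>U. SUP \<tau>\<in>{\<tau>. stopping_time path_filtration \<tau> \<and>
                        0 < (\<integral>\<^sup>+\<omega>. \<tau> \<omega> \<partial>P x) \<and> (\<integral>\<^sup>+\<omega>. \<tau> \<omega> \<partial>P x) < \<infinity>}.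
          (\<integral>\<^sup>+\<omega>. occupation_time (- cball z N) (\<tau> \<omega>) \<omega> \<partial>P x) / (\<integral>\<^sup>+\<omega>. \<tau> \<omega> \<partial>P x))
      \<longlongrightarrow> 0) at_top"


section \<open>Well-definedness of the controlled law\<close>

lemma cadlag_cong:
  assumes "\<And>t. 0 \<le> t \<Longrightarrow> \<omega> t = \<omega>' t" and "cadlag \<omega>"
  shows "cadlag \<omega>'"
  unfolding cadlag_def
proof safe
  fix t :: real assume t: "0 \<le> t"
  have "(\<omega> \<longlongrightarrow> \<omega> t) (at_right t)" using assms(2) t by (simp add: cadlag_def)
  moreover have "\<forall>\<^sub>F s in at_right t. \<omega> s = \<omega>' s"
    using t assms(1) by (auto simp: eventually_at_right_field intro!: exI[of _ "t + 1"])
  ultimately show "(\<omega>' \<longlongrightarrow> \<omega>' t) (at_right t)"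
    using tendsto_cong assms(1)[OF t] by metis
next
  fix t :: real assume t: "0 < t"
  obtain l where "(\<omega> \<longlongrightarrow> l) (at_left t)" using assms(2) t by (auto simp: cadlag_def)
  moreover have "\<forall>\<^sub>F s in at_left t. \<omega> s = \<omega>' s"
    using t assms(1) by (auto simp: eventually_at_left_field intro!: exI[of _ 0])
  ultimately show "\<exists>l. (\<omega>' \<longlongrightarrow> l) (at_left t)"
    using tendsto_cong by metis
qed

lemma cadlag_splice:
  fixes \<omega> \<omega>' :: "real \<Rightarrow> 'a::metric_space"
  assumes w: "cadlag \<omega>" and w': "cadlag \<omega>'"
  shows "cadlag (splice \<omega> T \<omega>')"
proof (cases "T = \<infinity>")
  case True
  then show ?thesis by (intro cadlag_cong[OF _ w]) (simp add: splice_def)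
next
  case False
  define r where "r = enn2real T"
  have r: "0 \<le> r" "T = ennreal r" using False by (auto simp: r_def top.not_eq_extremum)
  define g where "g = (\<lambda>t. if t < r then \<omega> t else \<omega>' (t - r))"
  have "cadlag g"
    unfolding cadlag_def
  proof safe
    fix t :: real assume t: "0 \<le> t"
    show "(g \<longlongrightarrow> g t) (at_right t)"
    proof (cases "t < r")
      case True
      have "(\<omega> \<longlongrightarrow> g t) (at_right t)" using w t True by (simp add: cadlag_def g_def)
      moreover have "\<forall>\<^sub>F s in at_right t. \<omega> s = g s"
        using True by (auto simp: eventually_at_right_field g_def intro!: exI[of _ r])
      ultimately show ?thesis by (rule Lim_transform_eventually)
    next
      case False
      have "(\<omega>' \<longlongrightarrow> g t) (at_right (t - r))" using w' False by (simp add: cadlag_def g_def)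
      moreover have "filterlim (\<lambda>s. s - r) (at_right (t - r)) (at_right t)"
        by (auto simp: filterlim_at eventually_at_filter intro!: tendsto_intros)
      ultimately have "((\<lambda>s. \<omega>' (s - r)) \<longlongrightarrow> g t) (at_right t)"
        by (rule filterlim_compose)
      moreover have "\<forall>\<^sub>F s in at_right t. \<omega>' (s - r) = g s"
        using False by (auto simp: eventually_at_right_field g_def intro!: exI[of _ "t + 1"])
      ultimately show ?thesis by (rule Lim_transform_eventually)
    qed
  next
    fix t :: real assume t: "0 < t"
    show "\<exists>l. (g \<longlongrightarrow> l) (at_left t)"
    proof (cases "t \<le> r")
      case True
      obtain l where l: "(\<omega> \<longlongrightarrow> l) (at_left t)" using w t by (auto simp: cadlag_def)
      have "\<forall>\<^sub>F s in at_left t. \<omega> s = g s"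
        using True by (auto simp: eventually_at_left_field g_def intro!: exI[of _ "t - 1"])
      from Lim_transform_eventually[OF l this] show ?thesis by blast
    next
      case False
      then have "0 < t - r" by simp
      then obtain l where l: "(\<omega>' \<longlongrightarrow> l) (at_left (t - r))" using w' unfolding cadlag_def by blast
      have "filterlim (\<lambda>s. s - r) (at_left (t - r)) (at_left t)"
        by (auto simp: filterlim_at eventually_at_filter intro!: tendsto_intros)
      from filterlim_compose[OF l this]
      have l': "((\<lambda>s. \<omega>' (s - r)) \<longlongrightarrow> l) (at_left t)" .
      have "\<forall>\<^sub>F s in at_left t. \<omega>' (s - r) = g s"
        using False by (auto simp: eventually_at_left_field g_def intro!: exI[of _ r])
      from Lim_transform_eventually[OF l' this] show ?thesis by blast
    qed
  qed
  then show ?thesis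
    by (rule cadlag_cong[rotated]) (use r in \<open>auto simp: splice_def g_def ennreal_less_iff\<close>)
qed

lemma space_path_space: "space path_space = {\<omega> \<in> extensional {0..}. cadlag \<omega>}"
  by (auto simp: path_space_def space_restrict_space space_PiM PiE_def)

lemma measurable_path_eval: "0 \<le> t \<Longrightarrow> (\<lambda>\<omega>. \<omega> t) \<in> path_space \<rightarrow>\<^sub>M borel"
  unfolding path_space_def by (intro measurable_restrict_space1 measurable_component_singleton) auto

lemma measurable_path_eval_pair:
  fixes M :: "'b measure" and g :: "'b \<Rightarrow> real \<Rightarrow> 'a::metric_space"
  assumes g: "g \<in> M \<rightarrow>\<^sub>M path_space" and s[measurable]: "s \<in> borel_measurable M"
    and pos: "\<And>x. x \<in> space M \<Longrightarrow> 0 \<le> s x"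
  shows "(\<lambda>x. g x (s x)) \<in> borel_measurable M"
proof -
  define u where "u n x = (real (nat \<lfloor>s x * real (Suc n)\<rfloor>) + 1) / real (Suc n)" for n x
  have u1: "s x < u n x" and u2: "u n x \<le> s x + 1 / real (Suc n)" if "x \<in> space M" for n x
  proof -
    have "0 \<le> s x * real (Suc n)" using pos[OF that] by simp
    then have *: "real (nat \<lfloor>s x * real (Suc n)\<rfloor>) = of_int \<lfloor>s x * real (Suc n)\<rfloor>" by simp
    have "s x * real (Suc n) < real (nat \<lfloor>s x * real (Suc n)\<rfloor>) + 1" unfolding * by linarith
    then show "s x < u n x" unfolding u_def by (subst pos_less_divide_eq) auto
    have "real (nat \<lfloor>s x * real (Suc n)\<rfloor>) \<le> s x * real (Suc n)" unfolding * by linarith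
    then have "u n x \<le> (s x * real (Suc n) + 1) / real (Suc n)"
      unfolding u_def by (intro divide_right_mono) auto
    also have "\<dots> = s x + 1 / real (Suc n)" by (simp add: add_divide_distrib)
    finally show "u n x \<le> s x + 1 / real (Suc n)" .
  qed
  show ?thesis
  proof (rule borel_measurable_LIMSEQ_metric)
    fix n
    show "(\<lambda>x. g x (u n x)) \<in> borel_measurable M"
      unfolding u_def
    proof (rule measurable_compose_countable[where f="\<lambda>k x. g x ((real k + 1) / real (Suc n))"])
      show "(\<lambda>x. g x ((real k + 1) / real (Suc n))) \<in> borel_measurable M" for k
        by (rule measurable_compose[OF g measurable_path_eval]) simp
    qed measurable
  next
    fix x assume x: "x \<in> space M"
    have "cadlag (g x)" using measurable_space[OF g x] by (simp add: space_path_space)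
    then have "(g x \<longlongrightarrow> g x (s x)) (at_right (s x))" using pos[OF x] by (simp add: cadlag_def)
    moreover have "(\<lambda>n. u n x) \<longlonglongrightarrow> s x"
    proof (rule tendsto_sandwich[where f="\<lambda>_. s x" and h="\<lambda>n. s x + 1 / real (Suc n)"])
      show "(\<lambda>n. s x + 1 / real (Suc n)) \<longlonglongrightarrow> s x"
        using tendsto_add[OF tendsto_const LIMSEQ_inverse_real_of_nat, of "s x"]
        by (simp add: inverse_eq_divide)
    qed (use u1[OF x] u2[OF x] in \<open>auto intro!: always_eventually less_imp_le\<close>)
    then have "filterlim (\<lambda>n. u n x) (at_right (s x)) sequentially"
      using u1[OF x] by (auto simp: filterlim_at less_imp_neq[symmetric])
    ultimately show "(\<lambda>n. g x (u n x)) \<longlonglongrightarrow> g x (s x)"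
      by (rule filterlim_compose)
  qed
qed

lemma measurable_path_spaceI:
  assumes "\<And>t. 0 \<le> t \<Longrightarrow> (\<lambda>x. g x t) \<in> borel_measurable M"
    and "\<And>x. x \<in> space M \<Longrightarrow> g x \<in> space path_space"
  shows "g \<in> M \<rightarrow>\<^sub>M path_space"
  unfolding path_space_def
proof (rule measurable_restrict_space2)
  show "g \<in> space M \<rightarrow> {\<omega>. cadlag \<omega>}" using assms(2) by (auto simp: space_path_space)
  have "(\<lambda>x. restrict (g x) {0..}) \<in> M \<rightarrow>\<^sub>M Pi\<^sub>M {0..} (\<lambda>_. borel)"
    by (rule measurable_restrict) (use assms(1) in auto)
  then show "g \<in> M \<rightarrow>\<^sub>M Pi\<^sub>M {0..} (\<lambda>_. borel)"
    by (rule measurable_cong[THEN iffD1, rotated])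
       (use assms(2) in \<open>auto simp: space_path_space extensional_restrict\<close>)
qed

lemma measurable_splice:
  assumes g: "g \<in> M \<rightarrow>\<^sub>M path_space" and T[measurable]: "T \<in> borel_measurable M"
    and g': "g' \<in> M \<rightarrow>\<^sub>M path_space"
  shows "(\<lambda>x. splice (g x) (T x) (g' x)) \<in> M \<rightarrow>\<^sub>M path_space"
proof (rule measurable_path_spaceI)
  fix x assume "x \<in> space M"
  then show "splice (g x) (T x) (g' x) \<in> space path_space"
    using cadlag_splice[of "g x" "g' x" "T x"] measurable_space[OF g] measurable_space[OF g']
    by (simp add: space_path_space) (simp add: splice_def)
next
  fix t :: real assume t: "0 \<le> t"
  have [measurable]: "(\<lambda>x. g x t) \<in> borel_measurable M"
    by (rule measurable_compose[OF g measurable_path_eval[OF t]])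
  have [measurable]: "(\<lambda>x. g' x (max 0 (t - enn2real (T x)))) \<in> borel_measurable M"
    by (rule measurable_path_eval_pair[OF g']) auto
  have "(\<lambda>x. if ennreal t < T x then g x t else g' x (max 0 (t - enn2real (T x)))) \<in> borel_measurable M"
    by measurable
  also have "(\<lambda>x. if ennreal t < T x then g x t else g' x (max 0 (t - enn2real (T x)))) =
    (\<lambda>x. splice (g x) (T x) (g' x) t)"
  proof (rule ext)
    fix x
    have "enn2real (T x) \<le> t" if "\<not> ennreal t < T x"
      using that t by (metis enn2real_leI not_le)
    then show "(if ennreal t < T x then g x t else g' x (max 0 (t - enn2real (T x)))) =
        splice (g x) (T x) (g' x) t"
      using t by (auto simp: splice_def max_def)
  qed
  finally show "(\<lambda>x. splice (g x) (T x) (g' x) t) \<in> borel_measurable M" .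
qed

lemma space_path_filtration: "space (path_filtration t) = space path_space"
  by (simp add: path_filtration_def)

lemma sets_path_filtration: "sets (path_filtration t) \<subseteq> sets path_space"
proof -
  have "(\<lambda>\<omega>. restrict \<omega> {s. 0 \<le> s \<and> ennreal s \<le> t}) \<in>
      path_space \<rightarrow>\<^sub>M Pi\<^sub>M {s. 0 \<le> s \<and> ennreal s \<le> t} (\<lambda>_. borel)"
    by (rule measurable_restrict) (auto intro: measurable_path_eval)
  then show ?thesis
    unfolding path_filtration_def by (intro sets_image_in_sets) auto
qed

lemma sets_path_filtration_mono:
  assumes "s \<le> t"
  shows "sets (path_filtration s) \<subseteq> sets (path_filtration t)"
proof -
  let ?I = "\<lambda>t. {r. 0 \<le> r \<and> ennreal r \<le> t}"
  have *: "(\<lambda>\<omega>. restrict \<omega> (?I t)) \<in> path_filtration t \<rightarrow>\<^sub>M Pi\<^sub>M (?I t) (\<lambda>_. borel)"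
    unfolding path_filtration_def by (rule measurable_vimage_algebra1) (auto simp: space_PiM)
  have "(\<lambda>\<omega>. restrict \<omega> (?I s)) \<in> path_filtration t \<rightarrow>\<^sub>M Pi\<^sub>M (?I s) (\<lambda>_. borel)"
  proof (rule measurable_restrict)
    fix r assume "r \<in> ?I s"
    then have r: "r \<in> ?I t" using assms by auto
    then show "(\<lambda>\<omega>. \<omega> r) \<in> path_filtration t \<rightarrow>\<^sub>M borel"
      using measurable_compose[OF * measurable_component_singleton[OF r]] by simp
  qed
  then show ?thesis
    unfolding path_filtration_def[of s]
    by (intro sets_image_in_sets) (auto simp: space_path_filtration)
qed

lemma filtration_path_filtration: "filtration (space path_space) path_filtration"
  by standard (simp_all add: space_path_filtration sets_path_filtration_mono)

lemma space_history_filtration: "space (history_filtration n t) = space (history_space n)"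
  by (simp add: history_filtration_def history_space_def space_PiM space_path_filtration)

lemma sets_PiM_mono:
  assumes "\<And>i. i \<in> I \<Longrightarrow> space (M i) = space (N i)" "\<And>i. i \<in> I \<Longrightarrow> sets (M i) \<subseteq> sets (N i)"
  shows "sets (Pi\<^sub>M I M) \<subseteq> sets (Pi\<^sub>M I N)"
proof -
  have sp: "space (Pi\<^sub>M I M) = space (Pi\<^sub>M I N)"
    using assms(1) by (simp add: space_PiM cong: PiE_cong)
  have "(\<lambda>h. h) \<in> Pi\<^sub>M I N \<rightarrow>\<^sub>M Pi\<^sub>M I M"
  proof (rule measurable_PiM_single')
    fix i assume i: "i \<in> I"
    have "(\<lambda>\<omega>. \<omega>) \<in> N i \<rightarrow>\<^sub>M M i"
      using assms[OF i] sets.sets_into_space[of _ "N i"]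
      by (auto simp: measurable_def Int_absorb2 subset_iff)
    with i show "(\<lambda>h. h i) \<in> Pi\<^sub>M I N \<rightarrow>\<^sub>M M i"
      by (auto intro: measurable_compose[OF measurable_component_singleton])
  qed (use sp in \<open>auto simp: space_PiM\<close>)
  from measurable_sets[OF this] show ?thesis
    using sets.sets_into_space[of _ "Pi\<^sub>M I M"] sp by (fastforce simp: Int_absorb2)
qed

lemma sets_history_filtration: "sets (history_filtration n t) \<subseteq> sets (history_space n)"
  unfolding history_filtration_def history_space_def
  by (rule sets_PiM_mono) (simp_all add: space_path_filtration sets_path_filtration)

lemma filtration_history_filtration: "filtration (space (history_space n)) (history_filtration n)"
proof
  show "sets (history_filtration n s) \<subseteq> sets (history_filtration n t)" if "s \<le> t" for s t
    unfolding history_filtration_def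
    by (rule sets_PiM_mono) (simp_all add: space_path_filtration sets_path_filtration_mono that)
qed (rule space_history_filtration)

lemma impulse_strategy_measurable:
  assumes "impulse_strategy U V"
  shows "fst V n \<in> borel_measurable (history_space (Suc n))"
    and "snd V n \<in> history_space (Suc n) \<rightarrow>\<^sub>M borel"
proof -
  let ?F = "history_filtration (Suc n)" and ?\<Omega> = "space (history_space (Suc n))"
  let ?G = "filtration.pre_sigma ?\<Omega> ?F (fst V n)"
  interpret filtration ?\<Omega> ?F by (rule filtration_history_filtration)
  have st: "stopping_time ?F (fst V n)" using assms by (simp add: impulse_strategy_def)
  then show "fst V n \<in> borel_measurable (history_space (Suc n))"
    by (rule measurable_stopping_time) (auto simp: space_history_filtration sets_history_filtration)
  have sets_G: "A \<in> sets (history_space (Suc n))" if "A \<in> sets ?G" for A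
    using sets_pre_sigmaD[OF st that, of top] sets_history_filtration by auto
  have G: "snd V n \<in> ?G \<rightarrow>\<^sub>M borel" using assms by (simp add: impulse_strategy_def)
  show "snd V n \<in> history_space (Suc n) \<rightarrow>\<^sub>M borel"
  proof (rule measurableI)
    show "snd V n -` A \<inter> ?\<Omega> \<in> sets (history_space (Suc n))" if "A \<in> sets borel" for A
      using sets_G[OF measurable_sets[OF G that]] by (simp only: space_pre_sigma)
  qed simp
qed

lemma (in markov_process) Ionescu_Tulcea_coordinate_kernel:
  assumes V: "impulse_strategy U V"
  shows "Ionescu_Tulcea (coordinate_kernel P V x) (\<lambda>_. path_space)"
proof -
  have P: "P y \<in> space (prob_algebra path_space)" for y
    using measurable_space[OF kernel] by simp
  have "coordinate_kernel P V x i \<in> Pi\<^sub>M {0..<i} (\<lambda>_. path_space) \<rightarrow>\<^sub>M prob_algebra path_space" for i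
  proof (cases i)
    case 0
    then show ?thesis using P by (simp add: coordinate_kernel_def[abs_def])
  next
    case (Suc m)
    let ?H = "history_space (Suc m) :: 'a history measure"
    have [measurable]: "(\<lambda>p. fst V m (fst p)) \<in> borel_measurable (?H \<Otimes>\<^sub>M path_space)"
      by (rule measurable_compose[OF measurable_fst impulse_strategy_measurable(1)[OF V]])
    have 1: "(\<lambda>h. h m) \<in> ?H \<rightarrow>\<^sub>M path_space"
      unfolding history_space_def by (rule measurable_component_singleton) simp
    have "(\<lambda>p. splice (fst p m) (fst V m (fst p)) (snd p)) \<in> ?H \<Otimes>\<^sub>M path_space \<rightarrow>\<^sub>M path_space"
      by (rule measurable_splice[OF measurable_compose[OF measurable_fst 1]]) measurable
    then have "(\<lambda>h. distr (P (snd V m h)) path_space (splice (h m) (fst V m h))) \<in>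
        ?H \<rightarrow>\<^sub>M prob_algebra path_space"
      by (intro measurable_distr_prob_space2[where M=path_space])
         (auto simp: split_beta' intro: measurable_compose[OF impulse_strategy_measurable(2)[OF V] kernel])
    then show ?thesis by (simp add: Suc coordinate_kernel_def[abs_def] history_space_def)
  qed
  note kernel_measurable = this
  show ?thesis
  proof (rule Ionescu_Tulcea.intro)
    fix i
    show "coordinate_kernel P V x i \<in> Pi\<^sub>M {0..<i} (\<lambda>_. path_space) \<rightarrow>\<^sub>M subprob_algebra path_space"
      by (rule measurable_prob_algebraD[OF kernel_measurable])
  next
    fix i and h :: "'a history"
    assume "h \<in> space (Pi\<^sub>M {0..<i} (\<lambda>_. path_space))"
    from measurable_space[OF kernel_measurable this]
    show "prob_space (coordinate_kernel P V x i h)" by (simp add: space_prob_algebra)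
  qed
qed

end

theory Submission
  imports Defs
begin

text \<open>
  No Bellman equation is needed. By the Markov property at an impulse time, a strategy conditioned
  on its first impulse is again a strategy, started in \<open>U\<close>. If its average reward exceeds \<open>r\<close>, then
  for large \<open>n\<close> the expected reward up to the \<open>n\<close>-th impulse exceeds \<open>r\<close> times the expected duration
  by an arbitrarily large constant, and so does that of some conditional strategy started at some
  \<open>y \<in> U\<close>. Repeating the latter periodically, with one extra impulse to \<open>y\<close> at the end of each
  period, yields an average of at least \<open>r\<close>, and an impulse to \<open>y\<close> at time \<open>0\<close>
  makes this available from every starting point. Hence average values are constant for every
  bounded measurable reward. Moreover, (C) applies to each cycle between two impulses, so the
  fraction of time that a strategy started in \<open>U\<close> spends outside a large ball is small uniformly
  over all strategies, and truncating the reward changes the value by little.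
\<close>

section \<open>Adapted functions of histories\<close>

text \<open>Two obstacles shape the development. A conditional strategy has to be shown adapted
  again; adaptedness is therefore turned into the statement that time and target of an impulse do
  not react to changes of the paths after it, a form that survives cutting, joining and infinite
  repetition. And expected costs may be infinite, so that differences of gains make no sense;
  comparisons are additive inequalities between \<open>ennreal\<close> integrals, with the reward
  raised by \<open>M\<close>. The surplus demanded before the first impulse is cut off is
  \<open>\<Phi> V x 0 + K\<close>: the first term replaces the reward of the discarded cycle, and
  \<open>K\<close>, a bound of the cost on the compact set \<open>U \<times> U\<close>, pays for the
  impulse that closes a period. The impulse that leads from the starting point to \<open>y\<close>
  costs a fixed finite amount, which disappears in the average. One good conditional strategy is
  picked and repeated, so no measurable selection among histories occurs. The surplus also forces a
  period to have positive expected length, which keeps the impulses of the periodic strategy from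
  accumulating.\<close>

definition agree_until :: "nat \<Rightarrow> ennreal \<Rightarrow> 'a history \<Rightarrow> 'a history \<Rightarrow> bool" where
  "agree_until n t h h' \<longleftrightarrow> (\<forall>i<n. \<forall>s\<ge>0. ennreal s \<le> t \<longrightarrow> h i s = h' i s)"

lemma agree_until_sym: "agree_until n t h h' \<Longrightarrow> agree_until n t h' h"
  by (simp add: agree_until_def)

lemma agree_until_mono: "agree_until n t h h' \<Longrightarrow> s \<le> t \<Longrightarrow> m \<le> n \<Longrightarrow> agree_until m s h h'"
  unfolding agree_until_def by (meson less_le_trans order_trans)

lemma space_history_space: "space (history_space n) = {0..<n} \<rightarrow>\<^sub>E space path_space"
  by (simp add: history_space_def space_PiM)

lemma splice_space: "cadlag \<omega> \<Longrightarrow> cadlag \<omega>' \<Longrightarrow> splice \<omega> T \<omega>' \<in> space path_space"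
  using cadlag_splice[of \<omega> \<omega>' T] by (simp add: space_path_space) (simp add: splice_def)

text \<open>The path frozen at its value at time \<open>t\<close>. For
  \<open>t = \<infinity>\<close> the default \<open>enn2real \<infinity> = 0\<close> has no effect,
  because \<open>splice\<close> never switches. Freezing is measurable from the filtration at
  \<open>t\<close> to the full path space, which yields sufficiency in Galmarino's test.\<close>

definition stop_path :: "ennreal \<Rightarrow> (real \<Rightarrow> 'a) \<Rightarrow> real \<Rightarrow> 'a" where
  "stop_path t \<omega> = splice \<omega> t (\<lambda>_. \<omega> (enn2real t))"

lemma stop_path_eq: "0 \<le> s \<Longrightarrow> ennreal s \<le> t \<Longrightarrow> stop_path t \<omega> s = \<omega> s"
  by (auto simp: stop_path_def splice_def)

lemma stop_path_space: "\<omega> \<in> space path_space \<Longrightarrow> stop_path t \<omega> \<in> space path_space"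
  unfolding stop_path_def by (rule splice_space) (auto simp: space_path_space cadlag_def)

lemma measurable_path_filtration_eval:
  assumes "0 \<le> s" "ennreal s \<le> t"
  shows "(\<lambda>\<omega>. \<omega> s) \<in> path_filtration t \<rightarrow>\<^sub>M borel"
proof -
  let ?I = "{r. 0 \<le> r \<and> ennreal r \<le> t}"
  have *: "(\<lambda>\<omega>. restrict \<omega> ?I) \<in> path_filtration t \<rightarrow>\<^sub>M Pi\<^sub>M ?I (\<lambda>_. borel)"
    unfolding path_filtration_def by (rule measurable_vimage_algebra1) (auto simp: space_PiM)
  show ?thesis
    using measurable_compose[OF * measurable_component_singleton[of s]] assms by simp
qed

lemma measurable_stop_path: "stop_path t \<in> path_filtration t \<rightarrow>\<^sub>M path_space"
proof (rule measurable_path_spaceI)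
  fix s :: real assume s: "0 \<le> s"
  show "(\<lambda>\<omega>. stop_path t \<omega> s) \<in> path_filtration t \<rightarrow>\<^sub>M borel"
  proof (cases "ennreal s \<le> t")
    case True
    then show ?thesis using s by (simp add: stop_path_eq measurable_path_filtration_eval)
  next
    case False
    then have "t \<noteq> \<infinity>" by auto
    then have "(\<lambda>\<omega>. \<omega> (enn2real t)) \<in> path_filtration t \<rightarrow>\<^sub>M borel"
      by (intro measurable_path_filtration_eval) (auto simp: top.not_eq_extremum)
    moreover have "\<not> ennreal s < t" using False by (simp add: order.strict_implies_order)
    ultimately show ?thesis using s by (simp add: stop_path_def splice_def)
  qed
qed (simp add: stop_path_space space_path_filtration)

text \<open>Galmarino's test: a history event is known at time \<open>t\<close> iff it is measurable and unaffected by
  changes of the paths after \<open>t\<close>.\<close>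

lemma sets_history_filtration_iff:
  "A \<in> sets (history_filtration n t) \<longleftrightarrow> A \<in> sets (history_space n) \<and>
     (\<forall>h\<in>A. \<forall>h'\<in>space (history_space n). agree_until n t h h' \<longrightarrow> h' \<in> A)"
proof (intro iffI conjI)
  assume A: "A \<in> sets (history_filtration n t)"
  then show "A \<in> sets (history_space n)" using sets_history_filtration by blast
  let ?\<Omega> = "space (history_space n) :: 'a history set"
  \<comment> \<open>Invariance is stated as an equivalence, so that complements preserve it in the
    induction over the generated sigma-field.\<close>
  define inv where "inv = (\<lambda>A. \<forall>h\<in>?\<Omega>. \<forall>h'\<in>?\<Omega>. agree_until n t h h' \<longrightarrow> (h \<in> A \<longleftrightarrow> h' \<in> A))"
  have path: "\<omega> \<in> B \<longleftrightarrow> \<omega>' \<in> B"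
    if B: "B \<in> sets (path_filtration t)" and "\<omega> \<in> space path_space" "\<omega>' \<in> space path_space"
      and eq: "\<And>s. 0 \<le> s \<Longrightarrow> ennreal s \<le> t \<Longrightarrow> \<omega> s = \<omega>' s" for B and \<omega> \<omega>' :: "real \<Rightarrow> 'a"
  proof -
    have "restrict \<omega> {s. 0 \<le> s \<and> ennreal s \<le> t} = restrict \<omega>' {s. 0 \<le> s \<and> ennreal s \<le> t}"
      using eq by (auto intro!: restrict_ext)
    then show ?thesis using B that(2,3)
      by (auto simp: path_filtration_def sets_vimage_algebra2 space_PiM)
  qed
  have \<Omega>: "(\<Pi>\<^sub>E i\<in>{0..<n}. space (path_filtration t)) = ?\<Omega>"
    by (simp add: space_history_space space_path_filtration)
  have "inv A"
    using A unfolding history_filtration_def sets_PiM_single \<Omega>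
  proof (induction rule: sigma_sets.induct)
    case (Basic a)
    then obtain i B where i: "i < n" "B \<in> sets (path_filtration t)" and a: "a = {f \<in> ?\<Omega>. f i \<in> B}"
      by auto
    show ?case unfolding inv_def
    proof (intro ballI impI)
      fix h h' assume "h \<in> ?\<Omega>" "h' \<in> ?\<Omega>" "agree_until n t h h'"
      then show "h \<in> a \<longleftrightarrow> h' \<in> a"
        using i path[of B "h i" "h' i"] unfolding a
        by (auto simp: agree_until_def space_history_space PiE_iff)
    qed
  qed (auto simp: inv_def)
  then show "\<forall>h\<in>A. \<forall>h'\<in>?\<Omega>. agree_until n t h h' \<longrightarrow> h' \<in> A"
    using sets.sets_into_space[OF A] by (auto simp: inv_def space_history_filtration)
next
  let ?\<Omega> = "space (history_space n) :: 'a history set"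
  let ?S = "\<lambda>h. \<lambda>i\<in>{0..<n}. stop_path t (h i)"
  assume A: "A \<in> sets (history_space n) \<and> (\<forall>h\<in>A. \<forall>h'\<in>?\<Omega>. agree_until n t h h' \<longrightarrow> h' \<in> A)"
  have S: "?S \<in> history_filtration n t \<rightarrow>\<^sub>M history_space n"
    unfolding history_filtration_def history_space_def
    by (intro measurable_restrict measurable_compose[OF _ measurable_stop_path] measurable_component_singleton)
  have "agree_until n t h (?S h)" "agree_until n t (?S h) h" for h
    by (auto simp: agree_until_def stop_path_eq)
  moreover have "?S h \<in> ?\<Omega>" if "h \<in> ?\<Omega>" for h
    using that by (auto simp: space_history_space PiE_iff stop_path_space)
  moreover have "A \<subseteq> ?\<Omega>" using A sets.sets_into_space by blast
  \<comment> \<open>An invariant set is its own preimage under freezing, because a history and its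
    frozen version agree until \<open>t\<close>.\<close>
  ultimately have "?S -` A \<inter> space (history_filtration n t) = A"
    using A unfolding space_history_filtration by blast
  then show "A \<in> sets (history_filtration n t)"
    using measurable_sets[OF S, of A] A by simp
qed

text \<open>\<open>det\<close> expresses adaptedness: time and target depend only on the history up
  to the time itself. If \<open>h'\<close> agrees with \<open>h\<close> until some \<open>t\<close>
  not before the impulse, then also until the impulse, so the events in question are invariant and
  Galmarino's test applies.\<close>

lemma impulse_strategyI:
  fixes V :: "'a::metric_space strategy"
  assumes time: "\<And>n. fst V n \<in> borel_measurable (history_space (Suc n))"
    and target: "\<And>n. snd V n \<in> history_space (Suc n) \<rightarrow>\<^sub>M borel"
    and U: "\<And>n h. h \<in> space (history_space (Suc n)) \<Longrightarrow> snd V n h \<in> U"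
    and mono: "\<And>n h. h \<in> space (history_space (Suc (Suc n))) \<Longrightarrow>
        fst V n (restrict h {0..<Suc n}) \<le> fst V (Suc n) h"
    and det: "\<And>n h h'. h \<in> space (history_space (Suc n)) \<Longrightarrow> h' \<in> space (history_space (Suc n)) \<Longrightarrow>
        agree_until (Suc n) (fst V n h) h h' \<Longrightarrow> fst V n h' = fst V n h \<and> snd V n h' = snd V n h"
  shows "impulse_strategy U V"
  unfolding impulse_strategy_def
proof (intro conjI allI ballI)
  fix n
  let ?F = "history_filtration (Suc n) :: ennreal \<Rightarrow> 'a history measure"
    and ?\<Omega> = "space (history_space (Suc n)) :: 'a history set"
  interpret filtration ?\<Omega> ?F by (rule filtration_history_filtration)
  note [measurable] = time[of n] target[of n]
  show st: "stopping_time ?F (fst V n)"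
  proof
    fix t
    have "{h \<in> ?\<Omega>. fst V n h \<le> t} \<in> sets (?F t)"
      unfolding sets_history_filtration_iff
    proof (intro conjI ballI impI)
      fix h h' assume "h \<in> {h \<in> ?\<Omega>. fst V n h \<le> t}" "h' \<in> ?\<Omega>" "agree_until (Suc n) t h h'"
      then show "h' \<in> {h \<in> ?\<Omega>. fst V n h \<le> t}"
        using det[of h n h'] agree_until_mono[of "Suc n" t h h' "fst V n h" "Suc n"] by auto
    qed measurable
    then show "Measurable.pred (?F t) (\<lambda>h. fst V n h \<le> t)"
      by (simp add: pred_def space_history_filtration)
  qed
  show "snd V n \<in> pre_sigma (fst V n) \<rightarrow>\<^sub>M borel"
  proof (rule measurableI)
    fix A :: "'a set" assume [measurable]: "A \<in> sets borel"
    show "snd V n -` A \<inter> space (pre_sigma (fst V n)) \<in> sets (pre_sigma (fst V n))"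
    proof (rule sets_pre_sigmaI[OF st])
      fix t
      have "{h \<in> ?\<Omega>. snd V n h \<in> A \<and> fst V n h \<le> t} \<in> sets (?F t)"
        unfolding sets_history_filtration_iff
      proof (intro conjI ballI impI)
        fix h h' assume "h \<in> {h \<in> ?\<Omega>. snd V n h \<in> A \<and> fst V n h \<le> t}" "h' \<in> ?\<Omega>" "agree_until (Suc n) t h h'"
        then show "h' \<in> {h \<in> ?\<Omega>. snd V n h \<in> A \<and> fst V n h \<le> t}"
          using det[of h n h'] agree_until_mono[of "Suc n" t h h' "fst V n h" "Suc n"] by auto
      qed measurable
      also have "{h \<in> ?\<Omega>. snd V n h \<in> A \<and> fst V n h \<le> t} =
          {h \<in> snd V n -` A \<inter> space (pre_sigma (fst V n)). fst V n h \<le> t}"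
        by (auto simp: space_pre_sigma)
      finally show "{h \<in> snd V n -` A \<inter> space (pre_sigma (fst V n)). fst V n h \<le> t} \<in> sets (?F t)" .
    qed
  qed simp
qed (use U mono in auto)

text \<open>The event that the impulse comes no later than \<open>fst V n h\<close> is known at that
  time and contains \<open>h\<close>, hence \<open>h'\<close>. So the histories also agree until the
  possibly smaller time \<open>fst V n h'\<close>, and exchanging their roles gives equality. For
  the targets the same is done with the preimage of a singleton, which is Borel.\<close>

lemma impulse_strategy_deterministic:
  fixes V :: "'a::metric_space strategy"
  assumes V: "impulse_strategy U V" and h: "h \<in> space (history_space (Suc n))"
    and h': "h' \<in> space (history_space (Suc n))" and agree: "agree_until (Suc n) (fst V n h) h h'"
  shows "fst V n h' = fst V n h" and "snd V n h' = snd V n h"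
proof -
  let ?F = "history_filtration (Suc n) :: ennreal \<Rightarrow> 'a history measure"
    and ?\<Omega> = "space (history_space (Suc n)) :: 'a history set"
  interpret filtration ?\<Omega> ?F by (rule filtration_history_filtration)
  have st: "stopping_time ?F (fst V n)" using V by (simp add: impulse_strategy_def)
  have le: "fst V n h2 \<le> fst V n h1" if "h1 \<in> ?\<Omega>" "h2 \<in> ?\<Omega>" "agree_until (Suc n) (fst V n h1) h1 h2" for h1 h2
  proof -
    have "{h \<in> ?\<Omega>. fst V n h \<le> fst V n h1} \<in> sets (?F (fst V n h1))"
      using stopping_timeD[OF st] by (simp add: pred_def space_history_filtration)
    with that show ?thesis unfolding sets_history_filtration_iff by blast
  qed
  have "fst V n h' \<le> fst V n h" using le[OF h h' agree] .
  moreover from agree_until_mono[OF agree_until_sym[OF agree] this order_refl]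
  have "fst V n h \<le> fst V n h'" using le[OF h' h] by simp
  ultimately show "fst V n h' = fst V n h" by simp
  have "snd V n \<in> pre_sigma (fst V n) \<rightarrow>\<^sub>M borel" using V by (simp add: impulse_strategy_def)
  then have "snd V n -` {snd V n h} \<inter> space (pre_sigma (fst V n)) \<in> sets (pre_sigma (fst V n))"
    by (rule measurable_sets) simp
  from sets_pre_sigmaD[OF st this, of "fst V n h"]
  show "snd V n h' = snd V n h"
    using h h' agree unfolding sets_history_filtration_iff space_pre_sigma by blast
qed

lemma impulse_strategy_target: "impulse_strategy U V \<Longrightarrow> h \<in> space (history_space (Suc n)) \<Longrightarrow> snd V n h \<in> U"
  by (simp add: impulse_strategy_def)

lemma impulse_strategy_mono: "impulse_strategy U V \<Longrightarrow> h \<in> space (history_space (Suc (Suc n))) \<Longrightarrow>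
    fst V n (restrict h {0..<Suc n}) \<le> fst V (Suc n) h"
  by (simp add: impulse_strategy_def)

section \<open>Tails and concatenations of strategies\<close>

lemma restrict_restrict_le:
  fixes h :: "nat \<Rightarrow> 'b"
  shows "m \<le> n \<Longrightarrow> restrict (restrict h {0..<n}) {0..<m} = restrict h {0..<m}"
  by (auto simp: restrict_def fun_eq_iff)

lemma impulse_strategy_mono_le:
  assumes V: "impulse_strategy U V"
  shows "n \<le> m \<Longrightarrow> h \<in> space (history_space (Suc m)) \<Longrightarrow> fst V n (restrict h {0..<Suc n}) \<le> fst V m h"
proof (induction m arbitrary: h rule: dec_induct)
  case base
  then have "restrict h {0..<Suc n} = h" by (simp add: space_history_space PiE_restrict)
  then show ?case by simp
next
  case (step m)
  have "restrict h {0..<Suc m} \<in> space (history_space (Suc m))"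
    using step.prems by (auto simp: space_history_space PiE_iff)
  from step.IH[OF this] have "fst V n (restrict h {0..<Suc n}) \<le> fst V m (restrict h {0..<Suc m})"
    using step.hyps by (simp only: restrict_restrict_le Suc_le_mono)
  also have "\<dots> \<le> fst V (Suc m) h" by (rule impulse_strategy_mono[OF V step.prems])
  finally show ?case .
qed

section \<open>Shifting, splicing and gluing of paths and histories\<close>

lemma cadlag_shift:
  fixes \<omega> :: "real \<Rightarrow> 'a::metric_space"
  assumes "cadlag \<omega>" and t: "0 \<le> t"
  shows "cadlag (\<lambda>s. \<omega> (t + s))"
  unfolding cadlag_def
proof safe
  fix s :: real assume "0 \<le> s"
  then have *: "(\<omega> \<longlongrightarrow> \<omega> (t + s)) (at_right (t + s))" using assms by (simp add: cadlag_def)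
  have "filterlim (\<lambda>s. t + s) (at_right (t + s)) (at_right s)"
    by (auto simp: filterlim_at eventually_at_filter intro!: tendsto_intros)
  then show "((\<lambda>s. \<omega> (t + s)) \<longlongrightarrow> \<omega> (t + s)) (at_right s)"
    by (rule filterlim_compose[OF *])
next
  fix s :: real assume "0 < s"
  with t have "0 < t + s" by simp
  then obtain l where *: "(\<omega> \<longlongrightarrow> l) (at_left (t + s))" using assms unfolding cadlag_def by blast
  have "filterlim (\<lambda>s. t + s) (at_left (t + s)) (at_left s)"
    by (auto simp: filterlim_at eventually_at_filter intro!: tendsto_intros)
  from filterlim_compose[OF * this] show "\<exists>l. ((\<lambda>s. \<omega> (t + s)) \<longlongrightarrow> l) (at_left s)" ..
qed

lemma shift_space: "\<omega> \<in> space path_space \<Longrightarrow> 0 \<le> t \<Longrightarrow> shift t \<omega> \<in> space path_space"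
  using cadlag_cong[OF _ cadlag_shift[of \<omega> t], of "shift t \<omega>"]
  by (simp add: space_path_space shift_def)

lemma measurable_shift:
  assumes g: "g \<in> M \<rightarrow>\<^sub>M path_space" and [measurable]: "t \<in> borel_measurable M"
    and pos: "\<And>x. x \<in> space M \<Longrightarrow> 0 \<le> t x"
  shows "(\<lambda>x. shift (t x) (g x)) \<in> M \<rightarrow>\<^sub>M path_space"
proof (rule measurable_path_spaceI)
  fix s :: real assume "0 \<le> s"
  then show "(\<lambda>x. shift (t x) (g x) s) \<in> borel_measurable M"
    using measurable_path_eval_pair[OF g, of "\<lambda>x. t x + s"] pos by (simp add: shift_def)
qed (use measurable_space[OF g] pos in \<open>auto intro: shift_space\<close>)

lemma shift_splice:
  assumes "\<omega>' \<in> space path_space" "T < \<infinity>"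
  shows "shift (enn2real T) (splice \<omega> T \<omega>') = \<omega>'"
proof
  fix s
  obtain r where r: "0 \<le> r" "T = ennreal r" using assms(2) by (cases T) auto
  show "shift (enn2real T) (splice \<omega> T \<omega>') s = \<omega>' s"
    using r assms(1) by (auto simp: shift_def splice_def ennreal_less_iff space_path_space extensional_def)
qed

text \<open>Nested splicing corresponds to addition of clocks. Because of this, extending a glued
  history by its next coordinate is the same as extending its second part and gluing
  afterwards.\<close>

lemma splice_assoc:
  assumes "T < \<infinity>"
  shows "splice (splice \<omega> T \<omega>') (T + S) \<omega>'' = splice \<omega> T (splice \<omega>' S \<omega>'')"
proof
  fix s
  obtain r where r: "0 \<le> r" "T = ennreal r" using assms by (cases T) auto
  show "splice (splice \<omega> T \<omega>') (T + S) \<omega>'' s = splice \<omega> T (splice \<omega>' S \<omega>'') s"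
  proof (cases S)
    case (real u)
    then show ?thesis using r
      by (auto simp: splice_def ennreal_less_iff ennreal_plus[symmetric] algebra_simps simp del: ennreal_plus)
  qed (use r in \<open>auto simp: splice_def ennreal_less_iff\<close>)
qed

text \<open>\<open>h\<close> is the past up to impulse \<open>n\<close>, and \<open>h'\<close>
  consists of \<open>m\<close> coordinates of a second strategy on its own clock. Under the
  controlled law every coordinate copies its predecessor before the impulse that starts it; hence
  all coordinates after \<open>n\<close> coincide with \<open>h n\<close> before \<open>T\<close>,
  and each coordinate of \<open>h'\<close> is delayed by \<open>T\<close> and prefixed by
  \<open>h n\<close>.\<close>

definition glue :: "nat \<Rightarrow> nat \<Rightarrow> ennreal \<Rightarrow> 'a history \<Rightarrow> 'a history \<Rightarrow> 'a history" where
  "glue n m T h h' = (\<lambda>i\<in>{0..<Suc n + m}. if i \<le> n then h i else splice (h n) T (h' (i - Suc n)))"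

text \<open>Recovers the second part of a glued history when \<open>T\<close> is finite; see
  \<open>after_glue\<close>.\<close>

definition after :: "nat \<Rightarrow> nat \<Rightarrow> ennreal \<Rightarrow> 'a history \<Rightarrow> 'a history" where
  "after n m T h = (\<lambda>i\<in>{0..<m}. shift (enn2real T) (h (Suc n + i)))"

lemma glue_space:
  assumes "h \<in> space (history_space (Suc n))" "h' \<in> space (history_space m)"
  shows "glue n m T h h' \<in> space (history_space (Suc n + m))"
proof -
  have "h i \<in> space path_space" if "i \<le> n" for i
    using assms(1) that by (auto simp: space_history_space)
  moreover have "splice (h n) T (h' (i - Suc n)) \<in> space path_space" if "\<not> i \<le> n" "i < Suc n + m" for i
  proof (rule splice_space)
    show "cadlag (h n)" using assms(1) by (auto simp: space_history_space space_path_space)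
    show "cadlag (h' (i - Suc n))" using assms(2) that
      by (auto simp: space_history_space space_path_space PiE_iff)
  qed
  ultimately show ?thesis
    unfolding glue_def space_history_space by (intro restrict_PiE_iff[THEN iffD2] ballI) auto
qed

lemma restrict_glue:
  "k \<le> m \<Longrightarrow> restrict (glue n m T h h') {0..<Suc n + k} = glue n k T h (restrict h' {0..<k})"
  by (auto simp: glue_def restrict_def fun_eq_iff)

lemma restrict_glue_le:
  "k \<le> Suc n \<Longrightarrow> restrict (glue n m T h h') {0..<k} = restrict h {0..<k}"
  by (auto simp: glue_def restrict_def fun_eq_iff)

lemma restrict_history: "h \<in> space (history_space n) \<Longrightarrow> restrict h {0..<n} = h"
  by (simp add: space_history_space PiE_restrict)

lemma restrict_history_space:
  "h \<in> space (history_space n) \<Longrightarrow> m \<le> n \<Longrightarrow> restrict h {0..<m} \<in> space (history_space m)"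
  by (auto simp: space_history_space PiE_iff)

lemma history_space_cadlag: "h \<in> space (history_space n) \<Longrightarrow> i < n \<Longrightarrow> cadlag (h i)"
  by (auto simp: space_history_space space_path_space PiE_iff)

lemma measurable_history_component: "i < n \<Longrightarrow> (\<lambda>h. h i) \<in> history_space n \<rightarrow>\<^sub>M path_space"
  unfolding history_space_def by (rule measurable_component_singleton) simp

lemma measurable_history_restrict: "m \<le> n \<Longrightarrow> (\<lambda>h. restrict h {0..<m}) \<in> history_space n \<rightarrow>\<^sub>M history_space m"
  unfolding history_space_def by (rule measurable_restrict_subset) simp

lemma measurable_glue:
  assumes "h \<in> space (history_space (Suc n))"
  shows "glue n m T h \<in> history_space m \<rightarrow>\<^sub>M history_space (Suc n + m)"
  unfolding glue_def[abs_def] history_space_def[of "Suc n + m"]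
proof (rule measurable_restrict)
  fix i assume i: "i \<in> {0..<Suc n + m}"
  have h: "h j \<in> space path_space" if "j \<le> n" for j
    using assms that by (auto simp: space_history_space)
  have "(\<lambda>h'. splice (h n) T (h' (i - Suc n))) \<in> history_space m \<rightarrow>\<^sub>M path_space" if "\<not> i \<le> n"
    by (rule measurable_splice) (use that i h[of n] in \<open>auto intro!: measurable_history_component\<close>)
  then show "(\<lambda>h'. if i \<le> n then h i else splice (h n) T (h' (i - Suc n))) \<in> history_space m \<rightarrow>\<^sub>M path_space"
    using h[of i] by (cases "i \<le> n") auto
qed

lemma after_space:
  "h \<in> space (history_space (Suc n + m)) \<Longrightarrow> after n m T h \<in> space (history_space m)"
  unfolding after_def space_history_space by (auto simp: PiE_iff intro!: shift_space)

lemma measurable_after: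
  assumes "T \<in> borel_measurable (history_space (Suc n + m))"
  shows "(\<lambda>h. after n m (T h) h) \<in> history_space (Suc n + m) \<rightarrow>\<^sub>M history_space m"
  unfolding after_def history_space_def[of m]
  using borel_measurable_enn2real[OF assms]
  by (intro measurable_restrict measurable_shift measurable_history_component) auto

lemma restrict_after: "k \<le> m \<Longrightarrow> restrict (after n m T h) {0..<k} = after n k T (restrict h {0..<Suc n + k})"
  by (auto simp: after_def restrict_def fun_eq_iff)

lemma after_glue:
  assumes "h' \<in> space (history_space m)" "T < \<infinity>"
  shows "after n m T (glue n m T h h') = h'"
proof
  fix i
  show "after n m T (glue n m T h h') i = h' i"
    using assms by (auto simp: after_def glue_def shift_splice space_history_space PiE_iff extensional_def)
qed

text \<open>Seen from the past \<open>h\<close>, \<open>W\<close> acts like \<open>R\<close> on a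
  clock set to zero at impulse \<open>n\<close>. Only glued histories are constrained, since after
  \<open>h\<close> these are the ones that occur. Tails, concatenations and periodic strategies all
  enter the strong Markov property through this relation.\<close>

definition continues :: "'a::metric_space strategy \<Rightarrow> nat \<Rightarrow> 'a history \<Rightarrow> 'a strategy \<Rightarrow> bool" where
  "continues W n h R \<longleftrightarrow> (\<forall>k. \<forall>h'\<in>space (history_space (Suc k)).
     fst W (Suc n + k) (glue n (Suc k) (fst W n h) h h') = fst W n h + fst R k h' \<and>
     snd W (Suc n + k) (glue n (Suc k) (fst W n h) h h') = snd R k h')"

text \<open>The truncated subtraction loses nothing: on glued histories the later impulse times of a
  strategy are at least \<open>fst W n h\<close>.\<close>

definition tail :: "'a::metric_space strategy \<Rightarrow> nat \<Rightarrow> 'a history \<Rightarrow> 'a strategy" where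
  "tail W n h =
     (\<lambda>k h'. fst W (Suc n + k) (glue n (Suc k) (fst W n h) h h') - fst W n h,
      \<lambda>k h'. snd W (Suc n + k) (glue n (Suc k) (fst W n h) h h'))"

text \<open>The impulses of \<open>Q\<close> after number \<open>n\<close> are dropped. If
  \<open>T = \<infinity>\<close>, all later times are infinite too, and the clock shift by
  \<open>enn2real \<infinity> = 0\<close> only affects targets of impulses that never
  happen.\<close>

definition concat_strategy :: "nat \<Rightarrow> 'a::metric_space strategy \<Rightarrow> 'a strategy \<Rightarrow> 'a strategy" where
  "concat_strategy n Q R =
     (\<lambda>k h. if k \<le> n then fst Q k h else
        let T = fst Q n (restrict h {0..<Suc n}) in T + fst R (k - Suc n) (after n (k - n) T h),
      \<lambda>k h. if k \<le> n then snd Q k h else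
        let T = fst Q n (restrict h {0..<Suc n}) in snd R (k - Suc n) (after n (k - n) T h))"

lemma impulse_time_glue_ge:
  assumes V: "impulse_strategy U V" and h: "h \<in> space (history_space (Suc n))"
    and h': "h' \<in> space (history_space (Suc k))"
  shows "fst V n h \<le> fst V (Suc n + k) (glue n (Suc k) T h h')"
  using impulse_strategy_mono_le[OF V, of n "Suc n + k" "glue n (Suc k) T h h'"] glue_space[OF h h', of T]
  by (simp add: restrict_glue_le restrict_history[OF h])

lemma continues_tail:
  assumes V: "impulse_strategy U V" and h: "h \<in> space (history_space (Suc n))"
  shows "continues V n h (tail V n h)"
  unfolding continues_def tail_def
  using impulse_time_glue_ge[OF V h] by (auto simp: add_diff_inverse_ennreal add_diff_eq_ennreal)

lemma impulse_strategy_tail: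
  fixes V :: "'a::metric_space strategy"
  assumes V: "impulse_strategy U V" and h: "h \<in> space (history_space (Suc n))" and fin: "fst V n h < \<infinity>"
  shows "impulse_strategy U (tail V n h)"
proof -
  let ?T = "fst V n h"
  let ?g = "\<lambda>k. glue n (Suc k) ?T h"
  have g: "?g k \<in> history_space (Suc k) \<rightarrow>\<^sub>M history_space (Suc (Suc n + k))" for k
    using measurable_glue[OF h, of "Suc k"] by simp
  have g_space: "?g k h' \<in> space (history_space (Suc (Suc n + k)))" if "h' \<in> space (history_space (Suc k))" for k h'
    using glue_space[OF h that, of ?T] by simp
  note ge = impulse_time_glue_ge[OF V h, where T="?T"]
  show ?thesis
  proof (rule impulse_strategyI)
    fix k
    have "(\<lambda>h'. fst V (Suc n + k) (?g k h')) \<in> borel_measurable (history_space (Suc k))"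
      by (rule measurable_compose[OF g impulse_strategy_measurable(1)[OF V]])
    then show "fst (tail V n h) k \<in> borel_measurable (history_space (Suc k))"
      unfolding tail_def fst_conv by measurable
    show "snd (tail V n h) k \<in> history_space (Suc k) \<rightarrow>\<^sub>M borel"
      unfolding tail_def snd_conv by (rule measurable_compose[OF g impulse_strategy_measurable(2)[OF V]])
  next
    fix k and h' :: "'a history" assume h': "h' \<in> space (history_space (Suc k))"
    show "snd (tail V n h) k h' \<in> U"
      unfolding tail_def snd_conv by (rule impulse_strategy_target[OF V g_space[OF h']])
  next
    fix k and h' :: "'a history" assume h': "h' \<in> space (history_space (Suc (Suc k)))"
    have "fst V (Suc n + k) (restrict (?g (Suc k) h') {0..<Suc (Suc n + k)}) \<le> fst V (Suc (Suc n + k)) (?g (Suc k) h')"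
      using impulse_strategy_mono[OF V, of "?g (Suc k) h'"] g_space[OF h'] by simp
    then show "fst (tail V n h) k (restrict h' {0..<Suc k}) \<le> fst (tail V n h) (Suc k) h'"
      using restrict_glue[of "Suc k" "Suc (Suc k)" n ?T h h']
      unfolding tail_def fst_conv by (simp add: ennreal_minus_mono)
  next
    fix k and h1 h2 :: "'a history"
    assume h1: "h1 \<in> space (history_space (Suc k))" and h2: "h2 \<in> space (history_space (Suc k))"
      and agree: "agree_until (Suc k) (fst (tail V n h) k h1) h1 h2"
    let ?T' = "fst V (Suc n + k) (?g k h1)"
    obtain r where r: "0 \<le> r" "?T = ennreal r" using fin by (cases ?T) auto
    \<comment> \<open>Before \<open>?T\<close> both glued histories consist of \<open>h\<close>;
      after \<open>?T\<close>, agreement until \<open>?T'\<close> is agreement of \<open>h1\<close>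
      and \<open>h2\<close> until \<open>?T' - ?T\<close>, the time of the tail.\<close>
    have "agree_until (Suc (Suc n + k)) ?T' (?g k h1) (?g k h2)"
      unfolding agree_until_def
    proof (intro allI impI)
      fix i s assume i: "i < Suc (Suc n + k)" and s: "0 \<le> s" "ennreal s \<le> ?T'"
      have "h1 (i - Suc n) (s - r) = h2 (i - Suc n) (s - r)" if "\<not> i \<le> n" "r \<le> s"
      proof -
        have "ennreal (s - r) = ennreal s - ?T" using r that by (simp add: ennreal_minus)
        also have "\<dots> \<le> ?T' - ?T" using s by (intro ennreal_minus_mono) auto
        finally show ?thesis
          using agree that i unfolding agree_until_def tail_def fst_conv by auto
      qed
      then show "?g k h1 i s = ?g k h2 i s"
        using i s r by (auto simp: glue_def splice_def ennreal_less_iff)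
    qed
    from impulse_strategy_deterministic[OF V g_space[OF h1] g_space[OF h2] this]
    show "fst (tail V n h) k h2 = fst (tail V n h) k h1 \<and> snd (tail V n h) k h2 = snd (tail V n h) k h1"
      unfolding tail_def by simp
  qed
qed

lemma continues_concat:
  fixes Q R :: "'a::metric_space strategy"
  assumes h: "h \<in> space (history_space (Suc n))" and fin: "fst Q n h < \<infinity>"
  shows "continues (concat_strategy n Q R) n h R"
  unfolding continues_def
proof (intro allI ballI)
  fix k and h' :: "'a history" assume h': "h' \<in> space (history_space (Suc k))"
  have *: "fst (concat_strategy n Q R) n = fst Q n" by (simp add: concat_strategy_def fun_eq_iff)
  show "fst (concat_strategy n Q R) (Suc n + k) (glue n (Suc k) (fst (concat_strategy n Q R) n h) h h') =
        fst (concat_strategy n Q R) n h + fst R k h' \<and>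
        snd (concat_strategy n Q R) (Suc n + k) (glue n (Suc k) (fst (concat_strategy n Q R) n h) h h') = snd R k h'"
    unfolding * using after_glue[OF h' fin, of n h]
    by (simp add: concat_strategy_def restrict_glue_le restrict_history[OF h] Let_def Suc_diff_le)
qed

lemma impulse_strategy_concat:
  fixes Q R :: "'a::metric_space strategy"
  assumes Q: "impulse_strategy U Q" and R: "impulse_strategy U R"
  shows "impulse_strategy U (concat_strategy n Q R)"
proof -
  let ?W = "concat_strategy n Q R" and ?T = "\<lambda>h. fst Q n (restrict h {0..<Suc n})"
  have le: "fst ?W k h = fst Q k h" "snd ?W k h = snd Q k h" if "k \<le> n" for k h
    using that by (simp_all add: concat_strategy_def)
  have gt: "fst ?W (Suc n + k) h = ?T h + fst R k (after n (Suc k) (?T h) h)"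
    "snd ?W (Suc n + k) h = snd R k (after n (Suc k) (?T h) h)" for k h
    by (simp_all add: concat_strategy_def Let_def Suc_diff_le)
  have gt_ex: "\<exists>j. k = Suc n + j" if "\<not> k \<le> n" for k
    using that by (intro exI[of _ "k - Suc n"]) simp
  have after_sp: "after n (Suc k) (?T h) h \<in> space (history_space (Suc k))"
    if "h \<in> space (history_space (Suc (Suc n + k)))" for h k
    using that after_space[of h n "Suc k"] by simp
  have T_meas[measurable]: "?T \<in> borel_measurable (history_space (Suc (Suc n + k)))" for k
    by (rule measurable_compose[OF measurable_history_restrict impulse_strategy_measurable(1)[OF Q]]) simp
  have after_meas: "(\<lambda>h. after n (Suc k) (?T h) h) \<in> history_space (Suc (Suc n + k)) \<rightarrow>\<^sub>M history_space (Suc k)" for k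
    using measurable_after[of ?T n "Suc k"] T_meas by simp
  show ?thesis
  proof (rule impulse_strategyI)
    fix k
    show "fst ?W k \<in> borel_measurable (history_space (Suc k))"
    proof (cases "k \<le> n")
      case True
      then have "fst ?W k = fst Q k" using le by (simp add: fun_eq_iff)
      then show ?thesis using impulse_strategy_measurable(1)[OF Q] by simp
    next
      case False
      then obtain j where j: "k = Suc n + j" using gt_ex by auto
      have [measurable]: "(\<lambda>h. fst R j (after n (Suc j) (?T h) h)) \<in> borel_measurable (history_space (Suc (Suc n + j)))"
        by (rule measurable_compose[OF after_meas impulse_strategy_measurable(1)[OF R]])
      have "(\<lambda>h. ?T h + fst R j (after n (Suc j) (?T h) h)) \<in> borel_measurable (history_space (Suc (Suc n + j)))"
        by measurable
      then show ?thesis unfolding j by (subst gt(1)[abs_def]) simp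
    qed
    show "snd ?W k \<in> history_space (Suc k) \<rightarrow>\<^sub>M borel"
    proof (cases "k \<le> n")
      case True
      then have "snd ?W k = snd Q k" using le by (simp add: fun_eq_iff)
      then show ?thesis using impulse_strategy_measurable(2)[OF Q] by simp
    next
      case False
      then obtain j where j: "k = Suc n + j" using gt_ex by auto
      show ?thesis unfolding j gt(2)[abs_def]
        by (rule measurable_compose[OF after_meas impulse_strategy_measurable(2)[OF R]])
    qed
  next
    fix k and h :: "'a history" assume h: "h \<in> space (history_space (Suc k))"
    show "snd ?W k h \<in> U"
    proof (cases "k \<le> n")
      case True
      then show ?thesis using impulse_strategy_target[OF Q h] le by simp
    next
      case False
      then obtain j where j: "k = Suc n + j" using gt_ex by auto
      show ?thesis using h after_sp unfolding j gt by (intro impulse_strategy_target[OF R]) simp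
    qed
  next
    fix k and h :: "'a history" assume h: "h \<in> space (history_space (Suc (Suc k)))"
    consider "Suc k \<le> n" | "k = n" | j where "k = Suc n + j"
      using gt_ex[of k] by fastforce
    then show "fst ?W k (restrict h {0..<Suc k}) \<le> fst ?W (Suc k) h"
    proof cases
      case 1
      then show ?thesis using impulse_strategy_mono[OF Q h] le by simp
    next
      case 2
      then show ?thesis using gt(1)[of 0 h] le(1)[of n "restrict h {0..<Suc n}"] by simp
    next
      case (3 j)
      have T: "?T (restrict h {0..<Suc k}) = ?T h" using 3 by (simp only: restrict_restrict_le)
      have "fst R j (restrict (after n (Suc (Suc j)) (?T h) h) {0..<Suc j}) \<le> fst R (Suc j) (after n (Suc (Suc j)) (?T h) h)"
        by (rule impulse_strategy_mono[OF R after_sp]) (use h 3 in simp)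
      then show ?thesis
        using gt(1)[of "Suc j" h] gt(1)[of j "restrict h {0..<Suc k}"] T 3
          restrict_after[of "Suc j" "Suc (Suc j)" n "?T h" h]
        by (simp add: add_left_mono)
    qed
  next
    fix k and h h' :: "'a history"
    assume h: "h \<in> space (history_space (Suc k))" and h': "h' \<in> space (history_space (Suc k))"
      and agree: "agree_until (Suc k) (fst ?W k h) h h'"
    show "fst ?W k h' = fst ?W k h \<and> snd ?W k h' = snd ?W k h"
    proof (cases "k \<le> n")
      case True
      then show ?thesis using impulse_strategy_deterministic[OF Q h h'] agree le by simp
    next
      case False
      then obtain j where j: "k = Suc n + j" using gt_ex by auto
      \<comment> \<open>The joined time is at least \<open>?T h\<close>, so the histories agree
        until \<open>?T h\<close>, and therefore \<open>R\<close> is started at the same time in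
        both.\<close>
      have "agree_until (Suc n) (?T h) (restrict h {0..<Suc n}) (restrict h' {0..<Suc n})"
        using agree_until_mono[OF agree, of "?T h" "Suc n"] j gt(1)[of j h]
        by (auto simp: agree_until_def)
      then have T: "?T h' = ?T h"
        using h h' j by (intro impulse_strategy_deterministic[OF Q]) (auto intro!: restrict_history_space)
      show ?thesis
      proof (cases "?T h")
        case (real r)
        have "agree_until (Suc j) (fst R j (after n (Suc j) (?T h) h)) (after n (Suc j) (?T h) h) (after n (Suc j) (?T h) h')"
          unfolding agree_until_def
        proof (intro allI impI)
          fix i s assume i: "i < Suc j" and s: "0 \<le> s" "ennreal s \<le> fst R j (after n (Suc j) (?T h) h)"
          have "ennreal (r + s) \<le> fst ?W k h"
            unfolding j gt(1) using s real by (auto simp: intro!: add_left_mono)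
          then show "after n (Suc j) (?T h) h i s = after n (Suc j) (?T h) h' i s"
            using agree i s real j unfolding agree_until_def after_def by (auto simp: shift_def)
        qed
        then have "fst R j (after n (Suc j) (?T h) h') = fst R j (after n (Suc j) (?T h) h)
           \<and> snd R j (after n (Suc j) (?T h) h') = snd R j (after n (Suc j) (?T h) h)"
          using h h' j by (intro conjI impulse_strategy_deterministic[OF R] after_space) auto
        then show ?thesis unfolding j gt T by simp
      next
        \<comment> \<open>Then the impulse itself is at infinity, and agreement until infinity is
          equality of the histories.\<close>
        case top
        have "h = h'"
        proof -
          have "h i = h' i" if "i < Suc k" for i
          proof
            fix s
            have "fst ?W k h = top" unfolding j gt using top by simp
            then show "h i s = h' i s" using agree h h' that
              by (cases "0 \<le> s") (auto simp: agree_until_def space_history_space space_path_space PiE_iff extensional_def)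
          qed
          then show ?thesis using h h'
            by (intro PiE_ext[of h "{0..<Suc k}" "\<lambda>_. space path_space"]) (auto simp: space_history_space)
        qed
        then show ?thesis by simp
      qed
    qed
  qed
qed

section \<open>The law of a history\<close>

text \<open>The law of the first \<open>n\<close> coordinates. Quantities up to impulse
  \<open>n\<close> depend on \<open>Suc n\<close> coordinates only, and on this level they are
  iterated integrals against \<open>coordinate_kernel\<close>; \<open>distr_controlled_law\<close>
  connects them with the projective limit.\<close>

definition history_law ::
    "('a::metric_space \<Rightarrow> (real \<Rightarrow> 'a) measure) \<Rightarrow> 'a strategy \<Rightarrow> 'a \<Rightarrow> nat \<Rightarrow> 'a history measure" where
  "history_law P V x n =
     Ionescu_Tulcea.C (coordinate_kernel P V x) (\<lambda>_. path_space) 0 n (\<lambda>_. undefined)"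

lemma measurable_history_fun_upd:
  assumes "h \<in> space (history_space n)"
  shows "(\<lambda>\<omega>. h(n := \<omega>)) \<in> path_space \<rightarrow>\<^sub>M history_space (Suc n)"
  unfolding history_space_def
  by (rule measurable_fun_upd[where J="{0..<n}"]) (use assms in \<open>auto simp: history_space_def\<close>)

section \<open>Finite histories under the controlled law\<close>

context markov_process begin

lemma P_prob: "prob_space (P y)" and P_sets: "sets (P y) = sets path_space"
  using measurable_space[OF kernel, of y] by (auto simp: space_prob_algebra)

lemma P_space: "space (P y) = space path_space"
  by (rule sets_eq_imp_space_eq[OF P_sets])

lemma sets_history_law:
  assumes "impulse_strategy U V"
  shows "sets (history_law P V x n) = sets (history_space n)"
proof -
  interpret Ionescu_Tulcea "coordinate_kernel P V x" "\<lambda>_. path_space"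
    by (rule Ionescu_Tulcea_coordinate_kernel[OF assms])
  show ?thesis using sets_C[of "\<lambda>_. undefined" 0 n]
    by (simp add: history_law_def history_space_def space_PiM)
qed

lemma space_history_law:
  assumes "impulse_strategy U V"
  shows "space (history_law P V x n) = space (history_space n)"
  by (rule sets_eq_imp_space_eq[OF sets_history_law[OF assms]])

lemma measurable_history_law:
  assumes "impulse_strategy U V"
  shows "measurable (history_law P V x n) N = measurable (history_space n) N"
  by (rule measurable_cong_sets[OF sets_history_law[OF assms] refl])

lemma prob_space_history_law:
  assumes "impulse_strategy U V"
  shows "prob_space (history_law P V x n)"
proof -
  interpret Ionescu_Tulcea "coordinate_kernel P V x" "\<lambda>_. path_space"
    by (rule Ionescu_Tulcea_coordinate_kernel[OF assms])
  show ?thesis using prob_space_C[of "\<lambda>_. undefined" 0 n]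
    by (simp add: history_law_def space_PiM)
qed

lemma distr_controlled_law:
  assumes "impulse_strategy U V"
  shows "distr (controlled_law P V x) (history_space n) (\<lambda>\<omega>. restrict \<omega> {0..<n}) = history_law P V x n"
proof -
  interpret Ionescu_Tulcea "coordinate_kernel P V x" "\<lambda>_. path_space"
    by (rule Ionescu_Tulcea_coordinate_kernel[OF assms])
  let ?\<omega> = "\<lambda>_. undefined"
  have u: "?\<omega> \<in> space (Pi\<^sub>M {0..<0::nat} (\<lambda>_. path_space))" by (simp add: space_PiM PiE_iff)
  \<comment> \<open>\<open>CI\<close> of a finite index set is computed on the smallest initial
    segment containing it, which for \<open>{0..<n}\<close> is the set itself.\<close>
  have "up_to {0..<n} \<le> n" by (simp add: up_to_iff)
  moreover have "n \<le> up_to {0..<n}" using up_to_less[of "{0..<n}" "n - 1"] by (cases n) auto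
  ultimately have n: "up_to {0..<n} = n" by simp
  have "CI {0..<n} = distr (C 0 n ?\<omega>) (Pi\<^sub>M {0..<n} (\<lambda>_. path_space)) (\<lambda>\<omega>. restrict \<omega> {0..<n})"
    by (simp add: CI_def n)
  also have "\<dots> = C 0 n ?\<omega>" using distr_C[OF order_refl u, of n] by simp
  finally show ?thesis
    using distr_lim[of "{0..<n}"] by (simp add: controlled_law_def history_law_def history_space_def)
qed

lemma sets_controlled_law:
  assumes "impulse_strategy U V"
  shows "sets (controlled_law P V x) = sets (Pi\<^sub>M UNIV (\<lambda>_. path_space))"
proof -
  interpret Ionescu_Tulcea "coordinate_kernel P V x" "\<lambda>_. path_space"
    by (rule Ionescu_Tulcea_coordinate_kernel[OF assms])
  show ?thesis unfolding controlled_law_def by (rule PF.sets_lim)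
qed

lemma measurable_restrict_controlled_law:
  assumes "impulse_strategy U V"
  shows "(\<lambda>\<omega>. restrict \<omega> {0..<n}) \<in> controlled_law P V x \<rightarrow>\<^sub>M history_space n"
  unfolding measurable_cong_sets[OF sets_controlled_law[OF assms] refl] history_space_def
  by (rule measurable_restrict_subset) simp

lemma prob_space_controlled_law:
  assumes "impulse_strategy U V"
  shows "prob_space (controlled_law P V x)"
  using prob_space_history_law[OF assms, of x 0]
  unfolding distr_controlled_law[OF assms, symmetric]
  by (rule prob_space_distrD[OF measurable_restrict_controlled_law[OF assms]])

lemma nn_integral_controlled_law:
  assumes "impulse_strategy U V" and "F \<in> borel_measurable (history_space n)"
  shows "(\<integral>\<^sup>+\<omega>. F (restrict \<omega> {0..<n}) \<partial>controlled_law P V x) = (\<integral>\<^sup>+h. F h \<partial>history_law P V x n)"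
  unfolding distr_controlled_law[OF assms(1), symmetric]
  by (rule nn_integral_distr[symmetric, OF measurable_restrict_controlled_law[OF assms(1)]])
     (use assms(2) in simp)

lemma nn_integral_history_law_restrict:
  assumes V: "impulse_strategy U V" and F: "F \<in> borel_measurable (history_space m)" and "m \<le> n"
  shows "(\<integral>\<^sup>+h. F (restrict h {0..<m}) \<partial>history_law P V x n) = (\<integral>\<^sup>+h. F h \<partial>history_law P V x m)"
proof -
  have "(\<lambda>h. F (restrict h {0..<m})) \<in> borel_measurable (history_space n)"
    by (rule measurable_compose[OF measurable_history_restrict[OF \<open>m \<le> n\<close>] F])
  from nn_integral_controlled_law[OF V this, of x] nn_integral_controlled_law[OF V F, of x] \<open>m \<le> n\<close>
  show ?thesis by (simp only: restrict_restrict_le)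
qed

lemma nn_integral_history_law_1:
  assumes V: "impulse_strategy U V" and F: "F \<in> borel_measurable (history_space 1)"
  shows "(\<integral>\<^sup>+h. F h \<partial>history_law P V x 1) = (\<integral>\<^sup>+\<omega>. F ((\<lambda>_. undefined)(0 := \<omega>)) \<partial>P x)"
proof -
  interpret Ionescu_Tulcea "coordinate_kernel P V x" "\<lambda>_. path_space"
    by (rule Ionescu_Tulcea_coordinate_kernel[OF V])
  have u: "(\<lambda>_. undefined) \<in> space (Pi\<^sub>M {0..<0::nat} (\<lambda>_. path_space))" by (simp add: space_PiM PiE_iff)
  have "history_law P V x 1 = eP 0 (\<lambda>_. undefined)"
    using bind_return[OF measurable_eP u] by (simp add: history_law_def)
  then show ?thesis
    using nn_integral_eP[OF u, of F] F by (simp add: coordinate_kernel_def history_space_def)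
qed

text \<open>The kernel of coordinate \<open>Suc n\<close> is the image under \<open>splice\<close>
  of the uncontrolled law started at the last target, so integrating that coordinate out leaves an
  integral over uncontrolled paths.\<close>

lemma nn_integral_history_law_Suc:
  assumes V: "impulse_strategy U V" and F: "F \<in> borel_measurable (history_space (Suc (Suc n)))"
  defines "G \<equiv> \<lambda>h. \<integral>\<^sup>+\<omega>. F (h(Suc n := splice (h n) (fst V n h) \<omega>)) \<partial>P (snd V n h)"
  shows "(\<integral>\<^sup>+h. F h \<partial>history_law P V x (Suc (Suc n))) = (\<integral>\<^sup>+h. G h \<partial>history_law P V x (Suc n))"
    and "G \<in> borel_measurable (history_space (Suc n))"
proof -
  interpret Ionescu_Tulcea "coordinate_kernel P V x" "\<lambda>_. path_space"
    by (rule Ionescu_Tulcea_coordinate_kernel[OF V])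
  have F': "F \<in> borel_measurable (Pi\<^sub>M {0..<Suc (Suc n)} (\<lambda>_. path_space))"
    using F by (simp add: history_space_def)
  have G: "(\<integral>\<^sup>+h'. F h' \<partial>eP (Suc n) h) = G h" if h: "h \<in> space (history_space (Suc n))" for h
  proof -
    have hn: "h n \<in> space path_space" using h by (auto simp: space_history_space)
    have "splice (h n) (fst V n h) \<in> path_space \<rightarrow>\<^sub>M path_space"
      by (rule measurable_splice) (use hn in simp_all)
    then have s: "splice (h n) (fst V n h) \<in> P (snd V n h) \<rightarrow>\<^sub>M path_space"
      by (simp add: measurable_cong_sets[OF P_sets refl])
    have "(\<lambda>\<omega>. F (h(Suc n := \<omega>))) \<in> borel_measurable path_space"
      by (rule measurable_compose[OF measurable_history_fun_upd[OF h] F])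
    then show ?thesis
      using nn_integral_eP[of h "Suc n" F] h F'
      by (simp add: history_space_def coordinate_kernel_def nn_integral_distr[OF s] G_def)
  qed
  have "(\<lambda>h. \<integral>\<^sup>+h'. F h' \<partial>eP (Suc n) h) \<in> borel_measurable (history_space (Suc n))"
    unfolding history_space_def
    by (rule measurable_compose[OF measurable_eP nn_integral_measurable_subprob_algebra]) (rule F')
  then show "G \<in> borel_measurable (history_space (Suc n))"
    by (rule measurable_cong[THEN iffD1, rotated]) (rule G)
  have "history_law P V x (Suc (Suc n)) = history_law P V x (Suc n) \<bind> eP (Suc n)"
    by (simp add: history_law_def)
  then have "(\<integral>\<^sup>+h. F h \<partial>history_law P V x (Suc (Suc n))) = (\<integral>\<^sup>+h. \<integral>\<^sup>+h'. F h' \<partial>eP (Suc n) h \<partial>history_law P V x (Suc n))"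
    using nn_integral_bind[OF F', of "eP (Suc n)" "history_law P V x (Suc n)"] measurable_eP[of "Suc n"]
    by (simp add: measurable_history_law[OF V] history_space_def)
  also have "\<dots> = (\<integral>\<^sup>+h. G h \<partial>history_law P V x (Suc n))"
    by (rule nn_integral_cong) (simp add: G space_history_law[OF V])
  finally show "(\<integral>\<^sup>+h. F h \<partial>history_law P V x (Suc (Suc n))) = (\<integral>\<^sup>+h. G h \<partial>history_law P V x (Suc n))" .
qed

lemma glue_fun_upd:
  "(glue n (Suc k) T h h')(Suc (n + Suc k) := splice (h n) T \<omega>) = glue n (Suc (Suc k)) T h (h'(Suc k := \<omega>))"
  by (auto simp: glue_def fun_eq_iff restrict_def)

lemma glue_fun_upd_0:
  assumes "h \<in> space (history_space (Suc n))"
  shows "h(Suc n := splice (h n) T \<omega>) = glue n (Suc 0) T h ((\<lambda>_. undefined)(0 := \<omega>))"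
  using assms by (auto simp: glue_def fun_eq_iff restrict_def space_history_space PiE_iff extensional_def)

text \<open>The strong Markov property at the impulse time \<open>n\<close>, which holds by construction of the law.\<close>

lemma nn_integral_history_law_continues:
  assumes W: "impulse_strategy U W"
    and R: "\<And>h. h \<in> space (history_space (Suc n)) \<Longrightarrow> fst W n h < \<infinity> \<Longrightarrow>
        impulse_strategy U (R h) \<and> continues W n h (R h)"
    and fin: "AE h in history_law P W x (Suc n). fst W n h < \<infinity>"
    and F: "F \<in> borel_measurable (history_space (Suc n + Suc k))"
  shows "(\<integral>\<^sup>+h. F h \<partial>history_law P W x (Suc n + Suc k)) =
    (\<integral>\<^sup>+h. \<integral>\<^sup>+h'. F (glue n (Suc k) (fst W n h) h h') \<partial>history_law P (R h) (snd W n h) (Suc k) \<partial>history_law P W x (Suc n))"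
  using F
\<comment> \<open>The last coordinate is integrated out, once in the history of \<open>W\<close> and
  once in that of \<open>R h\<close>; \<open>continues\<close> and \<open>splice_assoc\<close>
  identify the two operations. They are compared pointwise in \<open>h\<close>, so \<open>R\<close>
  may be chosen separately for each past.\<close>
proof (induction k arbitrary: F)
  case 0
  then have F: "F \<in> borel_measurable (history_space (Suc (Suc n)))" by simp
  have "(\<integral>\<^sup>+\<omega>. F (h(Suc n := splice (h n) (fst W n h) \<omega>)) \<partial>P (snd W n h)) =
      (\<integral>\<^sup>+h'. F (glue n (Suc 0) (fst W n h) h h') \<partial>history_law P (R h) (snd W n h) (Suc 0))"
    if h: "h \<in> space (history_space (Suc n))" and "fst W n h < \<infinity>" for h
  proof -
    have "(\<lambda>h'. F (glue n (Suc 0) (fst W n h) h h')) \<in> borel_measurable (history_space 1)"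
      using measurable_compose[OF measurable_glue[OF h, of "Suc 0"] 0] by simp
    from nn_integral_history_law_1[OF conjunct1[OF R[OF that]] this]
    show ?thesis by (simp add: glue_fun_upd_0[OF h])
  qed
  then show ?case
    using nn_integral_history_law_Suc(1)[OF W F, of x] fin
    by (auto intro!: nn_integral_cong_AE simp: space_history_law[OF W])
next
  case (Suc k)
  let ?N = "n + Suc k"
  have F: "F \<in> borel_measurable (history_space (Suc (Suc ?N)))" using Suc.prems by simp
  define G where "G = (\<lambda>g. \<integral>\<^sup>+\<omega>. F (g(Suc ?N := splice (g ?N) (fst W ?N g) \<omega>)) \<partial>P (snd W ?N g))"
  have G: "G \<in> borel_measurable (history_space (Suc n + Suc k))"
    using nn_integral_history_law_Suc(2)[OF W F] by (simp add: G_def)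
  have "(\<integral>\<^sup>+h. F h \<partial>history_law P W x (Suc (Suc ?N))) = (\<integral>\<^sup>+h. G h \<partial>history_law P W x (Suc ?N))"
    using nn_integral_history_law_Suc(1)[OF W F] by (simp add: G_def)
  also have "(\<integral>\<^sup>+h. G h \<partial>history_law P W x (Suc ?N)) =
      (\<integral>\<^sup>+h. \<integral>\<^sup>+h'. G (glue n (Suc k) (fst W n h) h h') \<partial>history_law P (R h) (snd W n h) (Suc k) \<partial>history_law P W x (Suc n))"
    using Suc.IH[OF G] by simp
  also have "\<dots> = (\<integral>\<^sup>+h. \<integral>\<^sup>+h'. F (glue n (Suc (Suc k)) (fst W n h) h h') \<partial>history_law P (R h) (snd W n h) (Suc (Suc k)) \<partial>history_law P W x (Suc n))"
  proof (rule nn_integral_cong_AE, use fin AE_space in eventually_elim)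
    fix h assume fin: "fst W n h < \<infinity>" and "h \<in> space (history_law P W x (Suc n))"
    then have h: "h \<in> space (history_space (Suc n))" by (simp add: space_history_law[OF W])
    let ?T = "fst W n h"
    have R': "impulse_strategy U (R h)" "continues W n h (R h)" using R[OF h fin] by auto
    have F': "(\<lambda>h'. F (glue n (Suc (Suc k)) ?T h h')) \<in> borel_measurable (history_space (Suc (Suc k)))"
      using measurable_compose[OF measurable_glue[OF h, of "Suc (Suc k)"] Suc.prems] .
    have "G (glue n (Suc k) ?T h h') =
        (\<integral>\<^sup>+\<omega>. F (glue n (Suc (Suc k)) ?T h (h'(Suc k := splice (h' k) (fst (R h) k h') \<omega>))) \<partial>P (snd (R h) k h'))"
      if h': "h' \<in> space (history_space (Suc k))" for h'
    proof -
      let ?g = "glue n (Suc k) ?T h h'"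
      have g: "fst W ?N ?g = ?T + fst (R h) k h'" "snd W ?N ?g = snd (R h) k h'"
        using R'(2) h' by (simp_all add: continues_def)
      have gN: "?g ?N = splice (h n) ?T (h' k)" by (simp add: glue_def)
      show ?thesis unfolding G_def g gN splice_assoc[OF fin] glue_fun_upd ..
    qed
    then have "(\<integral>\<^sup>+h'. G (glue n (Suc k) ?T h h') \<partial>history_law P (R h) (snd W n h) (Suc k)) =
       (\<integral>\<^sup>+h'. (\<integral>\<^sup>+\<omega>. F (glue n (Suc (Suc k)) ?T h (h'(Suc k := splice (h' k) (fst (R h) k h') \<omega>))) \<partial>P (snd (R h) k h'))
          \<partial>history_law P (R h) (snd W n h) (Suc k))"
      by (intro nn_integral_cong) (simp add: space_history_law[OF R'(1)])
    also have "\<dots> = (\<integral>\<^sup>+h'. F (glue n (Suc (Suc k)) ?T h h') \<partial>history_law P (R h) (snd W n h) (Suc (Suc k)))"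
      by (rule nn_integral_history_law_Suc(1)[OF R'(1) F', symmetric])
    finally
    show "(\<integral>\<^sup>+h'. G (glue n (Suc k) (fst W n h) h h') \<partial>history_law P (R h) (snd W n h) (Suc k)) =
       (\<integral>\<^sup>+h'. F (glue n (Suc (Suc k)) (fst W n h) h h') \<partial>history_law P (R h) (snd W n h) (Suc (Suc k)))" .
  qed
  finally show ?case by simp
qed

end

section \<open>Gains along the cycles of a strategy\<close>

definition start_time :: "'a strategy \<Rightarrow> nat \<Rightarrow> 'a history \<Rightarrow> ennreal" where
  "start_time V i h = (case i of 0 \<Rightarrow> 0 | Suc j \<Rightarrow> impulse_time V j h)"

text \<open>Cycle \<open>i\<close> is the stretch of coordinate \<open>i\<close> between impulses
  \<open>i - 1\<close> and \<open>i\<close>. A running rate \<open>g\<close> and an impulse amount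
  \<open>k\<close> with values in \<open>ennreal\<close> cover all functionals at once: rate
  \<open>1\<close> gives durations, \<open>f + M\<close> the raised rewards, an indicator occupation
  times, and rate \<open>0\<close> with \<open>k = cost U c\<close> the impulse costs. Nothing is
  booked for an impulse at infinity.\<close>

definition gain :: "('a \<Rightarrow> ennreal) \<Rightarrow> ('a \<Rightarrow> 'a \<Rightarrow> ennreal) \<Rightarrow> 'a strategy \<Rightarrow> nat \<Rightarrow> 'a history \<Rightarrow> ennreal" where
  "gain g k V i h =
     (\<integral>\<^sup>+s. g (h i s) * indicator {s. 0 \<le> s \<and> start_time V i h \<le> ennreal s \<and> ennreal s < impulse_time V i h} s \<partial>lborel) +
     (if impulse_time V i h < \<infinity> then k (pre_impulse_state V i h) (impulse_target V i h) else 0)"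

definition mean_gain ::
    "('a::metric_space \<Rightarrow> (real \<Rightarrow> 'a) measure) \<Rightarrow> ('a \<Rightarrow> ennreal) \<Rightarrow> ('a \<Rightarrow> 'a \<Rightarrow> ennreal) \<Rightarrow>
     'a strategy \<Rightarrow> 'a \<Rightarrow> nat \<Rightarrow> ennreal" where
  "mean_gain P g k V x n = (\<integral>\<^sup>+h. (\<Sum>i\<le>n. gain g k V i h) \<partial>history_law P V x (Suc n))"

lemma impulse_time_restrict: "i < n \<Longrightarrow> impulse_time V i (restrict \<omega> {0..<n}) = impulse_time V i \<omega>"
  by (simp only: impulse_time_def restrict_restrict_le Suc_le_eq)

lemma impulse_target_restrict: "i < n \<Longrightarrow> impulse_target V i (restrict \<omega> {0..<n}) = impulse_target V i \<omega>"
  by (simp only: impulse_target_def restrict_restrict_le Suc_le_eq)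

lemma impulse_time_history: "h \<in> space (history_space (Suc n)) \<Longrightarrow> impulse_time V n h = fst V n h"
  by (simp add: impulse_time_def restrict_history)

lemma start_time_restrict: "i < n \<Longrightarrow> start_time V i (restrict \<omega> {0..<n}) = start_time V i \<omega>"
  by (simp add: start_time_def impulse_time_restrict split: nat.split)

lemma gain_restrict: "i < n \<Longrightarrow> gain g k V i (restrict \<omega> {0..<n}) = gain g k V i \<omega>"
  by (simp add: gain_def impulse_time_restrict impulse_target_restrict start_time_restrict pre_impulse_state_def)

lemma gain_cong:
  assumes "\<And>j. j \<le> i \<Longrightarrow> fst V j = fst W j \<and> snd V j = snd W j"
  shows "gain g k V i = gain g k W i"
proof -
  have "impulse_time V j = impulse_time W j" "impulse_target V j = impulse_target W j" if "j \<le> i" for j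
    using assms[OF that] by (auto simp: impulse_time_def impulse_target_def fun_eq_iff)
  then show ?thesis
    by (auto simp: gain_def fun_eq_iff start_time_def pre_impulse_state_def split: nat.split)
qed

lemma impulse_time_mono:
  assumes V: "impulse_strategy U V" and h: "h \<in> space (history_space n)" and ij: "i \<le> j" "j < n"
  shows "impulse_time V i h \<le> impulse_time V j h"
  using impulse_strategy_mono_le[OF V ij(1), of "restrict h {0..<Suc j}"] restrict_history_space[OF h, of "Suc j"] ij
  by (simp only: impulse_time_def restrict_restrict_le Suc_le_mono Suc_le_eq)

context
  fixes U :: "'a::metric_space set" and V :: "'a strategy"
  assumes V: "impulse_strategy U V"
begin

lemma measurable_impulse_time: "i < n \<Longrightarrow> impulse_time V i \<in> borel_measurable (history_space n)"
  unfolding impulse_time_def[abs_def]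
  by (rule measurable_compose[OF measurable_history_restrict impulse_strategy_measurable(1)[OF V]]) simp

lemma measurable_impulse_target: "i < n \<Longrightarrow> impulse_target V i \<in> history_space n \<rightarrow>\<^sub>M borel"
  unfolding impulse_target_def[abs_def]
  by (rule measurable_compose[OF measurable_history_restrict impulse_strategy_measurable(2)[OF V]]) simp

lemma measurable_start_time: "i < n \<Longrightarrow> start_time V i \<in> borel_measurable (history_space n)"
  by (cases i) (auto simp: start_time_def[abs_def] measurable_impulse_time)

lemma measurable_pre_impulse_state:
  assumes "i < n" shows "pre_impulse_state V i \<in> history_space n \<rightarrow>\<^sub>M borel"
  unfolding pre_impulse_state_def[abs_def]
  by (rule measurable_path_eval_pair[OF measurable_history_component[OF assms]])
     (auto intro: borel_measurable_enn2real measurable_impulse_time assms)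

lemma measurable_gain:
  assumes [measurable]: "g \<in> borel_measurable borel" and k: "case_prod k \<in> borel_measurable (borel \<Otimes>\<^sub>M borel)"
    and i: "i < n"
  shows "gain g k V i \<in> borel_measurable (history_space n)"
proof -
  note [measurable] = measurable_impulse_time[OF i] measurable_start_time[OF i]
    measurable_impulse_target[OF i] measurable_pre_impulse_state[OF i]
  have [measurable]: "(\<lambda>h. k (pre_impulse_state V i h) (impulse_target V i h)) \<in> borel_measurable (history_space n)"
    using measurable_compose[OF measurable_Pair[OF measurable_pre_impulse_state[OF i] measurable_impulse_target[OF i]] k]
    by simp
  have [measurable]: "(\<lambda>(h, s). h i (max 0 s)) \<in> history_space n \<Otimes>\<^sub>M lborel \<rightarrow>\<^sub>M borel"
  proof -
    have "(\<lambda>p. fst p i) \<in> history_space n \<Otimes>\<^sub>M lborel \<rightarrow>\<^sub>M path_space"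
      by (rule measurable_compose[OF measurable_fst measurable_history_component[OF i]])
    from measurable_path_eval_pair[OF this, of "\<lambda>p. max 0 (snd p)"] show ?thesis
      by (simp add: split_beta')
  qed
  have "(\<lambda>h. \<integral>\<^sup>+s. g (h i (max 0 s)) *
      indicator {s. 0 \<le> s \<and> start_time V i h \<le> ennreal s \<and> ennreal s < impulse_time V i h} s \<partial>lborel)
      \<in> borel_measurable (history_space n)"
    by measurable
  moreover have "(\<integral>\<^sup>+s. g (h i (max 0 s)) *
      indicator {s. 0 \<le> s \<and> start_time V i h \<le> ennreal s \<and> ennreal s < impulse_time V i h} s \<partial>lborel) =
      (\<integral>\<^sup>+s. g (h i s) *
      indicator {s. 0 \<le> s \<and> start_time V i h \<le> ennreal s \<and> ennreal s < impulse_time V i h} s \<partial>lborel)" for h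
    by (intro nn_integral_cong) (auto split: split_indicator)
  ultimately have [measurable]: "(\<lambda>h. \<integral>\<^sup>+s. g (h i s) *
      indicator {s. 0 \<le> s \<and> start_time V i h \<le> ennreal s \<and> ennreal s < impulse_time V i h} s \<partial>lborel)
      \<in> borel_measurable (history_space n)"
    by simp
  show ?thesis unfolding gain_def[abs_def] by measurable
qed

end

text \<open>Clipping the argument at \<open>0\<close> keeps negative times, where paths carry no
  information, out of all measurability questions.\<close>

lemma measurable_path_time:
  assumes "cadlag (\<omega> :: real \<Rightarrow> 'a::metric_space)" shows "(\<lambda>s. \<omega> (max 0 s)) \<in> borel_measurable borel"
proof -
  have "cadlag (restrict \<omega> {0..})" using cadlag_cong[OF _ assms, of "restrict \<omega> {0..}"] by simp
  then have "(\<lambda>_. restrict \<omega> {0..}) \<in> borel \<rightarrow>\<^sub>M path_space"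
    by (simp add: space_path_space)
  from measurable_path_eval_pair[OF this, of "max 0"] show ?thesis by simp
qed

lemma impulse_time_continues:
  assumes h: "h \<in> space (history_space (Suc n))" and h': "h' \<in> space (history_space (Suc k))"
    and R: "continues W n h R" and j: "j \<le> k"
  defines "g \<equiv> glue n (Suc k) (fst W n h) h h'"
  shows "impulse_time W (Suc n + j) g = fst W n h + impulse_time R j h'"
    and "impulse_target W (Suc n + j) g = impulse_target R j h'"
    and "start_time W (Suc n + j) g = fst W n h + start_time R j h'"
proof -
  have g: "restrict g {0..<Suc (Suc n + i)} = glue n (Suc i) (fst W n h) h (restrict h' {0..<Suc i})" if "i \<le> k" for i
    using restrict_glue[of "Suc i" "Suc k" n "fst W n h" h h'] that unfolding g_def by simp
  have sp: "restrict h' {0..<Suc i} \<in> space (history_space (Suc i))" if "i \<le> k" for i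
    using restrict_history_space[OF h', of "Suc i"] that by simp
  have time: "impulse_time W (Suc n + i) g = fst W n h + impulse_time R i h'" if "i \<le> k" for i
    unfolding impulse_time_def g[OF that] using R sp[OF that] by (simp add: continues_def)
  then show "impulse_time W (Suc n + j) g = fst W n h + impulse_time R j h'" using j .
  show "impulse_target W (Suc n + j) g = impulse_target R j h'"
    unfolding impulse_target_def g[OF j] using R sp[OF j] by (simp add: continues_def)
  show "start_time W (Suc n + j) g = fst W n h + start_time R j h'"
  proof (cases j)
    case 0
    then show ?thesis unfolding g_def
      by (simp add: start_time_def impulse_time_def restrict_glue_le restrict_history[OF h])
  next
    case (Suc i)
    then show ?thesis using time[of i] j by (simp add: start_time_def)
  qed
qed

text \<open>Translation invariance of Lebesgue measure: the substitution of \<open>r + s\<close> for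
  \<open>s\<close>, with \<open>r\<close> the time of impulse \<open>n\<close>, carries the delayed
  cycle back to the original one.\<close>

lemma gain_continues:
  assumes h: "h \<in> space (history_space (Suc n))" and h': "h' \<in> space (history_space (Suc k))"
    and R: "continues W n h R" and fin: "fst W n h < \<infinity>" and j: "j \<le> k"
    and g[measurable]: "g \<in> borel_measurable borel"
  shows "gain g c W (Suc n + j) (glue n (Suc k) (fst W n h) h h') = gain g c R j h'"
proof -
  let ?g = "glue n (Suc k) (fst W n h) h h'"
  obtain r where r: "0 \<le> r" "fst W n h = ennreal r" using fin by (cases "fst W n h") auto
  have time: "impulse_time W (Suc n + j) ?g = ennreal r + impulse_time R j h'"
    "impulse_target W (Suc n + j) ?g = impulse_target R j h'"
    "start_time W (Suc n + j) ?g = ennreal r + start_time R j h'"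
    using impulse_time_continues[OF h h' R j] by (simp_all only: r(2)[symmetric])
  have comp: "?g (Suc n + j) = splice (h n) (ennreal r) (h' j)" using j r by (simp add: glue_def)
  have "cadlag (?g (Suc n + j))"
    using history_space_cadlag[OF glue_space[OF h h']] j by simp
  note [measurable] = measurable_path_time[OF this]
  let ?f = "\<lambda>s. g (?g (Suc n + j) (max 0 s)) *
      indicator {s. 0 \<le> s \<and> ennreal r + start_time R j h' \<le> ennreal s \<and> ennreal s < ennreal r + impulse_time R j h'} s"
  have "(\<integral>\<^sup>+s. g (?g (Suc n + j) s) *
      indicator {s. 0 \<le> s \<and> start_time W (Suc n + j) ?g \<le> ennreal s \<and> ennreal s < impulse_time W (Suc n + j) ?g} s \<partial>lborel) =
      (\<integral>\<^sup>+s. ?f s \<partial>lborel)"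
    unfolding time by (intro nn_integral_cong) (auto split: split_indicator)
  also have "\<dots> = (\<integral>\<^sup>+s. ?f (r + 1 * s) \<partial>lborel)"
  proof -
    have "?f \<in> borel_measurable borel" by measurable
    from nn_integral_real_affine[OF this, of 1 r] show ?thesis by simp
  qed
  also have "\<dots> = (\<integral>\<^sup>+s. g (h' j s) *
      indicator {s. 0 \<le> s \<and> start_time R j h' \<le> ennreal s \<and> ennreal s < impulse_time R j h'} s \<partial>lborel)"
  proof (intro nn_integral_cong)
    fix s
    show "?f (r + 1 * s) = g (h' j s) *
      indicator {s. 0 \<le> s \<and> start_time R j h' \<le> ennreal s \<and> ennreal s < impulse_time R j h'} s"
    proof (cases "0 \<le> s")
      case True
      have "?g (Suc n + j) (max 0 (r + s)) = h' j s"
        unfolding comp using True r by (simp add: splice_def ennreal_less_iff)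
      then show ?thesis using True r
        by (auto split: split_indicator simp: ennreal_plus ennreal_add_left_cancel_le ennreal_add_left_cancel_less simp del: ennreal_plus[symmetric])
    next
      \<comment> \<open>A negative \<open>s\<close> corresponds to a time before \<open>r\<close>,
        hence before the start of the delayed cycle.\<close>
      case False
      then have "\<not> (0 \<le> r + s \<and> ennreal r + start_time R j h' \<le> ennreal (r + s))"
        using order_trans[of "ennreal r" "ennreal r + start_time R j h'" "ennreal (r + s)"] r(1) by auto
      then show ?thesis using False by (auto split: split_indicator)
    qed
  qed
  finally have 1: "(\<integral>\<^sup>+s. g (?g (Suc n + j) s) *
      indicator {s. 0 \<le> s \<and> start_time W (Suc n + j) ?g \<le> ennreal s \<and> ennreal s < impulse_time W (Suc n + j) ?g} s \<partial>lborel) =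
      (\<integral>\<^sup>+s. g (h' j s) *
      indicator {s. 0 \<le> s \<and> start_time R j h' \<le> ennreal s \<and> ennreal s < impulse_time R j h'} s \<partial>lborel)" .
  have "pre_impulse_state W (Suc n + j) ?g = pre_impulse_state R j h'" if fin': "impulse_time R j h' < \<infinity>"
  proof -
    obtain u where u: "0 \<le> u" "impulse_time R j h' = ennreal u" using fin' by (cases "impulse_time R j h'") auto
    have "impulse_time W (Suc n + j) ?g = ennreal (r + u)" using time(1) u r by simp
    then have *: "enn2real (impulse_time W (Suc n + j) ?g) = r + u" "enn2real (impulse_time R j h') = u"
      using u r by (simp_all del: ennreal_plus)
    show ?thesis
      unfolding pre_impulse_state_def comp * using u r by (simp add: splice_def ennreal_less_iff)
  qed
  then show ?thesis
    unfolding gain_def 1 unfolding time(1,2) using fin by auto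
qed

lemma nn_integral_const_add:
  assumes "prob_space M" "F \<in> borel_measurable M"
  shows "(\<integral>\<^sup>+x. a + F x \<partial>M) = a + (\<integral>\<^sup>+x. F x \<partial>M)"
  using assms by (subst nn_integral_add) (auto simp: prob_space.emeasure_space_1)

lemma measurable_segment:
  assumes "cadlag (\<omega> :: real \<Rightarrow> 'a::metric_space)" and [measurable]: "g \<in> borel_measurable borel"
  shows "(\<lambda>s. g (\<omega> s) * indicator {s. 0 \<le> s \<and> a \<le> ennreal s \<and> ennreal s < b} s :: ennreal) \<in> borel_measurable borel"
proof -
  note [measurable] = measurable_path_time[OF assms(1)]
  have "(\<lambda>s. g (\<omega> (max 0 s)) * indicator {s. 0 \<le> s \<and> a \<le> ennreal s \<and> ennreal s < b} s) \<in> borel_measurable borel"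
    by measurable
  also have "(\<lambda>s. g (\<omega> (max 0 s)) * indicator {s. 0 \<le> s \<and> a \<le> ennreal s \<and> ennreal s < b} s) =
    (\<lambda>s. g (\<omega> s) * indicator {s. 0 \<le> s \<and> a \<le> ennreal s \<and> ennreal s < b} s)"
    by (auto simp: fun_eq_iff split: split_indicator)
  finally show ?thesis .
qed

lemma sum_atMost_Suc_add:
  fixes a :: "nat \<Rightarrow> 'b::comm_monoid_add"
  shows "(\<Sum>i\<le>Suc n + k. a i) = (\<Sum>i\<le>n. a i) + (\<Sum>j\<le>k. a (Suc n + j))"
  by (induction k) (simp_all add: add.assoc)

section \<open>Mean gains: splitting at an impulse, monotonicity and linearity\<close>

context markov_process begin

text \<open>Coordinate \<open>n\<close>, the last one in question, is started by impulse
  \<open>n - 1\<close>; impulse \<open>n\<close> itself does not yet influence the law.\<close>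

lemma history_law_cong:
  assumes V: "impulse_strategy U V" and W: "impulse_strategy U W"
    and eq: "\<And>i. i < n \<Longrightarrow> fst V i = fst W i \<and> snd V i = snd W i"
  shows "history_law P V x (Suc n) = history_law P W x (Suc n)"
proof -
  interpret V: Ionescu_Tulcea "coordinate_kernel P V x" "\<lambda>_. path_space"
    by (rule Ionescu_Tulcea_coordinate_kernel[OF V])
  interpret W: Ionescu_Tulcea "coordinate_kernel P W x" "\<lambda>_. path_space"
    by (rule Ionescu_Tulcea_coordinate_kernel[OF W])
  have ker: "coordinate_kernel P V x m = coordinate_kernel P W x m" if "m \<le> n" for m
    using eq[of "m - 1"] that by (cases m) (auto simp: coordinate_kernel_def fun_eq_iff)
  have "V.C 0 m (\<lambda>_. undefined) = W.C 0 m (\<lambda>_. undefined)" if "m \<le> Suc n" for m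
    using that
  proof (induction m)
    case (Suc m)
    then have "V.eP m = W.eP m"
      using ker[of m] by (simp add: V.eP_def W.eP_def fun_eq_iff)
    then show ?case using Suc by simp
  qed simp
  from this[OF order_refl] show ?thesis unfolding history_law_def .
qed

lemma mean_gain_cong:
  assumes V: "impulse_strategy U V" and W: "impulse_strategy U W"
    and eq: "\<And>i. i \<le> n \<Longrightarrow> fst V i = fst W i \<and> snd V i = snd W i"
  shows "mean_gain P g k V x n = mean_gain P g k W x n"
proof -
  have "history_law P V x (Suc n) = history_law P W x (Suc n)"
    by (rule history_law_cong[OF V W]) (use eq in auto)
  moreover have "gain g k V i = gain g k W i" if "i \<le> n" for i
    by (rule gain_cong) (use eq that in auto)
  ultimately show ?thesis by (simp add: mean_gain_def)
qed

lemma mean_gain_controlled: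
  assumes V: "impulse_strategy U V"
    and g: "g \<in> borel_measurable borel" and k: "case_prod k \<in> borel_measurable (borel \<Otimes>\<^sub>M borel)"
  shows "mean_gain P g k V x n = (\<integral>\<^sup>+\<omega>. (\<Sum>i\<le>n. gain g k V i \<omega>) \<partial>controlled_law P V x)"
proof -
  have "(\<lambda>h. \<Sum>i\<le>n. gain g k V i h) \<in> borel_measurable (history_space (Suc n))"
    by (intro borel_measurable_sum measurable_gain[OF V g k]) auto
  from nn_integral_controlled_law[OF V this, of x] show ?thesis
    by (simp add: mean_gain_def gain_restrict)
qed

text \<open>The strong Markov property for gains. The constant \<open>a\<close> passes under the
  integral because the law has mass \<open>1\<close>; with it, an inequality with additive slack can
  be transferred from the whole to single pasts, where subtraction in \<open>ennreal\<close> would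
  fail.\<close>

lemma mean_gain_continues:
  assumes W: "impulse_strategy U W"
    and R: "\<And>h. h \<in> space (history_space (Suc n)) \<Longrightarrow> fst W n h < \<infinity> \<Longrightarrow>
        impulse_strategy U (R h) \<and> continues W n h (R h)"
    and fin: "AE h in history_law P W x (Suc n). fst W n h < \<infinity>"
    and g: "g \<in> borel_measurable borel" and k: "case_prod k \<in> borel_measurable (borel \<Otimes>\<^sub>M borel)"
  shows "a + mean_gain P g k W x (Suc n + m) =
    mean_gain P g k W x n + (\<integral>\<^sup>+h. a + mean_gain P g k (R h) (snd W n h) m \<partial>history_law P W x (Suc n))"
proof -
  let ?L = "history_law P W x"
  have meas: "gain g k W i \<in> borel_measurable (history_space l)" if "i < l" for i l
    by (rule measurable_gain[OF W g k that])
  define F where "F h = a + (\<Sum>j\<le>m. gain g k W (Suc n + j) h)" for h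
  have F: "F \<in> borel_measurable (history_space (Suc n + Suc m))"
    unfolding F_def[abs_def] by (intro borel_measurable_add borel_measurable_const borel_measurable_sum meas) auto
  have F0: "(\<lambda>h. \<Sum>i\<le>n. gain g k W i h) \<in> borel_measurable (history_space (Suc n))"
    by (intro borel_measurable_sum meas) auto
  have F1: "(\<lambda>h. \<Sum>i\<le>n. gain g k W i h) \<in> borel_measurable (history_space (Suc n + Suc m))"
    by (intro borel_measurable_sum meas) auto
  have F2: "(\<lambda>h. \<Sum>i\<le>Suc n + m. gain g k W i h) \<in> borel_measurable (history_space (Suc n + Suc m))"
    by (intro borel_measurable_sum meas) auto
  have "a + mean_gain P g k W x (Suc n + m) = (\<integral>\<^sup>+h. a + (\<Sum>i\<le>Suc n + m. gain g k W i h) \<partial>?L (Suc n + Suc m))"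
    unfolding mean_gain_def add_Suc_right
    by (rule nn_integral_const_add[symmetric]) (use F2 in \<open>simp_all only: measurable_history_law[OF W] prob_space_history_law[OF W] add_Suc_right\<close>)
  also have "\<dots> = (\<integral>\<^sup>+h. (\<Sum>i\<le>n. gain g k W i h) + F h \<partial>?L (Suc n + Suc m))"
    unfolding sum_atMost_Suc_add F_def by (simp only: add.left_commute)
  also have "\<dots> = (\<integral>\<^sup>+h. (\<Sum>i\<le>n. gain g k W i h) \<partial>?L (Suc n + Suc m)) + (\<integral>\<^sup>+h. F h \<partial>?L (Suc n + Suc m))"
    by (rule nn_integral_add) (use F F1 in \<open>simp_all only: measurable_history_law[OF W]\<close>)
  also have "(\<integral>\<^sup>+h. (\<Sum>i\<le>n. gain g k W i h) \<partial>?L (Suc n + Suc m)) = mean_gain P g k W x n"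
    using nn_integral_history_law_restrict[OF W F0, of "Suc n + Suc m" x]
    by (simp add: gain_restrict mean_gain_def)
  also have "(\<integral>\<^sup>+h. F h \<partial>?L (Suc n + Suc m)) =
      (\<integral>\<^sup>+h. \<integral>\<^sup>+h'. F (glue n (Suc m) (fst W n h) h h') \<partial>history_law P (R h) (snd W n h) (Suc m) \<partial>?L (Suc n))"
    by (rule nn_integral_history_law_continues[OF W R fin F])
  also have "\<dots> = (\<integral>\<^sup>+h. a + mean_gain P g k (R h) (snd W n h) m \<partial>?L (Suc n))"
  proof (rule nn_integral_cong_AE, use fin AE_space in eventually_elim)
    fix h assume fin: "fst W n h < \<infinity>" and "h \<in> space (?L (Suc n))"
    then have h: "h \<in> space (history_space (Suc n))" by (simp add: space_history_law[OF W])
    have R': "impulse_strategy U (R h)" "continues W n h (R h)" using R[OF h fin] by auto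
    interpret R: prob_space "history_law P (R h) (snd W n h) (Suc m)" by (rule prob_space_history_law[OF R'(1)])
    have "(\<integral>\<^sup>+h'. F (glue n (Suc m) (fst W n h) h h') \<partial>history_law P (R h) (snd W n h) (Suc m)) =
      (\<integral>\<^sup>+h'. a + (\<Sum>j\<le>m. gain g k (R h) j h') \<partial>history_law P (R h) (snd W n h) (Suc m))"
      unfolding F_def
      by (intro nn_integral_cong arg_cong[where f="(+) a"] sum.cong refl gain_continues[OF h _ R'(2) fin _ g])
         (auto simp: space_history_law[OF R'(1)])
    also have "\<dots> = a + mean_gain P g k (R h) (snd W n h) m"
      unfolding mean_gain_def using measurable_gain[OF R'(1) g k]
      by (intro nn_integral_const_add R.prob_space_axioms) (auto simp: measurable_history_law[OF R'(1)] intro!: borel_measurable_sum)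
    finally show "(\<integral>\<^sup>+h'. F (glue n (Suc m) (fst W n h) h h') \<partial>history_law P (R h) (snd W n h) (Suc m)) =
      a + mean_gain P g k (R h) (snd W n h) m" .
  qed
  finally show ?thesis .
qed

lemma mean_gain_mono:
  assumes V: "impulse_strategy U V" and g: "\<And>y. g y \<le> g' y" and k: "\<And>y a. a \<in> U \<Longrightarrow> k y a \<le> k' y a"
  shows "mean_gain P g k V x n \<le> mean_gain P g' k' V x n"
  unfolding mean_gain_def
proof (intro nn_integral_mono sum_mono)
  fix h i assume "h \<in> space (history_law P V x (Suc n))" "i \<in> {..n}"
  then have "restrict h {0..<Suc i} \<in> space (history_space (Suc i))"
    by (simp add: space_history_law[OF V] restrict_history_space)
  then have "impulse_target V i h \<in> U" unfolding impulse_target_def by (rule impulse_strategy_target[OF V])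
  then show "gain g k V i h \<le> gain g' k' V i h"
    unfolding gain_def by (intro add_mono nn_integral_mono mult_right_mono) (auto simp: g k)
qed

lemma mean_gain_add:
  assumes V: "impulse_strategy U V" and g: "g \<in> borel_measurable borel" "g' \<in> borel_measurable borel"
    and k: "case_prod k \<in> borel_measurable (borel \<Otimes>\<^sub>M borel)" "case_prod k' \<in> borel_measurable (borel \<Otimes>\<^sub>M borel)"
  shows "mean_gain P (\<lambda>y. g y + g' y) (\<lambda>y a. k y a + k' y a) V x n =
    mean_gain P g k V x n + mean_gain P g' k' V x n"
proof -
  have gain: "gain (\<lambda>y. g y + g' y) (\<lambda>y a. k y a + k' y a) V i h = gain g k V i h + gain g' k' V i h"
    if "h \<in> space (history_space (Suc n))" "i \<le> n" for i h
    using measurable_segment[OF history_space_cadlag[OF that(1), of i]] that(2) g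
    by (simp add: gain_def distrib_right nn_integral_add algebra_simps)
  have "(\<lambda>h. \<Sum>i\<le>n. gain g k V i h) \<in> borel_measurable (history_space (Suc n))"
    "(\<lambda>h. \<Sum>i\<le>n. gain g' k' V i h) \<in> borel_measurable (history_space (Suc n))"
    using measurable_gain[OF V] g k by (auto intro!: borel_measurable_sum)
  note this[folded measurable_history_law[OF V, of x]]
  note add = nn_integral_add[OF this]
  show ?thesis
    unfolding mean_gain_def add[symmetric]
    by (intro nn_integral_cong) (simp add: gain space_history_law[OF V] sum.distrib)
qed

lemma mean_gain_cmult:
  assumes V: "impulse_strategy U V" and g: "g \<in> borel_measurable borel"
    and k: "case_prod k \<in> borel_measurable (borel \<Otimes>\<^sub>M borel)"
  shows "mean_gain P (\<lambda>y. a * g y) (\<lambda>y b. a * k y b) V x n = a * mean_gain P g k V x n"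
proof -
  have gain: "gain (\<lambda>y. a * g y) (\<lambda>y b. a * k y b) V i h = a * gain g k V i h"
    if "h \<in> space (history_space (Suc n))" "i \<le> n" for i h
    using measurable_segment[OF history_space_cadlag[OF that(1), of i]] that(2) g
    by (simp add: gain_def mult.assoc nn_integral_cmult distrib_left)
  have "(\<lambda>h. \<Sum>i\<le>n. gain g k V i h) \<in> borel_measurable (history_law P V x (Suc n))"
    using measurable_gain[OF V] g k by (auto intro!: borel_measurable_sum simp: measurable_history_law[OF V])
  from nn_integral_cmult[OF this, of a, symmetric] show ?thesis
    unfolding mean_gain_def
    by (simp only:) (intro nn_integral_cong, simp add: gain space_history_law[OF V] sum_distrib_left)
qed

end

text \<open>The cycles partition the time before impulse \<open>n\<close>. The cycle that contains
  \<open>s\<close> has as its index the least one whose impulse comes after \<open>s\<close>, and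
  this is the coordinate that \<open>controlled_process\<close> reads. Cycles between coinciding
  impulse times are empty.\<close>

lemma sum_segments:
  fixes g :: "'a::metric_space \<Rightarrow> ennreal"
  assumes V: "impulse_strategy U V" and h: "restrict h {0..<Suc n} \<in> space (history_space (Suc n))"
    and g: "g \<in> borel_measurable borel"
  shows "(\<Sum>i\<le>n. gain g (\<lambda>_ _. 0) V i h) =
    (\<integral>\<^sup>+s. g (controlled_process V s h) * indicator {s. 0 \<le> s \<and> ennreal s < impulse_time V n h} s \<partial>lborel)"
proof -
  let ?S = "\<lambda>i. {s. 0 \<le> s \<and> start_time V i h \<le> ennreal s \<and> ennreal s < impulse_time V i h}"
  have mono: "impulse_time V i h \<le> impulse_time V j h" if "i \<le> j" "j \<le> n" for i j
    using impulse_time_mono[OF V h that(1)] that by (simp add: impulse_time_restrict)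
  have cad: "cadlag (h i)" if "i \<le> n" for i
    using history_space_cadlag[OF h, of i] that by simp
  have "(\<Sum>i\<le>n. gain g (\<lambda>_ _. 0) V i h) = (\<Sum>i\<le>n. \<integral>\<^sup>+s. g (h i s) * indicator (?S i) s \<partial>lborel)"
    by (simp add: gain_def)
  also have "\<dots> = (\<integral>\<^sup>+s. (\<Sum>i\<le>n. g (h i s) * indicator (?S i) s) \<partial>lborel)"
    using measurable_segment[OF cad g] by (intro nn_integral_sum[symmetric]) auto
  also have "\<dots> = (\<integral>\<^sup>+s. g (controlled_process V s h) * indicator {s. 0 \<le> s \<and> ennreal s < impulse_time V n h} s \<partial>lborel)"
  proof (intro nn_integral_cong)
    fix s :: real
    show "(\<Sum>i\<le>n. g (h i s) * indicator (?S i) s) =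
      g (controlled_process V s h) * indicator {s. 0 \<le> s \<and> ennreal s < impulse_time V n h} s"
    proof (cases "0 \<le> s \<and> ennreal s < impulse_time V n h")
      case False
      have "indicator (?S i) s = (0 :: ennreal)" if "i \<le> n" for i
        using False mono[OF that order_refl] by (auto split: split_indicator)
      then show ?thesis using False by simp
    next
      case True
      define L where "L = (LEAST i. ennreal s < impulse_time V i h)"
      have L: "ennreal s < impulse_time V L h" "L \<le> n"
        unfolding L_def using True by (auto intro: LeastI Least_le)
      have less: "\<not> ennreal s < impulse_time V i h" if "i < L" for i
        using that unfolding L_def by (rule not_less_Least)
      have "s \<in> ?S i \<longleftrightarrow> i = L" if i: "i \<le> n" for i
      proof (cases i L rule: linorder_cases)
        case less
        then show ?thesis using \<open>\<And>i. i < L \<Longrightarrow> _\<close> by auto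
      next
        case equal
        then show ?thesis using True L less[of "L - 1"] by (cases L) (auto simp: start_time_def)
      next
        case greater
        then obtain j where j: "i = Suc j" "L \<le> j" by (cases i) auto
        then have "impulse_time V L h \<le> impulse_time V j h" using i by (intro mono) auto
        with L(1) have "\<not> start_time V i h \<le> ennreal s" by (simp add: j start_time_def)
        then show ?thesis using greater by auto
      qed
      then have "(\<Sum>i\<le>n. g (h i s) * indicator (?S i) s) = (\<Sum>i\<le>n. if i = L then g (h L s) else 0)"
        by (intro sum.cong) auto
      also have "\<dots> = g (h L s)" using L(2) by simp
      finally show ?thesis using True by (simp add: controlled_process_def L_def)
    qed
  qed
  finally show ?thesis .
qed

lemma nn_integral_initial_segment:
  "(\<integral>\<^sup>+s. indicator {s. 0 \<le> s \<and> ennreal s < t} s \<partial>lborel) = t"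
proof (cases t)
  case (real r)
  then have "{s. 0 \<le> s \<and> ennreal s < t} = {0..<r}" by (auto simp: ennreal_less_iff)
  then show ?thesis using real by simp
next
  case top
  then have eq: "{s. 0 \<le> s \<and> ennreal s < t} = {0..}" by auto
  have "emeasure lborel {0::real..} = top"
  proof (rule ccontr)
    assume "emeasure lborel {0::real..} \<noteq> top"
    then obtain r where r: "0 \<le> r" "emeasure lborel {0::real..} = ennreal r"
      by (cases "emeasure lborel {0::real..}") auto
    have "emeasure lborel {0..r + 1} \<le> emeasure lborel {0::real..}" by (intro emeasure_mono) auto
    then show False using r by simp
  qed
  then show ?thesis unfolding eq using top by simp
qed

lemma sum_segment_lengths:
  assumes "impulse_strategy U V" "restrict h {0..<Suc n} \<in> space (history_space (Suc n))"
  shows "(\<Sum>i\<le>n. gain (\<lambda>_. 1) (\<lambda>_ _. 0) V i h) = impulse_time V n h"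
  using sum_segments[OF assms borel_measurable_const[of 1]]
  by (simp only: nn_integral_initial_segment mult_1)

text \<open>In this form expected times obey all identities for mean gains, in particular the
  splitting at an impulse.\<close>

lemma (in markov_process) mean_gain_time:
  assumes V: "impulse_strategy U V"
  shows "mean_gain P (\<lambda>_. 1) (\<lambda>_ _. 0) V x n = expected_time P V x n"
proof -
  have "mean_gain P (\<lambda>_. 1) (\<lambda>_ _. 0) V x n = (\<integral>\<^sup>+h. impulse_time V n h \<partial>history_law P V x (Suc n))"
    unfolding mean_gain_def
    by (intro nn_integral_cong sum_segment_lengths[OF V]) (simp add: space_history_law[OF V] restrict_history)
  also have "\<dots> = expected_time P V x n"
    using nn_integral_controlled_law[OF V measurable_impulse_time[OF V, of n "Suc n"], of x]
    by (simp add: expected_time_def impulse_time_restrict)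
  finally show ?thesis .
qed

section \<open>Periodic strategies\<close>

text \<open>Reaches \<open>y\<close> from every starting point at the price of one impulse at time
  \<open>0\<close>. It serves both to begin a strategy and to close the periods below.\<close>

definition restart :: "'a::metric_space \<Rightarrow> 'a strategy \<Rightarrow> 'a strategy" where
  "restart y R = concat_strategy 0 (\<lambda>_ _. 0, \<lambda>_ _. y) R"

text \<open>Approximations to the periodic strategy, with \<open>j\<close> returns to
  \<open>y\<close>. A period has \<open>n + 2\<close> impulses, those of \<open>Q\<close> numbered
  \<open>0\<close> to \<open>n\<close> and the one to \<open>y\<close>, so impulse \<open>k\<close>
  no longer changes once \<open>j\<close> has reached \<open>k\<close>; \<open>periodic\<close>
  takes the diagonal.\<close>

primrec cycles :: "nat \<Rightarrow> 'a::metric_space \<Rightarrow> 'a strategy \<Rightarrow> nat \<Rightarrow> 'a strategy" where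
  "cycles n y Q 0 = Q"
| "cycles n y Q (Suc j) = concat_strategy n Q (restart y (cycles n y Q j))"

definition periodic :: "nat \<Rightarrow> 'a::metric_space \<Rightarrow> 'a strategy \<Rightarrow> 'a strategy" where
  "periodic n y Q = (\<lambda>k. fst (cycles n y Q k) k, \<lambda>k. snd (cycles n y Q k) k)"

lemma impulse_strategy_restart:
  assumes "y \<in> U" "impulse_strategy U R"
  shows "impulse_strategy U (restart y R)"
proof -
  have "impulse_strategy U (\<lambda>_ _. 0, \<lambda>_ _. y)"
    by (rule impulse_strategyI) (use assms(1) in auto)
  then show ?thesis unfolding restart_def using assms(2) by (rule impulse_strategy_concat)
qed

lemma impulse_strategy_cycles:
  "y \<in> U \<Longrightarrow> impulse_strategy U Q \<Longrightarrow> impulse_strategy U (cycles n y Q j)"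
  by (induction j) (auto intro: impulse_strategy_concat impulse_strategy_restart)

lemma concat_strategy_le:
  "k \<le> n \<Longrightarrow> fst (concat_strategy n Q R) k = fst Q k \<and> snd (concat_strategy n Q R) k = snd Q k"
  by (simp add: concat_strategy_def fun_eq_iff)

lemma concat_strategy_cong:
  assumes "n < k \<Longrightarrow> fst R (k - Suc n) = fst R' (k - Suc n) \<and> snd R (k - Suc n) = snd R' (k - Suc n)"
  shows "fst (concat_strategy n Q R) k = fst (concat_strategy n Q R') k \<and>
    snd (concat_strategy n Q R) k = snd (concat_strategy n Q R') k"
  using assms by (auto simp: concat_strategy_def fun_eq_iff Let_def)

text \<open>Impulses \<open>0\<close> to \<open>n\<close> belong to \<open>Q\<close>, impulse
  \<open>n + 1\<close> goes to \<open>y\<close>, and impulse \<open>n + 2 + j\<close> is impulse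
  \<open>j\<close> of \<open>R\<close>; so a single index of \<open>R\<close> matters for
  \<open>k\<close>.\<close>

lemma concat_restart_cong:
  assumes "\<And>j. j + n + 2 = k \<Longrightarrow> fst R j = fst R' j \<and> snd R j = snd R' j"
  shows "fst (concat_strategy n Q (restart y R)) k = fst (concat_strategy n Q (restart y R')) k \<and>
    snd (concat_strategy n Q (restart y R)) k = snd (concat_strategy n Q (restart y R')) k"
  unfolding restart_def
  by (intro concat_strategy_cong) (use assms[of "k - n - 2"] in auto)

lemma cycles_stable:
  "k \<le> i \<Longrightarrow> fst (cycles n y Q (Suc i)) k = fst (cycles n y Q i) k \<and>
    snd (cycles n y Q (Suc i)) k = snd (cycles n y Q i) k"
proof (induction k arbitrary: i rule: less_induct)
  case (less k)
  show ?case
  proof (cases i)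
    case 0
    then show ?thesis using less.prems by (simp add: concat_strategy_le)
  next
    case (Suc i')
    have "fst (cycles n y Q (Suc i')) j = fst (cycles n y Q i') j \<and>
        snd (cycles n y Q (Suc i')) j = snd (cycles n y Q i') j" if "j + n + 2 = k" for j
      by (rule less.IH) (use that less.prems Suc in auto)
    from concat_restart_cong[OF this]
    show ?thesis unfolding Suc by (simp only: cycles.simps)
  qed
qed

lemma cycles_eq_periodic:
  assumes "k \<le> i"
  shows "fst (cycles n y Q i) k = fst (periodic n y Q) k \<and> snd (cycles n y Q i) k = snd (periodic n y Q) k"
  using assms
proof (induction i rule: dec_induct)
  case base
  then show ?case by (simp add: periodic_def)
next
  case (step i)
  then show ?case using cycles_stable[of k i n y Q] by simp
qed

text \<open>Impulse \<open>k\<close> may equally be read from \<open>cycles n y Q (Suc k)\<close>,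
  which is a concatenation by definition. Gains along the periodic strategy are computed from this
  fixed-point equation.\<close>

lemma periodic_unfold: "periodic n y Q = concat_strategy n Q (restart y (periodic n y Q))"
proof -
  have "fst (periodic n y Q) k = fst (concat_strategy n Q (restart y (periodic n y Q))) k \<and>
    snd (periodic n y Q) k = snd (concat_strategy n Q (restart y (periodic n y Q))) k" for k
  proof -
    have "fst (cycles n y Q k) j = fst (periodic n y Q) j \<and> snd (cycles n y Q k) j = snd (periodic n y Q) j"
      if "j + n + 2 = k" for j
      using that by (intro cycles_eq_periodic) simp
    from concat_restart_cong[OF this] cycles_eq_periodic[of k "Suc k" n y Q]
    show ?thesis by (simp only: cycles.simps)
  qed
  then show ?thesis by (intro prod_eqI) auto
qed

lemma impulse_strategy_periodic:
  assumes "y \<in> U" "impulse_strategy U Q"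
  shows "impulse_strategy U (periodic n y Q)"
proof -
  note C = impulse_strategy_cycles[OF assms, of n]
  show ?thesis
  proof (rule impulse_strategyI)
    fix k
    show "fst (periodic n y Q) k \<in> borel_measurable (history_space (Suc k))"
      "snd (periodic n y Q) k \<in> history_space (Suc k) \<rightarrow>\<^sub>M borel"
      unfolding periodic_def fst_conv snd_conv
      by (rule impulse_strategy_measurable[OF C])+
  next
    fix k and h :: "'a history" assume "h \<in> space (history_space (Suc k))"
    then show "snd (periodic n y Q) k h \<in> U"
      unfolding periodic_def snd_conv by (rule impulse_strategy_target[OF C])
  next
    fix k and h :: "'a history" assume h: "h \<in> space (history_space (Suc (Suc k)))"
    \<comment> \<open>Impulses \<open>k\<close> and \<open>Suc k\<close> can both be read from the
      single strategy \<open>cycles n y Q (Suc k)\<close>.\<close>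
    show "fst (periodic n y Q) k (restrict h {0..<Suc k}) \<le> fst (periodic n y Q) (Suc k) h"
      using impulse_strategy_mono[OF C[of "Suc k"] h] cycles_stable[OF order_refl, of n y Q k]
      by (simp only: periodic_def fst_conv)
  next
    fix k h h' assume "h \<in> space (history_space (Suc k))" "h' \<in> space (history_space (Suc k))"
       "agree_until (Suc k) (fst (periodic n y Q) k h) h h'"
    then show "fst (periodic n y Q) k h' = fst (periodic n y Q) k h \<and> snd (periodic n y Q) k h' = snd (periodic n y Q) k h"
      unfolding periodic_def fst_conv snd_conv by (intro conjI impulse_strategy_deterministic[OF C])
  qed
qed

text \<open>Being multiplicative over cycles, its expectation decays geometrically along a periodic
  strategy; this is how impulse times are shown to tend to \<open>\<infinity>\<close>.\<close>

definition discount :: "ennreal \<Rightarrow> ennreal" where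
  "discount t = (if t < \<infinity> then ennreal (exp (- enn2real t)) else 0)"

lemma measurable_discount[measurable]: "discount \<in> borel_measurable borel"
  unfolding discount_def[abs_def] by measurable

lemma discount_add: "discount (s + t) = discount s * discount t"
proof (cases "s < \<infinity> \<and> t < \<infinity>")
  case True
  then obtain r u where "0 \<le> r" "s = ennreal r" "0 \<le> u" "t = ennreal u"
    by (cases s; cases t) auto
  moreover from this have "s + t = ennreal (r + u)" by simp
  moreover have "exp (- (r + u)) = exp (- r) * exp (- u)" by (simp add: exp_add[symmetric])
  ultimately show ?thesis by (simp add: discount_def ennreal_mult' del: ennreal_plus minus_add_distrib)
qed (auto simp: discount_def)

lemma discount_le_1: "discount t \<le> 1"
  by (simp add: discount_def)

lemma discount_antimono: "s \<le> t \<Longrightarrow> discount t \<le> discount s"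
  unfolding discount_def by (auto simp: enn2real_mono)

lemma discount_eq_1_iff: "discount t = 1 \<longleftrightarrow> t = 0"
proof (cases "t < \<infinity>")
  case True
  then show ?thesis by (cases t) (auto simp: discount_def)
qed (auto simp: discount_def)

lemma discount_0_eq: "discount 0 = 1"
  by (simp add: discount_eq_1_iff)

lemma discount_eq_0_iff: "discount t = 0 \<longleftrightarrow> t = \<infinity>"
  unfolding discount_def by (cases t) auto

definition mean_discount ::
    "('a::metric_space \<Rightarrow> (real \<Rightarrow> 'a) measure) \<Rightarrow> 'a strategy \<Rightarrow> 'a \<Rightarrow> nat \<Rightarrow> ennreal" where
  "mean_discount P V x n = (\<integral>\<^sup>+h. discount (fst V n h) \<partial>history_law P V x (Suc n))"

section \<open>Discounts, admissibility and immediate impulses\<close>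

context markov_process begin

lemma measurable_discount_time:
  "impulse_strategy U V \<Longrightarrow> (\<lambda>h. discount (fst V n h)) \<in> borel_measurable (history_space (Suc n))"
  by (rule measurable_compose[OF impulse_strategy_measurable(1) measurable_discount])

lemma mean_discount_le_1:
  assumes V: "impulse_strategy U V" shows "mean_discount P V x n \<le> 1"
proof -
  interpret prob_space "history_law P V x (Suc n)" by (rule prob_space_history_law[OF V])
  have "mean_discount P V x n \<le> (\<integral>\<^sup>+h. 1 \<partial>history_law P V x (Suc n))"
    unfolding mean_discount_def by (intro nn_integral_mono) (simp add: discount_le_1)
  then show ?thesis by (simp add: emeasure_space_1)
qed

lemma mean_discount_continues:
  assumes W: "impulse_strategy U W"
    and R: "\<And>h. h \<in> space (history_space (Suc n)) \<Longrightarrow> fst W n h < \<infinity> \<Longrightarrow>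
        impulse_strategy U (R h) \<and> continues W n h (R h)"
    and fin: "AE h in history_law P W x (Suc n). fst W n h < \<infinity>"
  shows "mean_discount P W x (Suc n + m) =
    (\<integral>\<^sup>+h. discount (fst W n h) * mean_discount P (R h) (snd W n h) m \<partial>history_law P W x (Suc n))"
proof -
  have "mean_discount P W x (Suc n + m) =
    (\<integral>\<^sup>+h. \<integral>\<^sup>+h'. discount (fst W (Suc n + m) (glue n (Suc m) (fst W n h) h h'))
      \<partial>history_law P (R h) (snd W n h) (Suc m) \<partial>history_law P W x (Suc n))"
    unfolding mean_discount_def
    using nn_integral_history_law_continues[OF W R fin, of "\<lambda>h. discount (fst W (Suc n + m) h)" m]
      measurable_discount_time[OF W, of "Suc n + m"] by simp
  also have "\<dots> = (\<integral>\<^sup>+h. discount (fst W n h) * mean_discount P (R h) (snd W n h) m \<partial>history_law P W x (Suc n))"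
  proof (rule nn_integral_cong_AE, use fin AE_space in eventually_elim)
    fix h assume fin: "fst W n h < \<infinity>" and "h \<in> space (history_law P W x (Suc n))"
    then have h: "h \<in> space (history_space (Suc n))" by (simp add: space_history_law[OF W])
    have R': "impulse_strategy U (R h)" "continues W n h (R h)" using R[OF h fin] by auto
    have "(\<integral>\<^sup>+h'. discount (fst W (Suc n + m) (glue n (Suc m) (fst W n h) h h'))
        \<partial>history_law P (R h) (snd W n h) (Suc m)) =
      (\<integral>\<^sup>+h'. discount (fst W n h) * discount (fst (R h) m h') \<partial>history_law P (R h) (snd W n h) (Suc m))"
    proof (intro nn_integral_cong)
      fix h' assume "h' \<in> space (history_law P (R h) (snd W n h) (Suc m))"
      then have "h' \<in> space (history_space (Suc m))" by (simp add: space_history_law[OF R'(1)])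
      then have "fst W (Suc n + m) (glue n (Suc m) (fst W n h) h h') = fst W n h + fst (R h) m h'"
        using R'(2) unfolding continues_def by blast
      then show "discount (fst W (Suc n + m) (glue n (Suc m) (fst W n h) h h')) =
        discount (fst W n h) * discount (fst (R h) m h')" by (simp only: discount_add)
    qed
    then show "(\<integral>\<^sup>+h'. discount (fst W (Suc n + m) (glue n (Suc m) (fst W n h) h h'))
        \<partial>history_law P (R h) (snd W n h) (Suc m)) =
      discount (fst W n h) * mean_discount P (R h) (snd W n h) m"
      unfolding mean_discount_def
      by (simp only:) (intro nn_integral_cmult, simp add: measurable_history_law[OF R'(1)] measurable_discount_time[OF R'(1)])
  qed
  finally show ?thesis .
qed

lemma controlled_law_restrict_space:
  assumes "impulse_strategy U V" "\<omega> \<in> space (controlled_law P V x)"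
  shows "restrict \<omega> {0..<n} \<in> space (history_space n)"
  using measurable_space[OF measurable_restrict_controlled_law[OF assms(1)] assms(2)] .

text \<open>The integral of the infimum of the discounts is below every
  \<open>mean_discount\<close>, hence zero. Almost surely the infimum is then \<open>0\<close>, and
  since discounts decrease in time, this forces the supremum of the impulse times to be
  infinite.\<close>

lemma admissible_of_mean_discount:
  assumes V: "impulse_strategy U V" and small: "\<And>\<epsilon>. 0 < \<epsilon> \<Longrightarrow> \<exists>n. mean_discount P V x n < \<epsilon>"
  shows "admissible P U x V"
proof -
  let ?L = "controlled_law P V x"
  have E: "(\<integral>\<^sup>+\<omega>. discount (impulse_time V n \<omega>) \<partial>?L) = mean_discount P V x n" for n
    using nn_integral_controlled_law[OF V measurable_discount_time[OF V, of n], where x=x]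
    by (simp only: mean_discount_def impulse_time_def)
  have meas: "(\<lambda>\<omega>. discount (impulse_time V n \<omega>)) \<in> borel_measurable ?L" for n
    using measurable_compose[OF measurable_restrict_controlled_law[OF V] measurable_discount_time[OF V]]
    by (simp only: impulse_time_def)
  have "(\<integral>\<^sup>+\<omega>. (INF n. discount (impulse_time V n \<omega>)) \<partial>?L) \<le> mean_discount P V x n" for n
    unfolding E[symmetric] by (intro nn_integral_mono INF_lower) simp
  then have "(\<integral>\<^sup>+\<omega>. (INF n. discount (impulse_time V n \<omega>)) \<partial>?L) = 0"
    using small by (metis linorder_not_less not_gr_zero)
  then have INF_0: "AE \<omega> in ?L. (INF n. discount (impulse_time V n \<omega>)) = 0"
    by (subst (asm) nn_integral_0_iff_AE) (auto intro!: borel_measurable_INF meas)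
  have "AE \<omega> in ?L. (\<lambda>n. impulse_time V n \<omega>) \<longlonglongrightarrow> \<infinity>"
  proof (use AE_space INF_0 in eventually_elim)
    fix \<omega> assume \<omega>: "\<omega> \<in> space ?L" and 0: "(INF n. discount (impulse_time V n \<omega>)) = 0"
    have inc: "incseq (\<lambda>n. impulse_time V n \<omega>)"
    proof (rule incseq_SucI)
      fix n
      show "impulse_time V n \<omega> \<le> impulse_time V (Suc n) \<omega>"
        using impulse_time_mono[OF V controlled_law_restrict_space[OF V \<omega>, of "Suc (Suc n)"], of n "Suc n"]
        by (simp add: impulse_time_restrict)
    qed
    have "discount (SUP n. impulse_time V n \<omega>) \<le> (INF n. discount (impulse_time V n \<omega>))"
      by (intro INF_greatest discount_antimono SUP_upper) simp
    then have "(SUP n. impulse_time V n \<omega>) = \<infinity>" using 0 by (simp add: discount_eq_0_iff)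
    then show "(\<lambda>n. impulse_time V n \<omega>) \<longlonglongrightarrow> \<infinity>" using LIMSEQ_SUP[OF inc] by (simp only:)
  qed
  then show ?thesis using V by (simp add: admissible_def)
qed

lemma restart_properties:
  assumes "y \<in> U" "impulse_strategy U R"
  shows "fst (restart y R) 0 h = 0" "snd (restart y R) 0 h = y"
    and "h \<in> space (history_space (Suc 0)) \<Longrightarrow> continues (restart y R) 0 h R"
proof -
  show "fst (restart y R) 0 h = 0" "snd (restart y R) 0 h = y"
    by (simp_all add: restart_def concat_strategy_def)
  show "continues (restart y R) 0 h R" if "h \<in> space (history_space (Suc 0))"
    unfolding restart_def using that by (intro continues_concat) auto
qed

lemma mean_gain_restart_0:
  assumes y: "y \<in> U" and R: "impulse_strategy U R"
    and g: "g \<in> borel_measurable borel" and k: "case_prod k \<in> borel_measurable (borel \<Otimes>\<^sub>M borel)"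
  shows "mean_gain P g k (restart y R) x 0 = k x y"
proof -
  note S = impulse_strategy_restart[OF y R]
  interpret P: prob_space "P x" by (rule P_prob)
  have "impulse_time (restart y R) 0 h = 0" "impulse_target (restart y R) 0 h = y" for h
    by (simp_all add: impulse_time_def impulse_target_def restart_properties[OF y R])
  then have gain: "gain g k (restart y R) 0 h = k (h 0 0) y" for h
    by (simp add: gain_def pre_impulse_state_def)
  have "mean_gain P g k (restart y R) x 0 = (\<integral>\<^sup>+\<omega>. k (\<omega> 0) y \<partial>P x)"
    using nn_integral_history_law_1[OF S, of "gain g k (restart y R) 0" x] measurable_gain[OF S g k, of 0 1]
    by (simp add: mean_gain_def gain)
  also have "\<dots> = (\<integral>\<^sup>+\<omega>. k x y \<partial>P x)"
    by (rule nn_integral_cong_AE) (use start[of x] in auto)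
  finally show ?thesis by (simp add: P.emeasure_space_1)
qed

lemma mean_gain_restart_Suc:
  assumes y: "y \<in> U" and R: "impulse_strategy U R"
    and g: "g \<in> borel_measurable borel" and k: "case_prod k \<in> borel_measurable (borel \<Otimes>\<^sub>M borel)"
  shows "mean_gain P g k (restart y R) x (Suc m) = k x y + mean_gain P g k R y m"
proof -
  note S = impulse_strategy_restart[OF y R]
  interpret prob_space "history_law P (restart y R) x (Suc 0)" by (rule prob_space_history_law[OF S])
  have "0 + mean_gain P g k (restart y R) x (Suc 0 + m) = mean_gain P g k (restart y R) x 0 +
      (\<integral>\<^sup>+h. 0 + mean_gain P g k R (snd (restart y R) 0 h) m \<partial>history_law P (restart y R) x (Suc 0))"
    by (rule mean_gain_continues[OF S _ _ g k]) (use R restart_properties[OF y R] in auto)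
  then show ?thesis
    using emeasure_space_1 by (simp add: restart_properties[OF y R] mean_gain_restart_0[OF y R g k])
qed

lemma mean_discount_restart:
  assumes y: "y \<in> U" and R: "impulse_strategy U R"
  shows "mean_discount P (restart y R) x (Suc m) = mean_discount P R y m"
proof -
  note S = impulse_strategy_restart[OF y R]
  interpret prob_space "history_law P (restart y R) x (Suc 0)" by (rule prob_space_history_law[OF S])
  have "mean_discount P (restart y R) x (Suc 0 + m) =
      (\<integral>\<^sup>+h. discount (fst (restart y R) 0 h) * mean_discount P R (snd (restart y R) 0 h) m \<partial>history_law P (restart y R) x (Suc 0))"
    by (rule mean_discount_continues[OF S]) (use R restart_properties[OF y R] in auto)
  then show ?thesis
    using emeasure_space_1 by (simp add: restart_properties[OF y R] discount_0_eq)
qed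

lemma AE_time_finite:
  assumes V: "impulse_strategy U V" and fin: "expected_time P V x n < \<infinity>"
  shows "AE h in history_law P V x (Suc n). fst V n h < \<infinity>"
proof -
  have [measurable]: "fst V n \<in> borel_measurable (history_law P V x (Suc n))"
    by (simp add: measurable_history_law[OF V] impulse_strategy_measurable(1)[OF V])
  have "expected_time P V x n = (\<integral>\<^sup>+h. fst V n h \<partial>history_law P V x (Suc n))"
    using nn_integral_controlled_law[OF V impulse_strategy_measurable(1)[OF V, of n], where x=x]
    by (simp only: expected_time_def impulse_time_def)
  with fin have "(\<integral>\<^sup>+h. fst V n h \<partial>history_law P V x (Suc n)) \<noteq> \<infinity>" by auto
  then have "AE h in history_law P V x (Suc n). fst V n h \<noteq> \<infinity>"
    by (intro nn_integral_PInf_AE) measurable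
  then show ?thesis by eventually_elim (simp add: less_top)
qed

lemma mean_gain_mono_time:
  assumes "m \<le> n" "impulse_strategy U V"
    and g: "g \<in> borel_measurable borel" and k: "case_prod k \<in> borel_measurable (borel \<Otimes>\<^sub>M borel)"
  shows "mean_gain P g k V x m \<le> mean_gain P g k V x n"
  unfolding mean_gain_controlled[OF assms(2-4)]
  by (intro nn_integral_mono sum_mono2) (use assms(1) in simp_all)

end

text \<open>One period is \<open>Q\<close>, started at \<open>y\<close>, up to impulse
  \<open>n\<close>, closed by an impulse to \<open>y\<close>. Finite expected length makes the
  periodic strategy integrable, and positive expected length makes its mean discounts decay.\<close>

locale periodic_strategy = markov_process P for P :: "'a::metric_space \<Rightarrow> (real \<Rightarrow> 'a) measure" +
  fixes U :: "'a set" and Q :: "'a strategy" and y :: 'a and n :: nat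
  assumes y: "y \<in> U" and Q: "impulse_strategy U Q"
    and fin: "expected_time P Q y n < \<infinity>" and pos: "0 < expected_time P Q y n"
begin

abbreviation "W \<equiv> periodic n y Q"

lemma impulse_strategy_W: "impulse_strategy U W"
  by (rule impulse_strategy_periodic[OF y Q])

lemma W_prefix: "k \<le> n \<Longrightarrow> fst W k = fst Q k \<and> snd W k = snd Q k"
  using concat_strategy_le[of k n Q "restart y W"] by (simp only: periodic_unfold[symmetric])

lemma impulse_strategy_restart_W: "impulse_strategy U (restart y W)"
  by (rule impulse_strategy_restart[OF y impulse_strategy_W])

lemma W_last: "fst W n = fst Q n" "snd W n = snd Q n"
  using W_prefix[OF order_refl] by auto

lemma W_law: "history_law P W x (Suc n) = history_law P Q x (Suc n)"
  by (rule history_law_cong[OF impulse_strategy_W Q]) (simp add: W_prefix)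

lemma W_continues:
  assumes "h \<in> space (history_space (Suc n))" "fst W n h < \<infinity>"
  shows "continues W n h (restart y W)"
  using continues_concat[OF assms(1), of Q "restart y W"] assms(2) W_prefix[OF order_refl]
  by (simp only: periodic_unfold[symmetric])

lemma W_time_finite: "AE h in history_law P W y (Suc n). fst W n h < \<infinity>"
  unfolding W_law W_last by (rule AE_time_finite[OF Q fin])

context
  fixes g :: "'a \<Rightarrow> ennreal" and k :: "'a \<Rightarrow> 'a \<Rightarrow> ennreal"
  assumes g: "g \<in> borel_measurable borel" and k: "case_prod k \<in> borel_measurable (borel \<Otimes>\<^sub>M borel)"
begin

lemma mean_gain_periodic_split:
  "a + mean_gain P g k W y (Suc n + m) = mean_gain P g k Q y n +
    (\<integral>\<^sup>+h. a + mean_gain P g k (restart y W) (snd Q n h) m \<partial>history_law P Q y (Suc n))"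
proof -
  have "mean_gain P g k W y n = mean_gain P g k Q y n"
    by (rule mean_gain_cong[OF impulse_strategy_W Q W_prefix])
  moreover have "a + mean_gain P g k W y (Suc n + m) = mean_gain P g k W y n +
    (\<integral>\<^sup>+h. a + mean_gain P g k (restart y W) (snd W n h) m \<partial>history_law P W y (Suc n))"
    by (rule mean_gain_continues[OF impulse_strategy_W _ W_time_finite g k]) (intro conjI impulse_strategy_restart_W W_continues)
  ultimately show ?thesis by (simp only: W_law W_last)
qed

text \<open>Index \<open>Suc n\<close> includes the closing impulse to \<open>y\<close>, so this is
  the gain of a whole period. The closing impulse is made from the target of impulse
  \<open>n\<close>, since no time passes in between.\<close>

lemma mean_gain_periodic:
  "mean_gain P g k W y (Suc n) = mean_gain P g k Q y n + (\<integral>\<^sup>+h. k (snd Q n h) y \<partial>history_law P Q y (Suc n))"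
  using mean_gain_periodic_split[of 0 0] by (simp add: mean_gain_restart_0[OF y impulse_strategy_W g k])

text \<open>After a whole period the strategy is again at \<open>y\<close>, so the remainder
  contributes a constant independent of the past. It is taken out of the integral as the constant
  \<open>a\<close> of \<open>mean_gain_periodic_split\<close> with \<open>m = 0\<close>.\<close>

lemma mean_gain_periodic_add:
  "mean_gain P g k W y (n + 2 + m) = mean_gain P g k W y (Suc n) + mean_gain P g k W y m"
proof -
  have "mean_gain P g k W y (n + 2 + m) = mean_gain P g k Q y n +
    (\<integral>\<^sup>+h. k (snd Q n h) y + mean_gain P g k W y m \<partial>history_law P Q y (Suc n))"
    using mean_gain_periodic_split[of 0 "Suc m"] by (simp add: mean_gain_restart_Suc[OF y impulse_strategy_W g k])
  also have "\<dots> = mean_gain P g k W y m + mean_gain P g k W y (Suc n)"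
    using mean_gain_periodic_split[of "mean_gain P g k W y m" 0]
    by (simp add: mean_gain_restart_0[OF y impulse_strategy_W g k] add.commute)
  finally show ?thesis by (simp only: add.commute)
qed

end

lemma expected_time_periodic: "expected_time P W y m < \<infinity>"
proof (induction m rule: less_induct)
  case (less m)
  have g: "(\<lambda>_. 1::ennreal) \<in> borel_measurable borel" "(\<lambda>(x, y). 0::ennreal) \<in> borel_measurable (borel \<Otimes>\<^sub>M borel)"
    by auto
  note eq = mean_gain_periodic_add[OF g] mean_gain_periodic[OF g]
  have cycle: "expected_time P W y (Suc n) < \<infinity>"
    using eq(2) fin by (simp add: mean_gain_time[OF impulse_strategy_W] mean_gain_time[OF Q])
  show ?case
  proof (cases "m \<le> Suc n")
    case True
    from mean_gain_mono_time[OF this impulse_strategy_W g, of y] cycle show ?thesis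
      by (simp add: mean_gain_time[OF impulse_strategy_W] mean_gain_time[OF Q])
  next
    case False
    then obtain j where j: "m = n + 2 + j" by (metis add_2_eq_Suc' le_add_diff_inverse not_less_eq_eq)
    then show ?thesis using eq(1)[of j] less.IH[of j] cycle by (simp add: mean_gain_time[OF impulse_strategy_W])
  qed
qed

text \<open>A mean discount of \<open>1\<close> would mean that the period almost surely takes no
  time, against \<open>pos\<close>.\<close>

lemma mean_discount_cycle_less_1: "mean_discount P Q y n < 1"
proof -
  let ?L = "history_law P Q y (Suc n)"
  interpret prob_space ?L by (rule prob_space_history_law[OF Q])
  have time[measurable]: "fst Q n \<in> borel_measurable ?L"
    by (simp add: measurable_history_law[OF Q] impulse_strategy_measurable(1)[OF Q])
  have time_eq: "expected_time P Q y n = (\<integral>\<^sup>+h. fst Q n h \<partial>?L)"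
    using nn_integral_controlled_law[OF Q impulse_strategy_measurable(1)[OF Q, of n], where x=y]
    by (simp only: expected_time_def impulse_time_def)
  have "mean_discount P Q y n \<noteq> 1"
  proof
    assume 1: "mean_discount P Q y n = 1"
    have "(\<integral>\<^sup>+h. 1 - discount (fst Q n h) \<partial>?L) + mean_discount P Q y n = (\<integral>\<^sup>+h. 1 \<partial>?L)"
      unfolding mean_discount_def
      by (subst nn_integral_add[symmetric])
         (auto simp: discount_le_1 diff_add_cancel_ennreal intro!: nn_integral_cong simp del: nn_integral_const)
    then have "1 + (\<integral>\<^sup>+h. 1 - discount (fst Q n h) \<partial>?L) = 1 + 0"
      using 1 by (simp add: emeasure_space_1 add.commute)
    then have "(\<integral>\<^sup>+h. 1 - discount (fst Q n h) \<partial>?L) = 0"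
      by (metis add.right_neutral ennreal_add_left_cancel ennreal_one_neq_top infinity_ennreal_def)
    then have "AE h in ?L. 1 - discount (fst Q n h) = 0"
      by (subst (asm) nn_integral_0_iff_AE) auto
    then have "AE h in ?L. fst Q n h = 0"
      by eventually_elim
         (metis antisym diff_eq_0_iff_ennreal discount_eq_1_iff discount_le_1 ennreal_one_less_top)
    then have "expected_time P Q y n = (\<integral>\<^sup>+h. 0 \<partial>?L)"
      unfolding time_eq by (intro nn_integral_cong_AE)
    then show False using pos by simp
  qed
  then show ?thesis using mean_discount_le_1[OF Q, of y n] by (simp add: less_le)
qed

lemma mean_discount_periodic:
  "mean_discount P W y (n + 2 + m) = mean_discount P Q y n * mean_discount P W y m"
proof -
  have "mean_discount P W y (Suc n + Suc m) =
    (\<integral>\<^sup>+h. discount (fst W n h) * mean_discount P (restart y W) (snd W n h) (Suc m) \<partial>history_law P W y (Suc n))"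
    by (rule mean_discount_continues[OF impulse_strategy_W _ W_time_finite]) (intro conjI impulse_strategy_restart_W W_continues)
  also have "\<dots> = (\<integral>\<^sup>+h. discount (fst Q n h) * mean_discount P W y m \<partial>history_law P Q y (Suc n))"
    by (simp only: mean_discount_restart[OF y impulse_strategy_W] W_law W_last)
  also have "\<dots> = mean_discount P Q y n * mean_discount P W y m"
    unfolding mean_discount_def[of P Q]
    by (rule nn_integral_multc) (simp add: measurable_history_law[OF Q] measurable_discount_time[OF Q])
  finally show ?thesis by simp
qed

lemma mean_discount_small:
  assumes "0 < \<epsilon>" shows "\<exists>m. mean_discount P W y m < \<epsilon>"
proof -
  let ?\<rho> = "mean_discount P Q y n"
  have le: "mean_discount P W y (j * (n + 2)) \<le> ?\<rho> ^ j" for j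
  proof (induction j)
    case (Suc j)
    have "mean_discount P W y (Suc j * (n + 2)) = ?\<rho> * mean_discount P W y (j * (n + 2))"
      unfolding mult_Suc by (rule mean_discount_periodic)
    also have "\<dots> \<le> ?\<rho> * ?\<rho> ^ j" by (rule mult_left_mono[OF Suc]) simp
    finally show ?case by simp
  qed (simp add: mean_discount_le_1[OF impulse_strategy_W])
  obtain r where r: "0 \<le> r" "r < 1" "?\<rho> = ennreal r"
    using mean_discount_cycle_less_1 by (cases ?\<rho>) (auto simp flip: ennreal_1 simp: ennreal_less_iff)
  have "(\<lambda>j. ennreal (r ^ j)) \<longlonglongrightarrow> ennreal 0"
    using r by (intro tendsto_ennrealI LIMSEQ_power_zero) auto
  then have "eventually (\<lambda>j. ennreal (r ^ j) < \<epsilon>) sequentially"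
    by (rule order_tendstoD(2)) (use assms in simp)
  then obtain j where "ennreal (r ^ j) < \<epsilon>" by (auto simp: eventually_sequentially)
  then show ?thesis using le[of j] r by (intro exI[of _ "j * (n + 2)"]) (simp add: ennreal_power)
qed

lemma integrable_strategy_restart_periodic: "integrable_strategy P U x (restart y W)"
  unfolding integrable_strategy_def
proof (intro conjI allI)
  show "admissible P U x (restart y W)"
  proof (rule admissible_of_mean_discount[OF impulse_strategy_restart_W])
    fix \<epsilon> :: ennreal assume "0 < \<epsilon>"
    then obtain m where "mean_discount P W y m < \<epsilon>" using mean_discount_small by blast
    then show "\<exists>n. mean_discount P (restart y W) x n < \<epsilon>"
      by (intro exI[of _ "Suc m"]) (simp add: mean_discount_restart[OF y impulse_strategy_W])
  qed
  fix m
  have g: "(\<lambda>_. 1::ennreal) \<in> borel_measurable borel" "(\<lambda>(x, y). 0::ennreal) \<in> borel_measurable (borel \<Otimes>\<^sub>M borel)"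
    by auto
  show "expected_time P (restart y W) x m < \<infinity>"
    using mean_gain_restart_0[OF y impulse_strategy_W g, of x] mean_gain_restart_Suc[OF y impulse_strategy_W g, of x] expected_time_periodic
    by (cases m) (simp_all add: mean_gain_time[OF impulse_strategy_W] mean_gain_time[OF impulse_strategy_restart_W])
qed

end

section \<open>The mean reward\<close>

text \<open>The sign is reversed to obtain nonnegative amounts. Targets outside \<open>U\<close>, to
  which no strategy jumps and where continuity of \<open>c\<close> is not assumed, are charged
  nothing.\<close>

definition cost :: "'a set \<Rightarrow> ('a \<Rightarrow> 'a \<Rightarrow> real) \<Rightarrow> 'a \<Rightarrow> 'a \<Rightarrow> ennreal" where
  "cost U c y a = (if a \<in> U then ennreal (- c y a) else 0)"

text \<open>The product of the Borel fields may be smaller than the Borel field of the product, so that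
  continuity of \<open>c\<close> does not suffice; the compactness of \<open>U\<close> provides countably many targets that
  approximate all others.\<close>

lemma measurable_cost:
  fixes c :: "'a::metric_space \<Rightarrow> 'a \<Rightarrow> real"
  assumes U: "compact U" and c: "continuous_on (UNIV \<times> U) (\<lambda>(x, a). c x a)"
  shows "case_prod (cost U c) \<in> borel_measurable (borel \<Otimes>\<^sub>M borel)"
proof (cases "U = {}")
  case True
  then have "case_prod (cost U c) = (\<lambda>_. 0)" by (auto simp: cost_def fun_eq_iff)
  then show ?thesis by simp
next
  case False
  \<comment> \<open>By total boundedness \<open>U\<close> has a finite net of mesh
    \<open>1 / (n + 1)\<close>; it is listed by a sequence, so that indices range over all of
    \<open>nat\<close>.\<close>
  have "\<exists>d :: nat \<Rightarrow> 'a. range d \<subseteq> U \<and> (\<forall>a\<in>U. \<exists>i. dist (d i) a < inverse (real (Suc n)))" for n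
  proof -
    obtain D where D: "finite D" "D \<subseteq> U" "U \<subseteq> (\<Union>x\<in>D. ball x (inverse (real (Suc n))))"
    proof -
      have "seq_compact U" using U by (simp only: compact_eq_seq_compact_metric)
      from seq_compact_imp_totally_bounded[OF this, rule_format, of "inverse (real (Suc n))"] that
      show thesis by auto
    qed
    with False have "D \<noteq> {}" by auto
    then have "range (from_nat_into D) = D" using D(1) by (intro range_from_nat_into) (auto intro: countable_finite)
    moreover have "\<exists>x\<in>D. dist x a < inverse (real (Suc n))" if "a \<in> U" for a
      using subsetD[OF D(3) that] by (simp only: UN_iff mem_ball)
    ultimately have "range (from_nat_into D) \<subseteq> U"
        "\<forall>a\<in>U. \<exists>i. dist (from_nat_into D i) a < inverse (real (Suc n))"
      using D(2) by (auto, metis rangeE)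
    then show ?thesis by blast
  qed
  then obtain d :: "nat \<Rightarrow> nat \<Rightarrow> 'a"
    where D: "\<forall>n. range (d n) \<subseteq> U \<and> (\<forall>a\<in>U. \<exists>i. dist (d n i) a < inverse (real (Suc n)))"
    using choice[of "\<lambda>n d. range d \<subseteq> U \<and> (\<forall>a\<in>U. \<exists>i. dist (d i) a < inverse (real (Suc n)))"] by blast
  then have d: "d n i \<in> U" and dense: "a \<in> U \<Longrightarrow> \<exists>i. dist (d n i) a < inverse (real (Suc n))" for n i a
    by blast+
  \<comment> \<open>The first index of a net point close to the target. It takes countably many
    values, so replacing the target by that net point leaves only the sections of \<open>c\<close>
    at the points \<open>d n i\<close>, each continuous in the state.\<close>
  define I where "I n a = (LEAST i. dist (d n i) a < inverse (real (Suc n)))" for n a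
  have [measurable]: "(\<lambda>a. dist x a) \<in> borel_measurable borel" for x :: 'a
    by (intro borel_measurable_continuous_onI continuous_intros)
  have I[measurable]: "I n \<in> borel \<rightarrow>\<^sub>M count_space UNIV" for n
    unfolding I_def by measurable
  have [measurable]: "U \<in> sets borel" using U by (simp add: compact_imp_closed)
  have cm: "(\<lambda>p. c (fst p) a) \<in> borel_measurable (borel \<Otimes>\<^sub>M borel)" if "a \<in> U" for a
  proof -
    have "continuous_on UNIV (\<lambda>x :: 'a. (x, a))" by (intro continuous_intros)
    from continuous_on_compose2[OF c this] have "continuous_on UNIV (\<lambda>x. c x a)"
      using that by auto
    then have [measurable]: "(\<lambda>x. c x a) \<in> borel_measurable borel" by (rule borel_measurable_continuous_onI)
    show ?thesis by measurable
  qed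
  have meas: "(\<lambda>p. c (fst p) (d n (I n (snd p)))) \<in> borel_measurable (borel \<Otimes>\<^sub>M borel)" for n
    by (rule measurable_compose_countable[where f="\<lambda>i p. c (fst p) (d n i)"]) (use cm[OF d] in auto)
  have "(\<lambda>p. if snd p \<in> U then c (fst p) (snd p) else 0) \<in> borel_measurable (borel \<Otimes>\<^sub>M borel)"
  proof (rule borel_measurable_LIMSEQ_metric)
    show "(\<lambda>p. if snd p \<in> U then c (fst p) (d n (I n (snd p))) else 0) \<in> borel_measurable (borel \<Otimes>\<^sub>M borel)" for n
      using meas[of n] by measurable
  next
    fix p :: "'a \<times> 'a"
    obtain x a where p: "p = (x, a)" by (cases p)
    show "(\<lambda>n. if snd p \<in> U then c (fst p) (d n (I n (snd p))) else 0) \<longlonglongrightarrow>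
        (if snd p \<in> U then c (fst p) (snd p) else 0)"
    proof (cases "a \<in> U")
      case True
      have "dist (d n (I n a)) a < inverse (real (Suc n))" for n
        unfolding I_def by (rule LeastI_ex[OF dense[OF True]])
      then have "(\<lambda>n. dist (d n (I n a)) a) \<longlonglongrightarrow> 0"
        by (intro tendsto_sandwich[OF _ _ tendsto_const LIMSEQ_inverse_real_of_nat])
           (auto intro!: always_eventually less_imp_le simp del: of_nat_Suc)
      then have "(\<lambda>n. d n (I n a)) \<longlonglongrightarrow> a" by (subst tendsto_dist_iff)
      then have "(\<lambda>n. (x, d n (I n a))) \<longlonglongrightarrow> (x, a)" by (intro tendsto_Pair tendsto_const)
      from continuous_on_tendsto_compose[OF c this] have "(\<lambda>n. c x (d n (I n a))) \<longlonglongrightarrow> c x a"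
        using True d by simp
      then show ?thesis using True by (simp add: p)
    qed (simp add: p)
  qed
  then have "(\<lambda>p. ennreal (- (if snd p \<in> U then c (fst p) (snd p) else 0))) \<in> borel_measurable (borel \<Otimes>\<^sub>M borel)"
    by measurable
  also have "(\<lambda>p. ennreal (- (if snd p \<in> U then c (fst p) (snd p) else 0))) = case_prod (cost U c)"
    by (auto simp: cost_def fun_eq_iff)
  finally show ?thesis .
qed

lemma measurable_controlled_process:
  assumes "\<And>i. cadlag (\<omega> i :: real \<Rightarrow> 'a::metric_space)"
  shows "(\<lambda>s. controlled_process V (max 0 s) \<omega>) \<in> borel_measurable borel"
  unfolding controlled_process_def
  by (rule measurable_compose_countable[where f="\<lambda>i s. \<omega> i (max 0 s)"])
     (use measurable_path_time[OF assms] in measurable)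

text \<open>Raising \<open>f\<close> by a bound \<open>M\<close> of \<open>\<bar>f\<bar>\<close> reduces everything to integrals of nonnegative functions;
  the value does not depend on \<open>M\<close>.\<close>

definition mean_reward ::
    "('a::metric_space \<Rightarrow> (real \<Rightarrow> 'a) measure) \<Rightarrow> 'a set \<Rightarrow> ('a \<Rightarrow> real) \<Rightarrow> real \<Rightarrow> ('a \<Rightarrow> 'a \<Rightarrow> real) \<Rightarrow>
     'a strategy \<Rightarrow> 'a \<Rightarrow> nat \<Rightarrow> ereal" where
  "mean_reward P U f M c V x n =
     enn2ereal (mean_gain P (\<lambda>y. ennreal (f y + M)) (\<lambda>_ _. 0) V x n) -
     ereal M * enn2ereal (expected_time P V x n) - enn2ereal (mean_gain P (\<lambda>_. 0) (cost U c) V x n)"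

text \<open>Domination of \<open>\<phi>\<close> by a multiple of \<open>t\<close> makes the integral
  \<open>p\<close> of the positive part finite. The claim is then read off the subtraction-free
  balance of integrals \<open>p + b * t + d = \<phi> + q\<close>; if \<open>d\<close> has infinite
  integral, then so has the negative part, and both sides are \<open>- \<infinity>\<close>.\<close>

lemma expectation_ereal_diff:
  fixes X :: "'b \<Rightarrow> real"
  assumes [measurable]: "\<phi> \<in> borel_measurable M" "t \<in> borel_measurable M" "d \<in> borel_measurable M"
    and t: "(\<integral>\<^sup>+x. t x \<partial>M) < \<infinity>" and m: "0 \<le> m"
    and le: "AE x in M. \<phi> x \<le> ennreal m * t x"
    and d: "AE x in M. d x < \<infinity>"
    and X: "AE x in M. X x = enn2real (\<phi> x) - b * enn2real (t x) - enn2real (d x)" and b: "0 \<le> b"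
  shows "expectation_ereal M (\<lambda>x. ereal (X x)) =
    enn2ereal (\<integral>\<^sup>+x. \<phi> x \<partial>M) - ereal b * enn2ereal (\<integral>\<^sup>+x. t x \<partial>M) - enn2ereal (\<integral>\<^sup>+x. d x \<partial>M)"
proof -
  let ?Y = "\<lambda>x. enn2real (\<phi> x) - b * enn2real (t x) - enn2real (d x)"
  define p where "p = (\<integral>\<^sup>+x. ennreal (?Y x) \<partial>M)"
  define q where "q = (\<integral>\<^sup>+x. ennreal (- ?Y x) \<partial>M)"
  have E: "expectation_ereal M (\<lambda>x. ereal (X x)) = enn2ereal p - enn2ereal q"
    unfolding expectation_ereal_def p_def q_def
    by (intro arg_cong2[where f="(-)"] arg_cong[where f=enn2ereal] nn_integral_cong_AE; use X in eventually_elim) simp_all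
  have t_fin: "AE x in M. t x < \<infinity>"
    using nn_integral_PInf_AE[of t M] t by (auto simp: less_top)
  have "(\<integral>\<^sup>+x. \<phi> x \<partial>M) \<le> (\<integral>\<^sup>+x. ennreal m * t x \<partial>M)" by (rule nn_integral_mono_AE[OF le])
  also have "\<dots> = ennreal m * (\<integral>\<^sup>+x. t x \<partial>M)" by (rule nn_integral_cmult) measurable
  also have "\<dots> < \<infinity>" using t by (simp add: ennreal_mult_less_top)
  finally have \<phi>: "(\<integral>\<^sup>+x. \<phi> x \<partial>M) < \<infinity>" .
  have fin: "AE x in M. t x < \<infinity> \<and> \<phi> x < \<infinity> \<and> d x < \<infinity>"
    using t_fin le d by eventually_elim (auto simp: ennreal_mult_less_top intro: le_less_trans)
  have "p \<le> (\<integral>\<^sup>+x. \<phi> x \<partial>M)"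
    unfolding p_def
  proof (rule nn_integral_mono_AE, use fin in eventually_elim)
    fix x assume "t x < \<infinity> \<and> \<phi> x < \<infinity> \<and> d x < \<infinity>"
    have "ennreal (?Y x) \<le> ennreal (enn2real (\<phi> x))"
      using mult_nonneg_nonneg[OF b enn2real_nonneg[of "t x"]] enn2real_nonneg[of "d x"]
      by (intro ennreal_leI) linarith
    also have "ennreal (enn2real (\<phi> x)) = \<phi> x" using \<open>t x < \<infinity> \<and> _\<close> by simp
    finally show "ennreal (?Y x) \<le> \<phi> x" .
  qed
  with \<phi> have p: "p < \<infinity>" by simp
  have "p + ennreal b * (\<integral>\<^sup>+x. t x \<partial>M) + (\<integral>\<^sup>+x. d x \<partial>M) = (\<integral>\<^sup>+x. ennreal (?Y x) + ennreal b * t x + d x \<partial>M)"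
    unfolding p_def
    by (subst nn_integral_add, measurable, subst nn_integral_add, measurable, subst nn_integral_cmult, measurable)
  also have "\<dots> = (\<integral>\<^sup>+x. \<phi> x + ennreal (- ?Y x) \<partial>M)"
  proof (rule nn_integral_cong_AE, use fin in eventually_elim)
    fix x assume "t x < \<infinity> \<and> \<phi> x < \<infinity> \<and> d x < \<infinity>"
    then obtain u v w where *: "0 \<le> u" "t x = ennreal u" "0 \<le> v" "\<phi> x = ennreal v" "0 \<le> w" "d x = ennreal w"
      by (cases "t x"; cases "\<phi> x"; cases "d x") auto
    have Y: "?Y x = v - b * u - w" and bt: "ennreal b * t x = ennreal (b * u)" and bu: "0 \<le> b * u"
      using * b by (simp_all add: ennreal_mult)
    show "ennreal (?Y x) + ennreal b * t x + d x = \<phi> x + ennreal (- ?Y x)"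
    proof (cases "0 \<le> v - b * u - w")
      case True
      then have "ennreal (v - b * u - w) + ennreal (b * u) + ennreal w = ennreal v"
        using *(5) bu by (simp add: ennreal_plus[symmetric] del: ennreal_plus)
      then show ?thesis unfolding Y bt using * True by (simp add: ennreal_neg)
    next
      case False
      then have "ennreal (b * u) + ennreal w = ennreal v + ennreal (- (v - b * u - w))"
        using *(3,5) bu by (subst (1 2) ennreal_plus[symmetric]) auto
      then show ?thesis unfolding Y bt using * False by (simp add: ennreal_neg)
    qed
  qed
  also have "\<dots> = (\<integral>\<^sup>+x. \<phi> x \<partial>M) + q"
    unfolding q_def by (rule nn_integral_add) measurable
  finally have eq: "p + ennreal b * (\<integral>\<^sup>+x. t x \<partial>M) + (\<integral>\<^sup>+x. d x \<partial>M) = (\<integral>\<^sup>+x. \<phi> x \<partial>M) + q" .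
  obtain p' t' \<phi>' where r: "0 \<le> p'" "p = ennreal p'" "0 \<le> t'" "(\<integral>\<^sup>+x. t x \<partial>M) = ennreal t'"
      "0 \<le> \<phi>'" "(\<integral>\<^sup>+x. \<phi> x \<partial>M) = ennreal \<phi>'"
    using p t \<phi> by (cases p; cases "\<integral>\<^sup>+x. t x \<partial>M"; cases "\<integral>\<^sup>+x. \<phi> x \<partial>M") auto
  show ?thesis
  proof (cases "\<integral>\<^sup>+x. d x \<partial>M")
    case (real d')
    then have "q \<noteq> top" using eq r b by (auto simp: ennreal_mult[symmetric] simp flip: ennreal_plus)
    then obtain q' where q: "0 \<le> q'" "q = ennreal q'" by (cases q) auto
    have "ennreal (p' + b * t' + d') = ennreal (\<phi>' + q')"
      using eq r q real b by (simp add: ennreal_mult)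
    then have "p' + b * t' + d' = \<phi>' + q'" using r q real b by (subst (asm) ennreal_inj) auto
    then show ?thesis unfolding E r q real using r q real by (simp add: algebra_simps)
  next
    case top
    then have "ennreal \<phi>' + q = top" using eq r by simp
    then have "q = top" by (simp add: ennreal_add_eq_top)
    then show ?thesis unfolding E r top using r by simp
  qed
qed

context markov_process begin

text \<open>Where the impulse time is finite, the raised reward integrates to the reward plus
  \<open>M\<close> times that time, and the booked costs are the negatives of the values of
  \<open>c\<close>. Taking expectations is left to \<open>expectation_ereal_diff\<close>, with
  \<open>2 * M\<close> as bound of \<open>f + M\<close>.\<close>

lemma expectation_reward:
  assumes V: "impulse_strategy U V" and fin: "expected_time P V x n < \<infinity>"
    and f[measurable]: "f \<in> borel_measurable borel" and M: "\<And>y. \<bar>f y\<bar> \<le> M"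
    and k: "case_prod (cost U c) \<in> borel_measurable (borel \<Otimes>\<^sub>M borel)" and c: "\<And>y a. a \<in> U \<Longrightarrow> c y a \<le> 0"
  shows "expectation_ereal (controlled_law P V x) (\<lambda>\<omega>.
      ereal ((LINT s:{s. 0 \<le> s \<and> ennreal s \<le> impulse_time V n \<omega>}|lborel. f (controlled_process V s \<omega>)) +
        (\<Sum>i\<le>n. c (pre_impulse_state V i \<omega>) (impulse_target V i \<omega>)))) = mean_reward P U f M c V x n"
proof -
  let ?L = "controlled_law P V x"
  let ?\<phi> = "\<lambda>\<omega>. \<Sum>i\<le>n. gain (\<lambda>y. ennreal (f y + M)) (\<lambda>_ _. 0) V i \<omega>"
  let ?d = "\<lambda>\<omega>. \<Sum>i\<le>n. gain (\<lambda>_. 0) (cost U c) V i \<omega>"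
  have M0: "0 \<le> M" using M[of x] by linarith
  have g: "(\<lambda>y. ennreal (f y + M)) \<in> borel_measurable borel" by measurable
  have k0: "case_prod (\<lambda>_ _. 0 :: ennreal) \<in> borel_measurable (borel \<Otimes>\<^sub>M borel)" by simp
  have g0: "(\<lambda>_. 0 :: ennreal) \<in> borel_measurable borel" by simp
  have restrict_meas: "F \<in> borel_measurable ?L"
    if "F \<in> borel_measurable (history_space (Suc n))" "\<And>\<omega>. F (restrict \<omega> {0..<Suc n}) = F \<omega>" for F :: "'a history \<Rightarrow> ennreal"
    using measurable_compose[OF measurable_restrict_controlled_law[OF V] that(1)] that(2) by simp
  have \<phi>_meas: "?\<phi> \<in> borel_measurable ?L"
    by (rule restrict_meas) (auto intro!: borel_measurable_sum measurable_gain[OF V g k0] simp: gain_restrict)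
  have d_meas: "?d \<in> borel_measurable ?L"
    by (rule restrict_meas) (auto intro!: borel_measurable_sum measurable_gain[OF V g0 k] simp: gain_restrict)
  have t_meas: "impulse_time V n \<in> borel_measurable ?L"
    by (rule restrict_meas) (auto intro!: measurable_impulse_time[OF V] simp: impulse_time_restrict)
  have t_fin: "AE \<omega> in ?L. impulse_time V n \<omega> < \<infinity>"
    using nn_integral_PInf_AE[OF t_meas] fin by (auto simp: less_top expected_time_def)
  have key: "?\<phi> \<omega> \<le> ennreal (2 * M) * impulse_time V n \<omega> \<and> ?d \<omega> < \<infinity> \<and>
      (LINT s:{s. 0 \<le> s \<and> ennreal s \<le> impulse_time V n \<omega>}|lborel. f (controlled_process V s \<omega>)) +
        (\<Sum>i\<le>n. c (pre_impulse_state V i \<omega>) (impulse_target V i \<omega>)) =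
      enn2real (?\<phi> \<omega>) - M * enn2real (impulse_time V n \<omega>) - enn2real (?d \<omega>)"
    if \<omega>: "\<omega> \<in> space ?L" and time_fin: "impulse_time V n \<omega> < \<infinity>" for \<omega>
  proof -
    note sp = controlled_law_restrict_space[OF V \<omega>]
    obtain t where t: "0 \<le> t" "impulse_time V n \<omega> = ennreal t" using time_fin by (cases "impulse_time V n \<omega>") auto
    have cad: "cadlag (\<omega> i)" for i using history_space_cadlag[OF sp, of i "Suc i"] by simp
    note [measurable] = measurable_controlled_process[OF cad, of V]
    let ?F = "\<lambda>s. f (controlled_process V (max 0 s) \<omega>)"
    have set: "{s. 0 \<le> s \<and> ennreal s \<le> impulse_time V n \<omega>} = {0..t}" "{s. 0 \<le> s \<and> ennreal s < impulse_time V n \<omega>} = {0..<t}"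
      using t by (auto simp: ennreal_less_iff)
    have ind: "integrable lborel (indicat_real {0..t})"
      by (rule integrable_real_indicator) (use t in simp_all)
    have int: "set_integrable lborel {0..t} ?F"
      unfolding set_integrable_def
      by (rule Bochner_Integration.integrable_bound[of lborel "\<lambda>s. indicator {0..t} s *\<^sub>R M"])
         (use M M0 ind in \<open>auto split: split_indicator\<close>)
    have intM: "set_integrable lborel {0..t} (\<lambda>s. M)"
      unfolding set_integrable_def using ind by simp
    have pos: "0 \<le> ?F s + M" for s using M[of "controlled_process V (max 0 s) \<omega>"] by linarith
    have "?\<phi> \<omega> = (\<integral>\<^sup>+s. ennreal (f (controlled_process V s \<omega>) + M) * indicator {0..<t} s \<partial>lborel)"
      using sum_segments[OF V sp[of "Suc n"] g] unfolding set .
    \<comment> \<open>Cycles are half-open, whereas the reward is integrated over a closed interval;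
      the end point \<open>t\<close> is a null set.\<close>
    also have "\<dots> = (\<integral>\<^sup>+s. ennreal (indicator {0..t} s * (?F s + M)) \<partial>lborel)"
      by (intro nn_integral_cong_AE, use AE_lborel_singleton[of t] in eventually_elim) (auto split: split_indicator)
    also have "\<dots> = ennreal (LINT s:{0..t}|lborel. ?F s + M)"
      using set_integral_add(1)[OF int intM] pos
      unfolding set_lebesgue_integral_def set_integrable_def real_scaleR_def
      by (intro nn_integral_eq_integral) (auto split: split_indicator)
    also have "(LINT s:{0..t}|lborel. ?F s + M) = (LINT s:{0..t}|lborel. ?F s) + M * t"
      using set_integral_add(2)[OF int intM] t by (simp add: set_lebesgue_integral_def)
    finally have \<phi>: "?\<phi> \<omega> = ennreal ((LINT s:{0..t}|lborel. ?F s) + M * t)" .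
    have F_eq: "(LINT s:{0..t}|lborel. f (controlled_process V s \<omega>)) = (LINT s:{0..t}|lborel. ?F s)"
      unfolding set_lebesgue_integral_def by (intro Bochner_Integration.integral_cong) (auto split: split_indicator)
    have "\<bar>LINT s:{0..t}|lborel. ?F s\<bar> \<le> (LINT s:{0..t}|lborel. M)"
      using set_integral_norm_bound[OF int] set_integral_mono[OF set_integrable_norm[OF int] intM] M by simp
    then have bound: "\<bar>LINT s:{0..t}|lborel. ?F s\<bar> \<le> M * t"
      using t by (simp add: set_lebesgue_integral_def mult.commute)
    have "?d \<omega> = (\<Sum>i\<le>n. ennreal (- c (pre_impulse_state V i \<omega>) (impulse_target V i \<omega>)))"
    proof (rule sum.cong[OF refl])
      fix i assume "i \<in> {..n}"
      then have "impulse_time V i \<omega> \<le> impulse_time V n \<omega>"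
        using impulse_time_mono[OF V sp, of i n "Suc n"] by (simp add: impulse_time_restrict)
      moreover have "impulse_target V i \<omega> \<in> U"
        unfolding impulse_target_def by (rule impulse_strategy_target[OF V sp])
      ultimately show "gain (\<lambda>_. 0) (cost U c) V i \<omega> = ennreal (- c (pre_impulse_state V i \<omega>) (impulse_target V i \<omega>))"
        using time_fin by (simp add: gain_def cost_def)
    qed
    also have "\<dots> = ennreal (- (\<Sum>i\<le>n. c (pre_impulse_state V i \<omega>) (impulse_target V i \<omega>)))"
      using c impulse_strategy_target[OF V sp] by (subst sum_ennreal) (auto simp: sum_negf impulse_target_def)
    finally have d: "?d \<omega> = ennreal (- (\<Sum>i\<le>n. c (pre_impulse_state V i \<omega>) (impulse_target V i \<omega>)))" .
    have neg: "(\<Sum>i\<le>n. c (pre_impulse_state V i \<omega>) (impulse_target V i \<omega>)) \<le> 0"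
      using c impulse_strategy_target[OF V sp] by (intro sum_nonpos) (auto simp: impulse_target_def)
    show ?thesis
      unfolding d \<phi> set F_eq unfolding t(2) using bound neg t M0
      by (auto simp: ennreal_mult[symmetric] intro!: ennreal_leI)
  qed
  have "expectation_ereal ?L (\<lambda>\<omega>.
      ereal ((LINT s:{s. 0 \<le> s \<and> ennreal s \<le> impulse_time V n \<omega>}|lborel. f (controlled_process V s \<omega>)) +
        (\<Sum>i\<le>n. c (pre_impulse_state V i \<omega>) (impulse_target V i \<omega>)))) =
    enn2ereal (\<integral>\<^sup>+\<omega>. ?\<phi> \<omega> \<partial>?L) - ereal M * enn2ereal (\<integral>\<^sup>+\<omega>. impulse_time V n \<omega> \<partial>?L) - enn2ereal (\<integral>\<^sup>+\<omega>. ?d \<omega> \<partial>?L)"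
    by (rule expectation_ereal_diff[OF \<phi>_meas t_meas d_meas, of "2 * M"])
       (use fin M0 in \<open>simp_all add: expected_time_def\<close>; use AE_space t_fin in eventually_elim; use key in auto)+
  then show ?thesis
    by (simp add: mean_reward_def mean_gain_controlled[OF V g k0] mean_gain_controlled[OF V g0 k] expected_time_def)
qed

end

section \<open>Average values do not depend on the starting point\<close>

locale reward_setting = markov_process P for P :: "'a::metric_space \<Rightarrow> (real \<Rightarrow> 'a) measure" +
  fixes U :: "'a set" and c :: "'a \<Rightarrow> 'a \<Rightarrow> real"
  assumes measurable_k: "case_prod (cost U c) \<in> borel_measurable (borel \<Otimes>\<^sub>M borel)"
    and cost_nonpos: "\<And>y a. a \<in> U \<Longrightarrow> c y a \<le> 0"
begin

lemma integrable_strategyD: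
  assumes "integrable_strategy P U x V"
  shows "impulse_strategy U V" "expected_time P V x n < \<infinity>"
  using assms by (auto simp: integrable_strategy_def admissible_def)

text \<open>Monotone convergence, as the impulse times increase to infinity almost surely. Because
  of this, bounded additive errors vanish in the average reward.\<close>

lemma expected_time_tendsto:
  assumes I: "integrable_strategy P U x V"
  shows "(\<lambda>n. expected_time P V x n) \<longlonglongrightarrow> \<infinity>"
proof -
  note V = integrable_strategyD(1)[OF I]
  let ?L = "controlled_law P V x"
  interpret prob_space ?L by (rule prob_space_controlled_law[OF V])
  have meas: "impulse_time V n \<in> borel_measurable ?L" for n
    using measurable_compose[OF measurable_restrict_controlled_law[OF V] measurable_impulse_time[OF V, of n "Suc n"]]
    by (simp add: impulse_time_restrict)
  have mono: "impulse_time V n \<omega> \<le> impulse_time V (Suc n) \<omega>" if "\<omega> \<in> space ?L" for n \<omega>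
    using impulse_time_mono[OF V controlled_law_restrict_space[OF V that, of "Suc (Suc n)"], of n "Suc n"]
    by (simp add: impulse_time_restrict)
  have AE_mono: "AE \<omega> in ?L. impulse_time V n \<omega> \<le> impulse_time V (Suc n) \<omega>" for n
    by (rule AE_I2) (rule mono)
  have "AE \<omega> in ?L. (\<lambda>n. impulse_time V n \<omega>) \<longlonglongrightarrow> \<infinity>"
    using I by (simp add: integrable_strategy_def admissible_def)
  then have "AE \<omega> in ?L. (SUP n. impulse_time V n \<omega>) = \<infinity>"
  proof (rule AE_mp, intro AE_I2 impI)
    fix \<omega> assume "\<omega> \<in> space ?L" and lim: "(\<lambda>n. impulse_time V n \<omega>) \<longlonglongrightarrow> \<infinity>"
    then have "incseq (\<lambda>n. impulse_time V n \<omega>)" by (intro incseq_SucI mono)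
    from LIMSEQ_unique[OF LIMSEQ_SUP[OF this] lim] show "(SUP n. impulse_time V n \<omega>) = \<infinity>" .
  qed
  then have "(\<integral>\<^sup>+\<omega>. (SUP n. impulse_time V n \<omega>) \<partial>?L) = (\<integral>\<^sup>+\<omega>. \<infinity> \<partial>?L)"
    by (rule nn_integral_cong_AE)
  also have "\<dots> = \<infinity>" by (simp add: emeasure_space_1)
  finally have SUP: "(SUP n. expected_time P V x n) = \<infinity>"
    unfolding expected_time_def
    using nn_integral_monotone_convergence_SUP_AE[where f="impulse_time V", OF AE_mono meas] by simp
  have "incseq (\<lambda>n. expected_time P V x n)"
    unfolding expected_time_def by (intro incseq_SucI nn_integral_mono mono)
  from LIMSEQ_SUP[OF this] show ?thesis unfolding SUP .
qed

lemma expected_time_real: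
  assumes I: "integrable_strategy P U x V"
  obtains t where "\<And>n. 0 \<le> t n" "\<And>n. expected_time P V x n = ennreal (t n)" "filterlim t at_top sequentially"
proof
  let ?t = "\<lambda>n. enn2real (expected_time P V x n)"
  show eq: "expected_time P V x n = ennreal (?t n)" for n
    using integrable_strategyD(2)[OF I, of n] by simp
  have "(\<lambda>n. ennreal (?t n)) \<longlonglongrightarrow> \<infinity>"
    using expected_time_tendsto[OF I] by (simp only: eq[symmetric])
  then show "filterlim ?t at_top sequentially" by (simp add: ennreal_tendsto_top_eq_at_top)
qed simp

end

locale bounded_reward = reward_setting P U c for P :: "'a::metric_space \<Rightarrow> (real \<Rightarrow> 'a) measure" and U c +
  fixes f :: "'a \<Rightarrow> real" and M :: real
  assumes f[measurable]: "f \<in> borel_measurable borel" and M: "\<And>y. \<bar>f y\<bar> \<le> M"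
begin

abbreviation "\<Phi> \<equiv> mean_gain P (\<lambda>y. ennreal (f y + M)) (\<lambda>_ _. 0)"

abbreviation "D \<equiv> mean_gain P (\<lambda>_. 0) (cost U c)"

lemma M_nonneg: "0 \<le> M"
  using M[of undefined] by linarith

lemma \<Phi>_measurable: "(\<lambda>y. ennreal (f y + M)) \<in> borel_measurable borel"
  by measurable

lemma zero_measurable: "case_prod (\<lambda>_ _. 0 :: ennreal) \<in> borel_measurable (borel \<Otimes>\<^sub>M borel)"
    "(\<lambda>_. 0 :: ennreal) \<in> borel_measurable borel"
  by simp_all

lemma mean_gain_const_time:
  assumes V: "impulse_strategy U V"
  shows "mean_gain P (\<lambda>_. a) (\<lambda>_ _. 0) V x n = a * expected_time P V x n"
  using mean_gain_cmult[OF V borel_measurable_const zero_measurable(1), of a 1 x n]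
  unfolding mean_gain_time[OF V] mult_1_right mult_zero_right .

lemma \<Phi>_le:
  assumes V: "impulse_strategy U V"
  shows "\<Phi> V x n \<le> ennreal (2 * M) * expected_time P V x n"
  unfolding mean_gain_const_time[OF V, symmetric]
proof (rule mean_gain_mono[OF V])
  show "ennreal (f y + M) \<le> ennreal (2 * M)" for y using M[of y] by (intro ennreal_leI) linarith
qed simp

lemma average_reward_eq:
  assumes I: "integrable_strategy P U x V"
  shows "average_reward P f c x V = liminf (\<lambda>n. mean_reward P U f M c V x n / enn2ereal (expected_time P V x n))"
  unfolding average_reward_def
proof (intro arg_cong[where f=liminf] ext arg_cong2[where f="(/)"] refl)
  show "expectation_ereal (controlled_law P V x) (\<lambda>\<omega>.
      ereal ((LINT s:{s. 0 \<le> s \<and> ennreal s \<le> impulse_time V n \<omega>}|lborel. f (controlled_process V s \<omega>)) +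
        (\<Sum>i\<le>n. c (pre_impulse_state V i \<omega>) (impulse_target V i \<omega>)))) = mean_reward P U f M c V x n" for n
    by (rule expectation_reward[OF integrable_strategyD[OF I] f M measurable_k cost_nonpos])
qed

text \<open>Division by the expected time leaves an error \<open>b / t n\<close>, which tends to
  \<open>0\<close>. The costs stand on the left, so that no difference is formed before the
  inequality itself has shown them finite; \<open>M + r\<close> in place of \<open>r\<close>
  accounts for the raised reward.\<close>

lemma average_reward_ge:
  assumes I: "integrable_strategy P U x V" and r: "0 \<le> M + r" and B: "B < \<infinity>"
    and le: "\<And>n. 1 \<le> n \<Longrightarrow> ennreal (M + r) * expected_time P V x n + D V x n \<le> \<Phi> V x n + B"
  shows "ereal r \<le> average_reward P f c x V"
proof -
  obtain t where t: "\<And>n. 0 \<le> t n" "\<And>n. expected_time P V x n = ennreal (t n)" "filterlim t at_top sequentially"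
    using expected_time_real[OF I] by blast
  obtain b where b: "0 \<le> b" "B = ennreal b" using B by (cases B) auto
  have "eventually (\<lambda>n. ereal (r - b / t n) \<le> mean_reward P U f M c V x n / enn2ereal (expected_time P V x n)) sequentially"
    using filterlim_at_top_dense[THEN iffD1, OF t(3), rule_format, of 0] eventually_ge_at_top[of 1]
  proof eventually_elim
    fix n assume n: "0 < t n" "1 \<le> n"
    have "\<Phi> V x n < \<infinity>"
      using \<Phi>_le[OF integrable_strategyD(1)[OF I], of x n] t(1,2)[of n] M_nonneg
      by (auto simp: ennreal_mult[symmetric] intro: le_less_trans)
    then obtain u where u: "0 \<le> u" "\<Phi> V x n = ennreal u" by (cases "\<Phi> V x n") auto
    have le': "ennreal ((M + r) * t n) + D V x n \<le> ennreal (u + b)"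
      using le[OF n(2)] u b t r by (simp add: ennreal_mult)
    then have "D V x n < \<infinity>" by (cases "D V x n") (auto simp: top_unique)
    then obtain d where d: "0 \<le> d" "D V x n = ennreal d" by (cases "D V x n") auto
    have "ennreal ((M + r) * t n + d) \<le> ennreal (u + b)"
      using le' d r t(1)[of n] by simp
    then have "(M + r) * t n + d \<le> u + b" using u b by (subst (asm) ennreal_le_iff) auto
    then have "r * t n - b \<le> u - M * t n - d" by (simp add: algebra_simps)
    then have "(r * t n - b) / t n \<le> (u - M * t n - d) / t n" using n by (intro divide_right_mono) auto
    then have "r - b / t n \<le> (u - M * t n - d) / t n" using n by (simp add: diff_divide_distrib)
    moreover have "mean_reward P U f M c V x n = ereal (u - M * t n - d)"
      unfolding mean_reward_def using u d t(1,2)[of n] by simp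
    ultimately show "ereal (r - b / t n) \<le> mean_reward P U f M c V x n / enn2ereal (expected_time P V x n)"
      using n t by simp
  qed
  then have "liminf (\<lambda>n. ereal (r - b / t n)) \<le> average_reward P f c x V"
    unfolding average_reward_eq[OF I] by (rule Liminf_mono)
  moreover have "(\<lambda>n. r - b / t n) \<longlonglongrightarrow> r - 0"
    by (intro tendsto_diff tendsto_const real_tendsto_divide_at_top[OF tendsto_const] t(3))
  then have "liminf (\<lambda>n. ereal (r - b / t n)) = ereal r"
    by (intro lim_imp_Liminf) auto
  ultimately show ?thesis by simp
qed

text \<open>With \<open>r'\<close> strictly between \<open>r\<close> and the average, the surplus
  over rate \<open>r\<close> is at least \<open>(r' - r) * t n\<close> for large \<open>n\<close>
  and exceeds every constant. The index \<open>Suc n\<close> leaves room for splitting off impulse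
  \<open>0\<close>.\<close>

lemma average_reward_greater:
  assumes I: "integrable_strategy P U x V" and r: "0 \<le> M + r" and B: "B < \<infinity>"
    and less: "ereal r < average_reward P f c x V"
  shows "\<exists>n. B + (ennreal (M + r) * expected_time P V x (Suc n) + D V x (Suc n)) < \<Phi> V x (Suc n)"
proof -
  obtain t where t: "\<And>n. 0 \<le> t n" "\<And>n. expected_time P V x n = ennreal (t n)" "filterlim t at_top sequentially"
    using expected_time_real[OF I] by blast
  obtain b where b: "0 \<le> b" "B = ennreal b" using B by (cases B) auto
  obtain r' where r': "r < r'" "ereal r' < average_reward P f c x V"
    using ereal_dense2[OF less] by auto
  have "eventually (\<lambda>n. ereal r' < mean_reward P U f M c V x n / enn2ereal (expected_time P V x n)) sequentially"
    using less_LiminfD[OF r'(2)[unfolded average_reward_eq[OF I]]] .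
  moreover have "eventually (\<lambda>n. max 0 (b / (r' - r)) < t n) sequentially"
    using filterlim_at_top_dense[THEN iffD1, OF t(3)] by blast
  moreover have "eventually (\<lambda>n. 1 \<le> n) (sequentially :: nat filter)" by (rule eventually_ge_at_top)
  ultimately have "eventually (\<lambda>n. ereal r' < mean_reward P U f M c V x n / enn2ereal (expected_time P V x n) \<and>
      max 0 (b / (r' - r)) < t n \<and> 1 \<le> n) sequentially"
    by eventually_elim simp
  then obtain n where *: "ereal r' < mean_reward P U f M c V x n / enn2ereal (expected_time P V x n)"
      "max 0 (b / (r' - r)) < t n" "1 \<le> n"
    using eventually_happens'[OF sequentially_bot] by blast
  have "\<Phi> V x n < \<infinity>"
    using \<Phi>_le[OF integrable_strategyD(1)[OF I], of x n] t(1,2)[of n] M_nonneg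
    by (auto simp: ennreal_mult[symmetric] intro: le_less_trans)
  then obtain u where u: "0 \<le> u" "\<Phi> V x n = ennreal u" by (cases "\<Phi> V x n") auto
  have tn: "0 < t n" "b < (r' - r) * t n" using *(2) r'(1) by (simp_all add: field_simps)
  have "D V x n \<noteq> top"
  proof
    assume "D V x n = top"
    then have "mean_reward P U f M c V x n = - \<infinity>" using u t(1,2)[of n] by (simp add: mean_reward_def)
    then show False using *(1) t(2)[of n] tn by simp
  qed
  then obtain d where d: "0 \<le> d" "D V x n = ennreal d" by (cases "D V x n") auto
  have "mean_reward P U f M c V x n = ereal (u - M * t n - d)"
    unfolding mean_reward_def using u d t(1,2)[of n] by simp
  then have "r' < (u - M * t n - d) / t n" using *(1) t(2)[of n] tn by simp
  then have "r' * t n < u - M * t n - d" using tn by (simp add: field_simps)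
  then have "b + ((M + r) * t n + d) < u" using tn(2) by (simp add: algebra_simps)
  moreover have "B + (ennreal (M + r) * expected_time P V x n + D V x n) = ennreal (b + ((M + r) * t n + d))"
    using b d t(1,2)[of n] r by (simp add: ennreal_mult)
  moreover have "0 \<le> b + ((M + r) * t n + d)" using b d r t(1)[of n] by simp
  ultimately have "B + (ennreal (M + r) * expected_time P V x n + D V x n) < \<Phi> V x n"
    unfolding u(2) by (simp only: ennreal_less_iff)
  then show ?thesis using *(3) by (cases n) auto
qed

lemma mean_gain_const_cost:
  assumes V: "impulse_strategy U V"
  shows "mean_gain P (\<lambda>_. a) (cost U c) V x n = a * expected_time P V x n + D V x n"
  using mean_gain_add[OF V borel_measurable_const zero_measurable(2,1) measurable_k, of a x n]
  unfolding mean_gain_const_time[OF V] add_0_left add_0_right .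

text \<open>The surplus \<open>K\<close> of one run of \<open>Q\<close> pays for the impulse that
  closes the period, so each period earns at least rate \<open>r\<close> after costs. An unfinished
  last period falls short by at most the debit \<open>?Y W y (Suc n)\<close> of a whole one, and the
  first impulse adds \<open>cost U c x y\<close>; both are finite constants and vanish in the
  average.\<close>

lemma restart_strategy_ge:
  assumes Q: "impulse_strategy U Q" and y: "y \<in> U" and r: "0 < M + r" and K: "K < \<infinity>"
    and K_cost: "\<And>a. a \<in> U \<Longrightarrow> cost U c a y \<le> K"
    and gain: "K + (ennreal (M + r) * expected_time P Q y n + D Q y n) < \<Phi> Q y n"
  shows "ereal r \<le> average_value P U f c x"
proof -
  let ?p = "ennreal (M + r)"
  have p: "0 < ?p" using r by simp
  have "?p * expected_time P Q y n \<noteq> top" using gain by auto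
  then have fin: "expected_time P Q y n < \<infinity>" using p by (auto simp: ennreal_mult_eq_top_iff less_top)
  \<comment> \<open>The raised reward is at most \<open>2 * M\<close> times the expected duration,
    so a strictly positive one needs a positive duration.\<close>
  have "expected_time P Q y n \<noteq> 0" using gain \<Phi>_le[OF Q, of y n] by auto
  then interpret periodic_strategy P U Q y n
    using fin by unfold_locales (auto simp: y Q zero_less_iff_neq_zero)
  \<comment> \<open>Rate \<open>M + r\<close> and impulse costs together form one mean gain, to
    which the identities for periods apply directly.\<close>
  let ?Y = "mean_gain P (\<lambda>_. ?p) (cost U c)"
  have p_meas: "(\<lambda>_. ?p) \<in> borel_measurable borel" by simp
  interpret L: prob_space "history_law P Q y (Suc n)" by (rule prob_space_history_law[OF Q])
  have cycle_\<Phi>: "\<Phi> W y (Suc n) = \<Phi> Q y n"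
    using mean_gain_periodic[OF \<Phi>_measurable zero_measurable(1)] by simp
  have "(\<integral>\<^sup>+h. cost U c (snd Q n h) y \<partial>history_law P Q y (Suc n)) \<le> (\<integral>\<^sup>+h. K \<partial>history_law P Q y (Suc n))"
    by (intro nn_integral_mono K_cost impulse_strategy_target[OF Q]) (simp add: space_history_law[OF Q])
  then have \<kappa>: "(\<integral>\<^sup>+h. cost U c (snd Q n h) y \<partial>history_law P Q y (Suc n)) \<le> K" by (simp add: L.emeasure_space_1)
  have "?Y W y (Suc n) = ?Y Q y n + (\<integral>\<^sup>+h. cost U c (snd Q n h) y \<partial>history_law P Q y (Suc n))"
    by (rule mean_gain_periodic[OF p_meas measurable_k])
  also have "\<dots> \<le> ?Y Q y n + K" by (rule add_left_mono[OF \<kappa>])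
  also have "\<dots> \<le> \<Phi> W y (Suc n)" using less_imp_le[OF gain] unfolding cycle_\<Phi> mean_gain_const_cost[OF Q, of ?p] by (simp only: add.commute)
  finally have cycle: "?Y W y (Suc n) \<le> \<Phi> W y (Suc n)" .
  have "\<Phi> W y (Suc n) < \<infinity>"
    unfolding cycle_\<Phi> by (rule le_less_trans[OF \<Phi>_le[OF Q]]) (use fin in \<open>simp add: ennreal_mult_less_top\<close>)
  with cycle have Y_fin: "?Y W y (Suc n) < \<infinity>" by (rule le_less_trans)
  \<comment> \<open>Induction in steps of a whole period. Up to one period, monotonicity in the
    number of impulses bounds \<open>?Y\<close> by its value over the full period.\<close>
  have le: "?Y W y m \<le> \<Phi> W y m + ?Y W y (Suc n)" for m
  proof (induction m rule: less_induct)
    case (less m)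
    show ?case
    proof (cases "m \<le> Suc n")
      case True
      then show ?thesis
        using mean_gain_mono_time[OF True impulse_strategy_W p_meas measurable_k, of y] by (simp add: add_increasing)
    next
      case False
      then obtain j where j: "m = n + 2 + j" by (metis add_2_eq_Suc' le_add_diff_inverse not_less_eq_eq)
      have "?Y W y m = ?Y W y (Suc n) + ?Y W y j"
        unfolding j by (rule mean_gain_periodic_add[OF p_meas measurable_k])
      also have "\<dots> \<le> \<Phi> W y (Suc n) + (\<Phi> W y j + ?Y W y (Suc n))"
        by (intro add_mono cycle less.IH) (simp add: j)
      also have "\<dots> = \<Phi> W y m + ?Y W y (Suc n)"
        unfolding j mean_gain_periodic_add[OF \<Phi>_measurable zero_measurable(1)] by (simp add: add.assoc)
      finally show ?thesis .
    qed
  qed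
  have I: "integrable_strategy P U x (restart y W)" by (rule integrable_strategy_restart_periodic)
  have "ereal r \<le> average_reward P f c x (restart y W)"
  proof (rule average_reward_ge[OF I])
    show "0 \<le> M + r" using r by simp
    show "cost U c x y + ?Y W y (Suc n) < \<infinity>" using Y_fin by (simp add: cost_def)
    fix m :: nat assume "1 \<le> m"
    then obtain j where j: "m = Suc j" by (cases m) auto
    have "?Y (restart y W) x m = cost U c x y + ?Y W y j"
      unfolding j by (rule mean_gain_restart_Suc[OF y impulse_strategy_W p_meas measurable_k])
    also have "\<dots> \<le> cost U c x y + (\<Phi> W y j + ?Y W y (Suc n))" by (intro add_left_mono le)
    also have "\<dots> = \<Phi> (restart y W) x m + (cost U c x y + ?Y W y (Suc n))"
      unfolding j mean_gain_restart_Suc[OF y impulse_strategy_W \<Phi>_measurable zero_measurable(1)] by (simp add: ac_simps)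
    finally show "?p * expected_time P (restart y W) x m + D (restart y W) x m \<le>
        \<Phi> (restart y W) x m + (cost U c x y + ?Y W y (Suc n))"
      unfolding mean_gain_const_cost[OF impulse_strategy_restart_W, of ?p] .
  qed
  also have "\<dots> \<le> average_value P U f c x"
    unfolding average_value_def using I by (intro SUP_upper) simp
  finally show ?thesis .
qed

lemma average_value_ge:
  assumes I: "integrable_strategy P U x V" and less: "ereal r < average_reward P f c x V" and r: "0 < M + r"
    and K: "K < \<infinity>" and K_cost: "\<And>a y. a \<in> U \<Longrightarrow> y \<in> U \<Longrightarrow> cost U c a y \<le> K"
  shows "ereal r \<le> average_value P U f c x'"
proof -
  note V = integrable_strategyD[OF I]
  let ?p = "ennreal (M + r)" and ?L = "history_law P V x (Suc 0)"
  let ?Y = "mean_gain P (\<lambda>_. ?p) (cost U c)"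
  have "\<Phi> V x 0 < \<infinity>"
    by (rule le_less_trans[OF \<Phi>_le[OF V(1)]]) (use V(2)[of 0] in \<open>simp add: ennreal_mult_less_top\<close>)
  \<comment> \<open>The surplus has to cover the reward \<open>\<Phi> V x 0\<close> of the cycle to
    be cut off and the price \<open>K\<close> of closing a period.\<close>
  then obtain n where n: "(\<Phi> V x 0 + K) + ?Y V x (Suc n) < \<Phi> V x (Suc n)"
    using average_reward_greater[OF I _ _ less, of "\<Phi> V x 0 + K"] r K unfolding mean_gain_const_cost[OF V(1), of ?p] by auto
  have R: "impulse_strategy U (tail V 0 h) \<and> continues V 0 h (tail V 0 h)"
    if "h \<in> space (history_space (Suc 0))" "fst V 0 h < \<infinity>" for h
    using impulse_strategy_tail[OF V(1) that] continues_tail[OF V(1) that(1)] by simp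
  have fin: "AE h in ?L. fst V 0 h < \<infinity>" by (rule AE_time_finite[OF V])
  have p_meas: "(\<lambda>_. ?p) \<in> borel_measurable borel" by simp
  have split_\<Phi>: "\<Phi> V x (Suc n) = \<Phi> V x 0 + (\<integral>\<^sup>+h. \<Phi> (tail V 0 h) (snd V 0 h) n \<partial>?L)"
    using mean_gain_continues[OF V(1) R fin \<Phi>_measurable zero_measurable(1), of 0 n] by simp
  have split_Y: "K + ?Y V x (Suc n) = ?Y V x 0 + (\<integral>\<^sup>+h. K + ?Y (tail V 0 h) (snd V 0 h) n \<partial>?L)"
    using mean_gain_continues[OF V(1) R fin p_meas measurable_k, of K n] by simp
  \<comment> \<open>If no past had a tail with surplus \<open>K\<close>, integrating the opposite
    inequality over the pasts would contradict the choice of \<open>n\<close>; the debit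
    \<open>?Y V x 0\<close> of the first cycle is simply dropped.\<close>
  have "\<exists>h\<in>space (history_space (Suc 0)). fst V 0 h < \<infinity> \<and>
      K + ?Y (tail V 0 h) (snd V 0 h) n < \<Phi> (tail V 0 h) (snd V 0 h) n"
  proof (rule ccontr)
    assume none: "\<not> ?thesis"
    have "AE h in ?L. \<Phi> (tail V 0 h) (snd V 0 h) n \<le> K + ?Y (tail V 0 h) (snd V 0 h) n"
      using fin AE_space
    proof eventually_elim
      fix h assume "fst V 0 h < \<infinity>" "h \<in> space ?L"
      then show "\<Phi> (tail V 0 h) (snd V 0 h) n \<le> K + ?Y (tail V 0 h) (snd V 0 h) n"
        using none unfolding space_history_law[OF V(1)] not_less[symmetric] by blast
    qed
    then have "(\<integral>\<^sup>+h. \<Phi> (tail V 0 h) (snd V 0 h) n \<partial>?L) \<le> (\<integral>\<^sup>+h. K + ?Y (tail V 0 h) (snd V 0 h) n \<partial>?L)"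
      by (rule nn_integral_mono_AE)
    also have "\<dots> \<le> K + ?Y V x (Suc n)" unfolding split_Y by simp
    finally have "\<Phi> V x (Suc n) \<le> (\<Phi> V x 0 + K) + ?Y V x (Suc n)"
      unfolding split_\<Phi> by (simp only: add.assoc add_left_mono)
    then show False using n by simp
  qed
  then obtain h where h: "h \<in> space (history_space (Suc 0))" "fst V 0 h < \<infinity>"
    and gt: "K + ?Y (tail V 0 h) (snd V 0 h) n < \<Phi> (tail V 0 h) (snd V 0 h) n"
    by blast
  have Q: "impulse_strategy U (tail V 0 h)" using R[OF h] by simp
  have y: "snd V 0 h \<in> U" by (rule impulse_strategy_target[OF V(1) h(1)])
  show ?thesis
    by (rule restart_strategy_ge[OF Q y r K]) (use K_cost[OF _ y] gt in \<open>auto simp: mean_gain_const_cost[OF Q, of ?p]\<close>)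
qed

end

section \<open>Truncation of the reward\<close>

context reward_setting begin

text \<open>Every real rate strictly below an average reward from \<open>x\<close> is a lower bound
  of the value at \<open>x'\<close>, and \<open>dense_le\<close> passes to the supremum.\<close>

lemma average_value_mono_start:
  fixes f :: "'a \<Rightarrow> real"
  assumes f: "f \<in> borel_measurable borel" and M: "\<And>y. \<bar>f y\<bar> \<le> M"
    and K: "K < \<infinity>" and K_cost: "\<And>a y. a \<in> U \<Longrightarrow> y \<in> U \<Longrightarrow> cost U c a y \<le> K"
  shows "average_value P U f c x \<le> average_value P U f c x'"
  unfolding average_value_def[of P U f c x]
proof (rule SUP_least, rule dense_le)
  fix V and s :: ereal
  assume V: "V \<in> {V. integrable_strategy P U x V}" and less: "s < average_reward P f c x V"
  show "s \<le> average_value P U f c x'"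
  proof (cases s)
    case (real r)
    \<comment> \<open>The bound is enlarged by \<open>\<bar>r\<bar> + 1\<close> to make the raised
      rate positive also for negative \<open>r\<close>.\<close>
    have pos: "0 < M + \<bar>r\<bar> + 1 + r" using M[of x] by linarith
    interpret bounded_reward P U c f "M + \<bar>r\<bar> + 1"
    proof
      show "\<bar>f y\<bar> \<le> M + \<bar>r\<bar> + 1" for y using M[of y] by linarith
    qed (rule f)
    show ?thesis unfolding real
      by (rule average_value_ge[of x V]) (use V less real K K_cost pos in auto)
  qed (use less in auto)
qed

lemma average_value_constant:
  fixes f :: "'a \<Rightarrow> real"
  assumes "f \<in> borel_measurable borel" "\<And>y. \<bar>f y\<bar> \<le> M"
    and "K < \<infinity>" "\<And>a y. a \<in> U \<Longrightarrow> y \<in> U \<Longrightarrow> cost U c a y \<le> K"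
  shows "average_value P U f c x = average_value P U f c x'"
  by (intro antisym average_value_mono_start[OF assms])

section \<open>Occupation times along a strategy\<close>

definition occupation_bound :: "'a set \<Rightarrow> ennreal \<Rightarrow> bool" where
  "occupation_bound A \<epsilon> \<longleftrightarrow> (\<forall>x\<in>U. \<forall>\<tau>. stopping_time path_filtration \<tau> \<longrightarrow>
     0 < (\<integral>\<^sup>+\<omega>. \<tau> \<omega> \<partial>P x) \<longrightarrow> (\<integral>\<^sup>+\<omega>. \<tau> \<omega> \<partial>P x) < \<infinity> \<longrightarrow>
     (\<integral>\<^sup>+\<omega>. occupation_time A (\<tau> \<omega>) \<omega> \<partial>P x) \<le> \<epsilon> * (\<integral>\<^sup>+\<omega>. \<tau> \<omega> \<partial>P x))"

text \<open>Up to impulse \<open>0\<close> the controlled process is the uncontrolled one, and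
  \<open>fst V 0\<close>, read as a function of a single path, is a stopping time
  \<open>\<tau>\<close> of the natural filtration, so the bound applies to it.\<close>

lemma first_cycle_occupation:
  assumes V: "impulse_strategy U V" and x: "x \<in> U" and A[measurable]: "A \<in> sets borel"
    and bound: "occupation_bound A \<epsilon>" and fin: "expected_time P V x 0 < \<infinity>"
  shows "mean_gain P (indicator A) (\<lambda>_ _. 0) V x 0 \<le> \<epsilon> * expected_time P V x 0"
proof -
  let ?h = "\<lambda>\<omega>. (\<lambda>_. undefined)(0 := \<omega>) :: 'a history"
  define \<tau> where "\<tau> = (\<lambda>\<omega>. fst V 0 (?h \<omega>))"
  have zero: "case_prod (\<lambda>_ _. 0 :: ennreal) \<in> borel_measurable (borel \<Otimes>\<^sub>M borel)" by simp
  have h_space: "?h \<omega> \<in> space (history_space (Suc 0))" if "\<omega> \<in> space path_space" for \<omega>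
    using that by (auto simp: space_history_space PiE_iff extensional_def)
  have st: "stopping_time path_filtration \<tau>"
  proof
    fix t
    have "(\<lambda>\<omega>. (\<lambda>_. undefined)(0 := \<omega>)) \<in> path_filtration t \<rightarrow>\<^sub>M Pi\<^sub>M {0..<Suc 0} (\<lambda>_. path_filtration t)"
      by (rule measurable_fun_upd[where J="{}"]) (auto simp: space_PiM)
    then have h: "?h \<in> path_filtration t \<rightarrow>\<^sub>M history_filtration (Suc 0) t"
      by (simp add: history_filtration_def)
    have "stopping_time (history_filtration (Suc 0)) (fst V 0)" using V by (simp add: impulse_strategy_def)
    then show "Measurable.pred (path_filtration t) (\<lambda>\<omega>. \<tau> \<omega> \<le> t)"
      unfolding \<tau>_def by (intro measurable_compose[OF h] stopping_timeD)
  qed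
  have time: "impulse_time V 0 (?h \<omega>) = \<tau> \<omega>" if "\<omega> \<in> space path_space" for \<omega>
    unfolding \<tau>_def by (rule impulse_time_history[OF h_space[OF that]])
  have gain: "mean_gain P g (\<lambda>_ _. 0) V x 0 = (\<integral>\<^sup>+\<omega>. gain g (\<lambda>_ _. 0) V 0 (?h \<omega>) \<partial>P x)"
    if "g \<in> borel_measurable borel" for g
    using nn_integral_history_law_1[OF V, of "gain g (\<lambda>_ _. 0) V 0" x] measurable_gain[OF V that zero, of 0 1]
    by (simp add: mean_gain_def)
  have T: "expected_time P V x 0 = (\<integral>\<^sup>+\<omega>. \<tau> \<omega> \<partial>P x)"
  proof -
    have "expected_time P V x 0 = (\<integral>\<^sup>+h. impulse_time V 0 h \<partial>history_law P V x 1)"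
      using nn_integral_controlled_law[OF V measurable_impulse_time[OF V, of 0 1], of x]
      by (simp only: expected_time_def impulse_time_restrict zero_less_one)
    also have "\<dots> = (\<integral>\<^sup>+\<omega>. \<tau> \<omega> \<partial>P x)"
      unfolding nn_integral_history_law_1[OF V measurable_impulse_time[OF V zero_less_one]]
      by (rule nn_integral_cong) (simp add: P_space time)
    finally show ?thesis .
  qed
  show ?thesis
  proof (cases "expected_time P V x 0 = 0")
    \<comment> \<open>\<open>occupation_bound\<close> speaks of positive expected times only; for
      zero expected time the occupation vanishes, being at most the duration.\<close>
    case True
    have "mean_gain P (indicator A) (\<lambda>_ _. 0) V x 0 \<le> mean_gain P (\<lambda>_. 1) (\<lambda>_ _. 0) V x 0"
      by (rule mean_gain_mono[OF V]) (auto simp: indicator_def)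
    then show ?thesis using True by (simp add: mean_gain_time[OF V])
  next
    case False
    have "mean_gain P (indicator A) (\<lambda>_ _. 0) V x 0 \<le> (\<integral>\<^sup>+\<omega>. occupation_time A (\<tau> \<omega>) \<omega> \<partial>P x)"
      unfolding gain[OF borel_measurable_indicator[OF A]]
    proof (rule nn_integral_mono)
      fix \<omega> assume "\<omega> \<in> space (P x)"
      then show "gain (indicator A) (\<lambda>_ _. 0) V 0 (?h \<omega>) \<le> occupation_time A (\<tau> \<omega>) \<omega>"
        unfolding gain_def occupation_time_def using time[of \<omega>]
        by (auto simp: P_space intro!: nn_integral_mono mult_left_mono split: split_indicator)
    qed
    also have "\<dots> \<le> \<epsilon> * expected_time P V x 0"
      using bound x st fin False unfolding occupation_bound_def T by (simp add: zero_less_iff_neq_zero)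
    finally show ?thesis .
  qed
qed

text \<open>Induction over the impulses: the tail after impulse \<open>0\<close> starts from its
  target, again a point of \<open>U\<close>. Both sides are mean gains and split by the same
  identity. With infinite expected time the right side is infinite, because
  \<open>\<epsilon>\<close> is positive.\<close>

lemma mean_occupation_le:
  assumes A: "A \<in> sets borel" and bound: "occupation_bound A \<epsilon>" and \<epsilon>: "0 < \<epsilon>"
  shows "impulse_strategy U V \<Longrightarrow> x \<in> U \<Longrightarrow>
    mean_gain P (indicator A) (\<lambda>_ _. 0) V x n \<le> mean_gain P (\<lambda>_. \<epsilon>) (\<lambda>_ _. 0) V x n"
proof -
  have zero: "case_prod (\<lambda>_ _. 0 :: ennreal) \<in> borel_measurable (borel \<Otimes>\<^sub>M borel)" by simp
  have const: "mean_gain P (\<lambda>_. \<epsilon>) (\<lambda>_ _. 0) V x n = \<epsilon> * expected_time P V x n"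
    if V: "impulse_strategy U V" for V x n
    using mean_gain_cmult[OF V borel_measurable_const zero, of \<epsilon> 1 x n]
    unfolding mean_gain_time[OF V] mult_1_right mult_zero_right .
  show "impulse_strategy U V \<Longrightarrow> x \<in> U \<Longrightarrow>
    mean_gain P (indicator A) (\<lambda>_ _. 0) V x n \<le> mean_gain P (\<lambda>_. \<epsilon>) (\<lambda>_ _. 0) V x n"
  proof (induction n arbitrary: V x)
  case 0
    show ?case
    proof (cases "expected_time P V x 0 < \<infinity>")
      case True
      then show ?thesis using first_cycle_occupation[OF 0 A bound] by (simp add: const[OF 0(1)])
    next
      case False
      then show ?thesis using \<epsilon> by (simp add: const[OF 0(1)] less_top[symmetric] ennreal_mult_top)
    qed
  next
  case (Suc n)
    show ?case
    proof (cases "expected_time P V x (Suc n) < \<infinity>")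
      case True
      have "expected_time P V x 0 \<le> expected_time P V x (Suc n)"
        using mean_gain_mono_time[of 0 "Suc n", OF _ Suc.prems(1) borel_measurable_const zero, of 1 x]
        by (simp add: mean_gain_time[OF Suc.prems(1)])
      with True have fin: "expected_time P V x 0 < \<infinity>" by (rule le_less_trans[rotated])
      have R: "impulse_strategy U (tail V 0 h) \<and> continues V 0 h (tail V 0 h)"
        if "h \<in> space (history_space (Suc 0))" "fst V 0 h < \<infinity>" for h
        using impulse_strategy_tail[OF Suc.prems(1) that] continues_tail[OF Suc.prems(1) that(1)] by simp
      note AE_fin = AE_time_finite[OF Suc.prems(1) fin]
      have split: "mean_gain P g (\<lambda>_ _. 0) V x (Suc n) = mean_gain P g (\<lambda>_ _. 0) V x 0 +
          (\<integral>\<^sup>+h. mean_gain P g (\<lambda>_ _. 0) (tail V 0 h) (snd V 0 h) n \<partial>history_law P V x (Suc 0))"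
        if "g \<in> borel_measurable borel" for g
        using mean_gain_continues[OF Suc.prems(1) R AE_fin that zero, of 0 n] by simp
      show ?thesis
        unfolding split[OF borel_measurable_indicator[OF A]] split[OF borel_measurable_const]
      proof (intro add_mono nn_integral_mono_AE)
        show "mean_gain P (indicator A) (\<lambda>_ _. 0) V x 0 \<le> mean_gain P (\<lambda>_. \<epsilon>) (\<lambda>_ _. 0) V x 0"
          using first_cycle_occupation[OF Suc.prems A bound fin] by (simp add: const[OF Suc.prems(1)])
        show "AE h in history_law P V x (Suc 0). mean_gain P (indicator A) (\<lambda>_ _. 0) (tail V 0 h) (snd V 0 h) n
            \<le> mean_gain P (\<lambda>_. \<epsilon>) (\<lambda>_ _. 0) (tail V 0 h) (snd V 0 h) n"
          using AE_fin AE_space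
        proof eventually_elim
          fix h assume fin: "fst V 0 h < \<infinity>" and "h \<in> space (history_law P V x (Suc 0))"
          then have h: "h \<in> space (history_space (Suc 0))" by (simp add: space_history_law[OF Suc.prems(1)])
          show "mean_gain P (indicator A) (\<lambda>_ _. 0) (tail V 0 h) (snd V 0 h) n
            \<le> mean_gain P (\<lambda>_. \<epsilon>) (\<lambda>_ _. 0) (tail V 0 h) (snd V 0 h) n"
            using R[OF h fin] impulse_strategy_target[OF Suc.prems(1) h] by (intro Suc.IH) auto
        qed
      qed
    next
      case False
      then show ?thesis using \<epsilon> by (simp add: const[OF Suc.prems(1)] less_top[symmetric] ennreal_mult_top)
    qed
  qed
qed

text \<open>The same strategy is evaluated with both rewards. They differ by at most
  \<open>2 * M\<close>, and only on \<open>A\<close>, where at most the fraction \<open>e\<close> of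
  the expected duration is spent.\<close>

lemma average_value_le:
  fixes f f' :: "'a \<Rightarrow> real"
  assumes f: "f \<in> borel_measurable borel" "f' \<in> borel_measurable borel"
    and M: "\<And>y. \<bar>f y\<bar> \<le> M" "\<And>y. \<bar>f' y\<bar> \<le> M"
    and A: "A \<in> sets borel" and eq: "\<And>y. y \<notin> A \<Longrightarrow> f' y = f y"
    and x: "x \<in> U" and bound: "occupation_bound A (ennreal e)" and e: "0 < e"
  shows "average_value P U f' c x \<le> average_value P U f c x + ereal (2 * M * e)"
  unfolding average_value_def[of P U f' c x]
proof (rule SUP_least)
  fix V assume "V \<in> {V. integrable_strategy P U x V}"
  then have I: "integrable_strategy P U x V" by simp
  note V = integrable_strategyD[OF I]
  interpret f: bounded_reward P U c f M by unfold_locales (rule f M)+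
  interpret f': bounded_reward P U c f' M by unfold_locales (rule f M)+
  obtain t where t: "\<And>n. 0 \<le> t n" "\<And>n. expected_time P V x n = ennreal (t n)" "filterlim t at_top sequentially"
    using expected_time_real[OF I] by blast
  have "f'.\<Phi> V x n \<le> f.\<Phi> V x n + ennreal (2 * M * e * t n)" for n
  proof -
    \<comment> \<open>The impulse amount is written \<open>0 + ennreal (2 * M) * 0\<close> to match
      \<open>mean_gain_add\<close> and \<open>mean_gain_cmult\<close>.\<close>
    have "f'.\<Phi> V x n \<le> mean_gain P (\<lambda>y. ennreal (f y + M) + ennreal (2 * M) * indicator A y) (\<lambda>_ _. 0 + ennreal (2 * M) * 0) V x n"
    proof (rule mean_gain_mono[OF V(1)])
      fix y
      show "ennreal (f' y + M) \<le> ennreal (f y + M) + ennreal (2 * M) * indicator A y"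
      proof (cases "y \<in> A")
        case True
        have "ennreal (f' y + M) \<le> ennreal (2 * M)" using M(2)[of y] by (intro ennreal_leI) linarith
        then show ?thesis using True by (simp add: add_increasing)
      qed (simp add: eq)
    qed simp
    also have "\<dots> = f.\<Phi> V x n + ennreal (2 * M) * mean_gain P (indicator A) (\<lambda>_ _. 0) V x n"
    proof -
      have "(\<lambda>y. ennreal (2 * M) * indicator A y) \<in> borel_measurable borel" using A by measurable
      from mean_gain_add[OF V(1) f.\<Phi>_measurable this f.zero_measurable(1), of "\<lambda>_ _. ennreal (2 * M) * 0" x n]
      show ?thesis
        using mean_gain_cmult[OF V(1) borel_measurable_indicator[OF A] f.zero_measurable(1), of "ennreal (2 * M)" x n]
        by simp
    qed
    also have "\<dots> \<le> f.\<Phi> V x n + ennreal (2 * M) * (ennreal e * expected_time P V x n)"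
      using mean_occupation_le[OF A bound _ V(1) x, of n] e
      by (intro add_left_mono mult_left_mono) (simp_all add: f.mean_gain_const_time[OF V(1)])
    also have "ennreal (2 * M) * (ennreal e * expected_time P V x n) = ennreal (2 * M * e * t n)"
      using t(1)[of n] e f.M_nonneg by (simp add: t(2) ennreal_mult mult.assoc)
    finally show ?thesis .
  qed
  note \<Phi>' = this
  have "eventually (\<lambda>n. mean_reward P U f' M c V x n / enn2ereal (expected_time P V x n) \<le>
      mean_reward P U f M c V x n / enn2ereal (expected_time P V x n) + ereal (2 * M * e)) sequentially"
    using filterlim_at_top_dense[THEN iffD1, OF t(3), rule_format, of 0]
  proof eventually_elim
    fix n assume tn: "0 < t n"
    have "a < \<infinity>" if "a \<le> ennreal (2 * M) * expected_time P V x n" for a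
      using V(2)[of n] by (intro le_less_trans[OF that]) (simp add: ennreal_mult_less_top)
    from this[OF f.\<Phi>_le[OF V(1)]] this[OF f'.\<Phi>_le[OF V(1)]]
    obtain u u' where u: "0 \<le> u" "f.\<Phi> V x n = ennreal u" "0 \<le> u'" "f'.\<Phi> V x n = ennreal u'"
      by (cases "f.\<Phi> V x n"; cases "f'.\<Phi> V x n") auto
    have pos: "0 \<le> 2 * M * e * t n" using f.M_nonneg e tn by simp
    have "ennreal u' \<le> ennreal (u + 2 * M * e * t n)"
      using \<Phi>'[of n] u pos by simp
    then have uu: "u' \<le> u + 2 * M * e * t n" using u pos by (subst (asm) ennreal_le_iff) auto
    show "mean_reward P U f' M c V x n / enn2ereal (expected_time P V x n) \<le>
      mean_reward P U f M c V x n / enn2ereal (expected_time P V x n) + ereal (2 * M * e)"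
    proof (cases "f.D V x n")
      case (real d)
      have "(u' - M * t n - d) / t n \<le> (u + 2 * M * e * t n - M * t n - d) / t n"
        using uu tn by (intro divide_right_mono) auto
      also have "\<dots> = (u - M * t n - d) / t n + 2 * M * e"
        using tn by (simp add: add_divide_distrib diff_divide_distrib)
      finally show ?thesis
        using u real tn by (simp add: mean_reward_def t(2))
    next
      case top
      then have "mean_reward P U f' M c V x n = - \<infinity>" using u tn by (simp add: mean_reward_def t(2))
      then show ?thesis using tn by (simp add: t(2))
    qed
  qed
  then have "average_reward P f' c x V \<le>
      liminf (\<lambda>n. mean_reward P U f M c V x n / enn2ereal (expected_time P V x n) + ereal (2 * M * e))"
    unfolding f'.average_reward_eq[OF I] by (rule Liminf_mono)
  also have "\<dots> = average_reward P f c x V + ereal (2 * M * e)"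
    unfolding f.average_reward_eq[OF I] by (rule Liminf_add_ereal_right) auto
  also have "\<dots> \<le> average_value P U f c x + ereal (2 * M * e)"
    unfolding average_value_def using I by (intro add_right_mono SUP_upper) simp
  finally show "average_reward P f' c x V \<le> average_value P U f c x + ereal (2 * M * e)" .
qed

text \<open>Multiplies out the quotients in (C), whose denominators are positive and finite.\<close>

lemma eventually_occupation_bound:
  assumes C: "assumption_C P U z" and e: "0 < e"
  shows "eventually (\<lambda>N. occupation_bound (- cball z N) e) at_top"
  using order_tendstoD(2)[OF C[unfolded assumption_C_def] e]
proof eventually_elim
  fix N
  let ?S = "\<lambda>x. {\<tau>. stopping_time path_filtration \<tau> \<and>
    0 < (\<integral>\<^sup>+\<omega>. \<tau> \<omega> \<partial>P x) \<and> (\<integral>\<^sup>+\<omega>. \<tau> \<omega> \<partial>P x) < \<infinity>}"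
  let ?q = "\<lambda>x \<tau>. (\<integral>\<^sup>+\<omega>. occupation_time (- cball z N) (\<tau> \<omega>) \<omega> \<partial>P x) / (\<integral>\<^sup>+\<omega>. \<tau> \<omega> \<partial>P x)"
  assume less: "(SUP x\<in>U. SUP \<tau>\<in>?S x. ?q x \<tau>) < e"
  show "occupation_bound (- cball z N) e"
    unfolding occupation_bound_def
  proof (intro ballI allI impI)
    fix x \<tau> assume x: "x \<in> U" and \<tau>: "stopping_time path_filtration \<tau>"
      "0 < (\<integral>\<^sup>+\<omega>. \<tau> \<omega> \<partial>P x)" "(\<integral>\<^sup>+\<omega>. \<tau> \<omega> \<partial>P x) < \<infinity>"
    let ?t = "\<integral>\<^sup>+\<omega>. \<tau> \<omega> \<partial>P x" and ?o = "\<integral>\<^sup>+\<omega>. occupation_time (- cball z N) (\<tau> \<omega>) \<omega> \<partial>P x"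
    have "?q x \<tau> \<le> (SUP \<tau>\<in>?S x. ?q x \<tau>)" by (rule SUP_upper) (use \<tau> in simp)
    also have "\<dots> \<le> (SUP x\<in>U. SUP \<tau>\<in>?S x. ?q x \<tau>)" by (rule SUP_upper[OF x])
    finally have "?q x \<tau> \<le> e" using less by simp
    then have "?q x \<tau> * ?t \<le> e * ?t" by (rule mult_right_mono) simp
    moreover have "?q x \<tau> * ?t = ?o"
      using \<tau>(2,3) by (simp add: mult.commute[of "?q x \<tau>"] ennreal_times_divide mult.commute[of ?t] mult_divide_eq_ennreal)
    ultimately show "?o \<le> e * ?t" by simp
  qed
qed

end

section \<open>The truncated reward, and convergence of extended reals\<close>

lemma proximity_continuous: "continuous_on UNIV (proximity A)"
  unfolding proximity_def by (cases "A = {}") (auto intro!: continuous_intros)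

lemma proximity_bounds: "0 \<le> proximity A x" "proximity A x \<le> 1"
  by (auto simp: proximity_def infdist_nonneg)

text \<open>Points of the ball of radius \<open>N\<close> have distance at least \<open>1\<close>
  from the complement of the ball of radius \<open>N + 1\<close>, so the second term vanishes; if
  that complement is empty, the convention in \<open>proximity\<close> gives the same.\<close>

lemma truncated_reward_cball:
  fixes f :: "'a::metric_space \<Rightarrow> real"
  assumes "x \<in> cball z N"
  shows "truncated_reward f z N x = f x"
proof -
  have "dist z x \<le> N" using assms by simp
  then have "0 \<le> N" using zero_le_dist[of z x] by linarith
  then have "proximity (cball z N) x = 1" using assms by (auto simp: proximity_def)
  moreover have "proximity (- cball z (N + 1)) x = 0"
  proof (cases "- cball z (N + 1) = {}")
    case False
    have "1 \<le> infdist x (- cball z (N + 1))"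
      unfolding infdist_notempty[OF False]
    proof (rule cINF_greatest[OF False])
      fix y assume "y \<in> - cball z (N + 1)"
      then show "1 \<le> dist x y" using assms dist_triangle[of z y x] by auto
    qed
    then show ?thesis by (simp add: proximity_def)
  qed (simp add: proximity_def)
  ultimately show ?thesis by (simp add: truncated_reward_def)
qed

text \<open>The additive bounds keep their meaning for an infinite limit \<open>L\<close>, where a
  difference of \<open>v N\<close> and \<open>L\<close> would not.\<close>

lemma tendsto_ereal_of_le_add:
  fixes L :: ereal and v :: "'b \<Rightarrow> ereal"
  assumes "\<And>e. 0 < e \<Longrightarrow> eventually (\<lambda>N. v N \<le> L + ereal e \<and> L \<le> v N + ereal e) F"
  shows "(v \<longlongrightarrow> L) F"
proof (rule order_tendstoI)
  fix a assume "a < L"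
  then obtain r where r: "a < ereal r" "ereal r < L" using ereal_dense2 by blast
  then obtain s where s: "ereal r < ereal s" "ereal s < L" using ereal_dense2 by blast
  have "0 < s - r" using s by simp
  from assms[OF this] show "eventually (\<lambda>N. a < v N) F"
  proof eventually_elim
    fix N assume "v N \<le> L + ereal (s - r) \<and> L \<le> v N + ereal (s - r)"
    then have "ereal s < v N + ereal (s - r)" using s by (meson less_le_trans)
    then have "ereal r < v N" by (cases "v N") auto
    then show "a < v N" using r by simp
  qed
next
  fix a assume "L < a"
  then obtain r where r: "L < ereal r" "ereal r < a" using ereal_dense2 by blast
  then obtain s where s: "L < ereal s" "ereal s < ereal r" using ereal_dense2 by blast
  have "0 < r - s" using s by simp
  from assms[OF this] show "eventually (\<lambda>N. v N < a) F"
  proof eventually_elim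
    fix N assume *: "v N \<le> L + ereal (r - s) \<and> L \<le> v N + ereal (r - s)"
    have "L + ereal (r - s) < ereal r" using s(1) by (cases L) auto
    then show "v N < a" using * r by (meson le_less_trans less_trans)
  qed
qed

theorem theorem12:
  fixes P :: "'a::metric_space \<Rightarrow> (real \<Rightarrow> 'a) measure"
    and U :: "'a set" and z :: 'a
    and f :: "'a \<Rightarrow> real" and c :: "'a \<Rightarrow> 'a \<Rightarrow> real"
    and \<mu> :: "'a measure" and lam :: real
  assumes "locally_compact_space (euclidean :: 'a topology)"
    and "markov_process P"
    and "compact U" and "z \<in> U"
    and "continuous_on UNIV f" and "bounded (range f)"
    and "continuous_on (UNIV \<times> U) (\<lambda>(x, a). c x a)"
    and "assumption_A1 P"
    and "assumption_A2 P \<mu>"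
    and "assumption_B1 U c"
    and "assumption_B2 P U c"
    and "assumption_B3 P U"
    and "assumption_B5 P U c"
    and "assumption_C P U z"
    and "\<not> (\<exists>k. AE x in \<mu>. f x = k)"
    and "Limsup (at_right 0) (\<lambda>\<alpha>. ereal \<alpha> * discounted_value P U f c \<alpha> z) = ereal lam"
    and "lam > (\<integral>x. f x \<partial>\<mu>)"
  shows "(\<forall>\<^sub>F N in at_top. \<exists>l. \<forall>x. truncated_value P U f c z N x = l) \<and>
    (\<forall>x. ((\<lambda>N. truncated_value P U f c z N x) \<longlongrightarrow> average_value P U f c x) at_top) \<and>
    (\<exists>l. \<forall>x. average_value P U f c x = l)"
proof -
  interpret markov_process P by fact
  interpret reward_setting P U c
  proof
    show "case_prod (cost U c) \<in> borel_measurable (borel \<Otimes>\<^sub>M borel)"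
      by (rule measurable_cost) fact+
    obtain c0 where "c0 < 0" "\<forall>x. \<forall>y\<in>U. c x y \<le> c0"
      using \<open>assumption_B1 U c\<close> unfolding assumption_B1_def by blast
    then show "c y a \<le> 0" if "a \<in> U" for y a using that by (meson less_imp_le order_trans)
  qed
  have "continuous_on (U \<times> U) (\<lambda>(x, a). c x a)"
    by (rule continuous_on_subset[OF \<open>continuous_on (UNIV \<times> U) (\<lambda>(x, a). c x a)\<close>]) auto
  then have "bounded ((\<lambda>(x, a). c x a) ` (U \<times> U))"
    using \<open>compact U\<close> by (intro compact_imp_bounded compact_continuous_image compact_Times)
  \<comment> \<open>The impulses that close periods lead from \<open>U\<close> to \<open>U\<close>,
    so a bound on the compact set \<open>U \<times> U\<close> suffices for them.\<close>
  then obtain K where "\<forall>p\<in>U \<times> U. \<bar>case p of (x, a) \<Rightarrow> c x a\<bar> \<le> K"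
    unfolding bounded_iff by auto
  then have K_cost: "cost U c a y \<le> ennreal K" if "a \<in> U" "y \<in> U" for a y
    using that by (fastforce simp: cost_def intro!: ennreal_leI)
  define B where "B = (SUP y. \<bar>f y\<bar>)"
  obtain b where "\<And>y. \<bar>f y\<bar> \<le> b"
    using \<open>bounded (range f)\<close> unfolding bounded_iff by auto
  then have "bdd_above (range (\<lambda>y. \<bar>f y\<bar>))" by (rule bdd_aboveI2)
  then have B: "\<bar>f y\<bar> \<le> B" for y unfolding B_def by (rule cSUP_upper[OF UNIV_I])
  have B0: "0 \<le> B" using B[of z] by linarith
  have f: "f \<in> borel_measurable borel"
    by (rule borel_measurable_continuous_onI) fact
  have fN: "truncated_reward f z N \<in> borel_measurable borel" for N
  proof (rule borel_measurable_continuous_onI)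
    show "continuous_on UNIV (truncated_reward f z N)"
      unfolding truncated_reward_def
      by (intro continuous_intros proximity_continuous) fact
  qed
  \<comment> \<open>A common bound for \<open>f\<close> and all truncated rewards: both proximities
    are at most \<open>1\<close>, so a truncated reward is at most \<open>B + (B + 1)\<close> in
    absolute value.\<close>
  define M where "M = 2 * B + 1"
  have f_M: "\<bar>f y\<bar> \<le> M" for y using B[of y] B0 unfolding M_def by linarith
  have fN_M: "\<bar>truncated_reward f z N y\<bar> \<le> M" for N y
  proof -
    have "\<bar>truncated_reward f z N y\<bar> \<le>
        \<bar>f y\<bar> * proximity (cball z N) y + (B + 1) * proximity (- cball z (N + 1)) y"
      unfolding truncated_reward_def B_def[symmetric]
      by (rule order_trans[OF abs_triangle_ineq]) (use B0 in \<open>simp add: abs_mult proximity_bounds(1)\<close>)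
    also have "\<dots> \<le> B * 1 + (B + 1) * 1"
      using B B0 by (intro add_mono mult_mono) (auto simp: proximity_bounds)
    finally show ?thesis by (simp add: M_def)
  qed
  note const = average_value_constant[OF f f_M ennreal_less_top[folded infinity_ennreal_def] K_cost]
  have constN: "truncated_value P U f c z N x = truncated_value P U f c z N y" for N x y
    unfolding truncated_value_def
    by (rule average_value_constant[OF fN fN_M ennreal_less_top[folded infinity_ennreal_def] K_cost])
  \<comment> \<open>(C) concerns starting points in \<open>U\<close>; the limit is therefore taken
    at \<open>z\<close> and then carried to every \<open>x\<close> by constancy in the starting
    point.\<close>
  have "((\<lambda>N. truncated_value P U f c z N z) \<longlongrightarrow> average_value P U f c z) at_top"
  proof (rule tendsto_ereal_of_le_add)
    fix \<delta> :: real assume \<delta>: "0 < \<delta>"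
    \<comment> \<open>Chosen to turn the error \<open>2 * M * e\<close> of
      \<open>average_value_le\<close> into \<open>\<delta>\<close>.\<close>
    define e where "e = \<delta> / (2 * M)"
    have M: "0 < M" using B0 by (simp add: M_def)
    then have e: "0 < e" "2 * M * e = \<delta>" using \<delta> by (simp_all add: e_def)
    have "0 < ennreal e" using e by simp
    from eventually_occupation_bound[OF \<open>assumption_C P U z\<close> this]
    show "\<forall>\<^sub>F N in at_top. truncated_value P U f c z N z \<le> average_value P U f c z + ereal \<delta> \<and>
        average_value P U f c z \<le> truncated_value P U f c z N z + ereal \<delta>"
    proof eventually_elim
      fix N assume bound: "occupation_bound (- cball z N) (ennreal e)"
      have A: "- cball z N \<in> sets borel" by (intro borel_open open_Compl closed_cball)
      show "truncated_value P U f c z N z \<le> average_value P U f c z + ereal \<delta> \<and>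
        average_value P U f c z \<le> truncated_value P U f c z N z + ereal \<delta>"
        unfolding truncated_value_def e(2)[symmetric]
        using average_value_le[OF f fN f_M fN_M A _ \<open>z \<in> U\<close> bound e(1)]
          average_value_le[OF fN f fN_M f_M A _ \<open>z \<in> U\<close> bound e(1)] truncated_reward_cball[of _ z N f]
        by auto
    qed
  qed
  then have "((\<lambda>N. truncated_value P U f c z N x) \<longlongrightarrow> average_value P U f c x) at_top" for x
    using const[of x z] constN[of _ x z] by simp
  moreover have "\<forall>\<^sub>F N in at_top. \<exists>l. \<forall>x. truncated_value P U f c z N x = l"
    using constN by (intro always_eventually) blast
  moreover have "\<exists>l. \<forall>x. average_value P U f c x = l" using const by blast
  ultimately show ?thesis by blast
qed

end
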